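(* Let $h\in C^{2+\nu}(\mathcal{T}^1)$ be positive, $Q=\{(y,Z):\ y\in\mathcal{T}^1,\ 0<Z<h(y)\}$, $\mu>0$, $s>0$, $M>0$, $\bar\varrho>0$. Let $p\in C^0[0,\bar\varrho)\cap C^1(0,\bar\varrho)$ satisfy $p(0)\ge0$, $p'(\varrho)>0$ for $\varrho\in(0,\bar\varrho)$, and $\lim_{\varrho\to\bar\varrho}p(\varrho)=+\infty$. Then there is at most one pair $(\varrho,v)$ with $$\varrho=\varrho(y),\quad 0\le\varrho\le\bar\varrho,\quad p(\varrho)\in L^2(\mathcal{T}^1),\qquad v,\ \partial_Zv\in L^2(Q),$$ satisfying $$\int_{\mathcal{T}^1}h\varrho\,dy=M,\qquad v|_{Z=0}=s,\qquad v|_{Z=h(y)}=0,$$ $$\partial_y\Bigl(\int_0^{h(y)}\varrho\,v\,dZ\Bigr)=0\ \text{ in }\mathcal{D}'(\mathcal{T}^1),\qquad -\mu\,\partial_Z^2v+\partial_yp(\varrho)=0\ \text{ in }\mathcal{D}'(Q).$$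
   Context: $\mathcal{T}^1$ is the one-dimensional torus (functions on it are periodic functions on $[0,1]$). Since $p(\varrho)\in L^2$ and $p$ blows up at $\bar\varrho$, $\varrho<\bar\varrho$ a.e. is implicit. The boundary values of $v$ at $Z=0$ and $Z=h(y)$ are understood as traces, which exist because $v,\partial_Zv\in L^2(Q)$. *)

theory Defs
  imports "HOL-Analysis.Analysis" "HOL-Library.Periodic_Fun"
begin

text \<open>
  A function on the one-dimensional torus is a function on the reals with period 1
  (\<^locale>\<open>periodic_fun_simple'\<close>); integrals over the torus are integrals over \<open>{0..1}\<close>.
  A function on (torus) x (reals) is a function on the plane that has period 1 in its
  first argument.
\<close>

abbreviation periodic1 :: "(real \<Rightarrow> real) \<Rightarrow> bool" where
  "periodic1 f \<equiv> periodic_fun_simple' f"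

abbreviation y_periodic :: "(real \<times> real \<Rightarrow> real) \<Rightarrow> bool" where
  "y_periodic f \<equiv> periodic_fun_simple' (\<lambda>y Z. f (y, Z))"

primrec C_diff :: "nat \<Rightarrow> ('a::euclidean_space \<Rightarrow> real) \<Rightarrow> bool" where
  "C_diff 0 f \<longleftrightarrow> continuous_on UNIV f"
| "C_diff (Suc k) f \<longleftrightarrow>
     (\<forall>x. f differentiable (at x)) \<and> (\<forall>d. C_diff k (\<lambda>x. frechet_derivative f (at x) d))"

definition smooth :: "('a::euclidean_space \<Rightarrow> real) \<Rightarrow> bool" where
  "smooth f \<longleftrightarrow> (\<forall>k. C_diff k f)"

text \<open>For a periodic second derivative, the Hoelder condition on the whole line is equivalent
  to the one with respect to the distance of the torus.\<close>

definition C2_holder_torus :: "real \<Rightarrow> (real \<Rightarrow> real) \<Rightarrow> bool" where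
  "C2_holder_torus \<nu> f \<longleftrightarrow> periodic1 f \<and> C_diff 2 f \<and>
     (\<exists>L. \<forall>x y. \<bar>deriv (deriv f) x - deriv (deriv f) y\<bar> \<le> L * \<bar>x - y\<bar> powr \<nu>)"

definition L2_on :: "'a::euclidean_space set \<Rightarrow> ('a \<Rightarrow> real) \<Rightarrow> bool" where
  "L2_on S f \<longleftrightarrow> f \<in> borel_measurable (lebesgue_on S) \<and> integrable (lebesgue_on S) (\<lambda>x. (f x)\<^sup>2)"

definition dy :: "(real \<times> real \<Rightarrow> real) \<Rightarrow> real \<times> real \<Rightarrow> real" where
  "dy f x = deriv (\<lambda>y. f (y, snd x)) (fst x)"

definition dZ :: "(real \<times> real \<Rightarrow> real) \<Rightarrow> real \<times> real \<Rightarrow> real" where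
  "dZ f x = deriv (\<lambda>Z. f (fst x, Z)) (snd x)"

text \<open>The lift of \<open>Q\<close> to the plane, and one period of it, over which integrals are taken.\<close>

definition Q_lift :: "(real \<Rightarrow> real) \<Rightarrow> (real \<times> real) set" where
  "Q_lift h = {(y, Z). 0 < Z \<and> Z < h y}"

definition Q :: "(real \<Rightarrow> real) \<Rightarrow> (real \<times> real) set" where
  "Q h = {(y, Z). 0 \<le> y \<and> y \<le> 1 \<and> 0 < Z \<and> Z < h y}"

definition test_torus :: "(real \<Rightarrow> real) \<Rightarrow> bool" where
  "test_torus \<psi> \<longleftrightarrow> smooth \<psi> \<and> periodic1 \<psi>"

text \<open>A periodic set is the lift of a compact set iff its part over one period is compact.\<close>

definition test_Q :: "(real \<Rightarrow> real) \<Rightarrow> (real \<times> real \<Rightarrow> real) \<Rightarrow> bool" where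
  "test_Q h \<phi> \<longleftrightarrow> smooth \<phi> \<and> y_periodic \<phi> \<and>
     closure {x. \<phi> x \<noteq> 0} \<subseteq> Q_lift h \<and>
     compact (closure {x. \<phi> x \<noteq> 0} \<inter> ({0..1} \<times> UNIV))"

definition weak_dZ :: "(real \<Rightarrow> real) \<Rightarrow> (real \<times> real \<Rightarrow> real) \<Rightarrow> (real \<times> real \<Rightarrow> real) \<Rightarrow> bool" where
  "weak_dZ h v w \<longleftrightarrow> (\<forall>\<phi>. test_Q h \<phi> \<longrightarrow>
     (LINT x|lebesgue_on (Q h). v x * dZ \<phi> x) = - (LINT x|lebesgue_on (Q h). w x * \<phi> x))"

definition in_V :: "(real \<Rightarrow> real) \<Rightarrow> (real \<times> real \<Rightarrow> real) \<Rightarrow> bool" where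
  "in_V h v \<longleftrightarrow> y_periodic v \<and> L2_on (Q h) v \<and> (\<exists>w. L2_on (Q h) w \<and> weak_dZ h v w)"

text \<open>The trace on the curve \<open>Z = b y\<close> (used for \<open>b = 0\<close> and \<open>b = h\<close>) is the extension by
  continuity, from functions smooth up to the boundary, of the restriction to the curve;
  \<open>v\<close> and its weak derivative carry the \<open>L\<^sup>2\<close> norm on \<open>Q\<close>, the traces the \<open>L\<^sup>2\<close> norm on the
  torus. The smooth functions are dense for the first norm.\<close>

definition has_trace ::
  "(real \<Rightarrow> real) \<Rightarrow> (real \<times> real \<Rightarrow> real) \<Rightarrow> (real \<Rightarrow> real) \<Rightarrow> (real \<Rightarrow> real) \<Rightarrow> bool" where
  "has_trace h v b g \<longleftrightarrow> L2_on (Q h) v \<and> L2_on {0..1} g \<and>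
     (\<exists>w \<phi>. L2_on (Q h) w \<and> weak_dZ h v w \<and>
        (\<forall>n::nat. smooth (\<phi> n) \<and> y_periodic (\<phi> n)) \<and>
        (\<lambda>n. LINT x|lebesgue_on (Q h). (\<phi> n x - v x)\<^sup>2) \<longlonglongrightarrow> 0 \<and>
        (\<lambda>n. LINT x|lebesgue_on (Q h). (dZ (\<phi> n) x - w x)\<^sup>2) \<longlonglongrightarrow> 0 \<and>
        (\<lambda>n. LINT y|lebesgue_on {0..1}. (\<phi> n (y, b y) - g y)\<^sup>2) \<longlonglongrightarrow> 0)"

definition flux :: "(real \<Rightarrow> real) \<Rightarrow> (real \<Rightarrow> real) \<Rightarrow> (real \<times> real \<Rightarrow> real) \<Rightarrow> real \<Rightarrow> real" where
  "flux h \<rho> v y = (LINT Z|lebesgue_on {0..h y}. \<rho> y * v (y, Z))"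

text \<open>In \<open>is_solution\<close>, \<open>p\<close> is a total function whose value at \<open>rmax\<close> is meaningless; the
  integrability of \<open>p(\<rho>)\<close>, with \<open>p\<close> infinite at \<open>rmax\<close>, contains the requirement
  \<open>\<rho> < rmax\<close> almost everywhere, which is therefore listed.\<close>

definition is_solution ::
  "(real \<Rightarrow> real) \<Rightarrow> (real \<Rightarrow> real) \<Rightarrow> real \<Rightarrow> real \<Rightarrow> real \<Rightarrow> real \<Rightarrow>
   (real \<Rightarrow> real) \<Rightarrow> (real \<times> real \<Rightarrow> real) \<Rightarrow> bool" where
  "is_solution h p \<mu> s M rmax \<rho> v \<longleftrightarrow>
     periodic1 \<rho> \<and> \<rho> \<in> borel_measurable (lebesgue_on {0..1}) \<and>
     (AE y in lebesgue_on {0..1}. 0 \<le> \<rho> y \<and> \<rho> y \<le> rmax) \<and>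
     (AE y in lebesgue_on {0..1}. \<rho> y < rmax) \<and>
     L2_on {0..1} (\<lambda>y. p (\<rho> y)) \<and>
     in_V h v \<and>
     (LINT y|lebesgue_on {0..1}. h y * \<rho> y) = M \<and>
     has_trace h v (\<lambda>_. 0) (\<lambda>_. s) \<and>
     has_trace h v h (\<lambda>_. 0) \<and>
     (\<forall>\<psi>. test_torus \<psi> \<longrightarrow>
        - (LINT y|lebesgue_on {0..1}. flux h \<rho> v y * deriv \<psi> y) = 0) \<and>
     (\<forall>\<phi>. test_Q h \<phi> \<longrightarrow>
        - \<mu> * (LINT x|lebesgue_on (Q h). v x * dZ (dZ \<phi>) x)
        - (LINT x|lebesgue_on (Q h). p (\<rho> (fst x)) * dy \<phi> x) = 0)"

end

theory Submission
  imports Defs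
begin

text \<open>
  Why the solution is unique. Testing the momentum equation with products \<open>\<psi> y * \<eta> Z\<close> separates the
  variables. A fixed profile \<open>\<eta>\<close> with positive integral shows that the pressure \<open>P = p (\<rho>)\<close> has an
  integrable weak derivative \<open>G\<close> on the torus, so that \<open>P\<close> agrees almost everywhere with a continuous
  function (\<open>weak_derivative_torus\<close>). Varying \<open>\<eta>\<close> shows that \<open>\<mu> \<partial>\<^sub>Z v - G Z\<close> is constant on almost every
  vertical segment (\<open>vertical_du_Bois_Reymond\<close>, \<open>momentum_reduction\<close>). The two traces, in the form of
  \<open>trace_formula\<close>, fix the remaining constants, so that
  \<open>v = G / (2 \<mu>) Z (Z - h) + s (1 - Z / h)\<close>, and conservation of mass becomes the Reynolds equation
  \<open>\<rho> (s h / 2 - G h\<^sup>3 / (12 \<mu>)) = C\<close> with a constant \<open>C\<close> (\<open>solution_reduction\<close>).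

  What remains concerns this first order equation for the pressure. Periodicity of \<open>P\<close> forces \<open>C > 0\<close>,
  and then \<open>\<rho>\<close> cannot vanish, since the pressure would fall below its least value \<open>p 0\<close> next to a zero;
  hence \<open>P\<close> is continuously differentiable and \<open>\<rho>\<close> is continuous and positive
  (\<open>pressure_regularity\<close>). Given two solutions, \<open>P1' = P2'\<close> at a minimum of \<open>P1 - P2\<close>, which reads
  \<open>C1 / \<rho>1 = C2 / \<rho>2\<close>. If \<open>C1 > C2\<close>, then \<open>\<rho>1 > \<rho>2\<close> at the minimum, so \<open>P1 > P2\<close> and \<open>\<rho>1 > \<rho>2\<close>
  everywhere, contradicting the equality of the masses. Hence \<open>C1 = C2\<close>, and now the same argument
  gives \<open>\<rho>1 \<ge> \<rho>2\<close> and \<open>\<rho>2 \<ge> \<rho>1\<close> (\<open>reynolds_comparison\<close>). Equality of the velocities follows from the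
  explicit profile.

  In every limit of test functions, smooth functions converge boundedly and pointwise to
  indicators of intervals, and dominated convergence applies; what is tested with
  indicators are second differences of primitives, and a continuous function with vanishing
  second differences is affine (\<open>linear_if_second_differences_vanish\<close>).
\<close>

section \<open>Smooth functions\<close>

lemma C_diff_continuous: "C_diff k f \<Longrightarrow> continuous_on UNIV f"
  by (cases k) (auto intro!: differentiable_imp_continuous_on simp: differentiable_on_def differentiable_at_withinI)

lemma C_diff_SucD: "C_diff (Suc k) f \<Longrightarrow> C_diff k f"
proof (induction k arbitrary: f)
  case 0
  then show ?case using C_diff_continuous[of "Suc 0" f] by simp
next
  case (Suc k)
  then show ?case by (metis C_diff.simps(2))
qed

lemma C_diff_const: "C_diff k (\<lambda>x. c)"
  by (induction k arbitrary: c) auto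

lemma C_diff_SucI:
  assumes "\<And>x. (f has_derivative f' x) (at x)" "\<And>d. C_diff k (\<lambda>x. f' x d)"
  shows "C_diff (Suc k) f"
proof -
  have "frechet_derivative f (at x) = f' x" for x
    using frechet_derivative_at[OF assms(1)] by simp
  then show ?thesis using assms by (auto simp: differentiable_def)
qed

lemma C_diff_has_derivative:
  "C_diff (Suc k) f \<Longrightarrow> (f has_derivative frechet_derivative f (at x)) (at x)"
  by (simp add: frechet_derivative_works)

lemma C_diff_bounded_linear:
  assumes "bounded_linear f" shows "C_diff k f"
proof (cases k)
  case 0 then show ?thesis using assms by (simp add: linear_continuous_on)
next
  case (Suc j)
  show ?thesis unfolding Suc
    by (rule C_diff_SucI[where f' = "\<lambda>_. f"])
       (use assms in \<open>auto intro: bounded_linear_imp_has_derivative C_diff_const\<close>)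
qed

lemma C_diff_add: "C_diff k f \<Longrightarrow> C_diff k g \<Longrightarrow> C_diff k (\<lambda>x. f x + g x)"
proof (induction k arbitrary: f g)
  case 0 then show ?case by (auto intro: continuous_intros)
next
  case (Suc k)
  note d = C_diff_has_derivative[OF Suc.prems(1)] C_diff_has_derivative[OF Suc.prems(2)]
  show ?case
    by (rule C_diff_SucI[OF has_derivative_add[OF d]], rule Suc.IH) (use Suc.prems in auto)
qed

lemma C_diff_mult: "C_diff k f \<Longrightarrow> C_diff k g \<Longrightarrow> C_diff k (\<lambda>x. f x * g x)"
proof (induction k arbitrary: f g)
  case 0 then show ?case by (auto intro: continuous_intros)
next
  case (Suc k)
  note d = C_diff_has_derivative[OF Suc.prems(1)] C_diff_has_derivative[OF Suc.prems(2)]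
  show ?case
    by (rule C_diff_SucI[OF has_derivative_mult[OF d]], intro C_diff_add Suc.IH)
       (use Suc.prems C_diff_SucD in auto)
qed

lemma frechet_derivative_eq_deriv:
  fixes g :: "real \<Rightarrow> real"
  assumes "(g has_real_derivative g') (at x)"
  shows "frechet_derivative g (at x) d = d * g'"
proof -
  have "(g has_derivative (\<lambda>d. d * g')) (at x)"
    using assms by (simp add: has_field_derivative_def mult_commute_abs)
  then have "frechet_derivative g (at x) = (\<lambda>d. d * g')"
    using frechet_derivative_at by fastforce
  then show ?thesis by simp
qed

text \<open>On the line, differentiability in the sense of Frechet derivatives reduces to the ordinary
  derivative; this and the converse below let one-dimensional calculus rules be used.\<close>

lemma C_diff_real_Suc:
  fixes g :: "real \<Rightarrow> real"
  assumes "C_diff (Suc k) g"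
  obtains g' where "\<And>x. (g has_real_derivative g' x) (at x)" "C_diff k g'"
proof -
  have *: "(g has_real_derivative frechet_derivative g (at x) 1) (at x)" for x
  proof -
    have "g differentiable at x" using assms by simp
    then obtain D where D: "(g has_real_derivative D) (at x)"
      by (auto simp: real_differentiable_def)
    from frechet_derivative_eq_deriv[OF this, of 1] D show ?thesis by simp
  qed
  show ?thesis using that[OF *] assms by simp
qed

lemma C_diff_real_SucI:
  fixes g :: "real \<Rightarrow> real"
  assumes "\<And>x. (g has_real_derivative g' x) (at x)" "C_diff k g'"
  shows "C_diff (Suc k) g"
  by (rule C_diff_SucI[where f' = "\<lambda>x d. g' x * d"])
     (use assms in \<open>auto simp: has_field_derivative_def intro!: C_diff_mult C_diff_const\<close>)

lemma C_diff_compose: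
  fixes g :: "real \<Rightarrow> real"
  shows "C_diff k g \<Longrightarrow> C_diff k f \<Longrightarrow> C_diff k (\<lambda>x. g (f x))"
proof (induction k arbitrary: f g)
  case 0
  then show ?case
    using continuous_on_compose[of UNIV f g] by (auto simp: o_def intro: continuous_on_subset)
next
  case (Suc k)
  obtain g' where g': "\<And>x. (g has_real_derivative g' x) (at x)" "C_diff k g'"
    using C_diff_real_Suc[OF Suc.prems(1)] by blast
  note d = C_diff_has_derivative[OF Suc.prems(2)]
  have "((\<lambda>x. g (f x)) has_derivative (\<lambda>d. g' (f x) * frechet_derivative f (at x) d)) (at x)" for x
    using has_derivative_compose[OF d[of x], of g "(*) (g' (f x))"] g'(1)
    by (simp add: has_field_derivative_def)
  then show ?case
    by (rule C_diff_SucI, intro C_diff_mult)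
       (use Suc.IH[OF g'(2) C_diff_SucD[OF Suc.prems(2)]] Suc.prems in auto)
qed

lemma smooth_const: "smooth (\<lambda>x. c)"
  and smooth_bounded_linear: "bounded_linear f \<Longrightarrow> smooth f"
  by (simp_all add: smooth_def C_diff_const C_diff_bounded_linear)

lemma smooth_add: "smooth f \<Longrightarrow> smooth g \<Longrightarrow> smooth (\<lambda>x. f x + g x)"
  and smooth_mult: "smooth f \<Longrightarrow> smooth g \<Longrightarrow> smooth (\<lambda>x. f x * g x)"
  by (simp_all add: smooth_def C_diff_add C_diff_mult)

lemma smooth_compose: "smooth g \<Longrightarrow> smooth f \<Longrightarrow> smooth (\<lambda>x. g (f x))" for g :: "real \<Rightarrow> real"
  by (simp add: smooth_def C_diff_compose)

lemma smooth_diff: "smooth f \<Longrightarrow> smooth g \<Longrightarrow> smooth (\<lambda>x. f x - g x)"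
  using smooth_add[of f "\<lambda>x. - 1 * g x"] smooth_mult[OF smooth_const[of "-1"], of g] by simp

lemma smooth_continuous: "smooth f \<Longrightarrow> continuous_on UNIV f"
  using C_diff_continuous smooth_def by blast

lemma smooth_real_deriv:
  fixes g :: "real \<Rightarrow> real"
  assumes "smooth g"
  shows "(g has_real_derivative deriv g x) (at x)" "smooth (deriv g)"
proof -
  have *: "C_diff (Suc k) g" for k using assms by (simp add: smooth_def)
  from C_diff_real_Suc[OF *] have d: "(g has_real_derivative deriv g x) (at x)" for x
    by (metis DERIV_imp_deriv)
  show "(g has_real_derivative deriv g x) (at x)" by fact
  have "C_diff k (deriv g)" for k
  proof -
    obtain g' where g': "\<And>x. (g has_real_derivative g' x) (at x)" "C_diff k g'"
      using C_diff_real_Suc[OF *] by blast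
    then have "g' = deriv g" using d DERIV_unique by blast
    with g' show ?thesis by simp
  qed
  then show "smooth (deriv g)" by (simp add: smooth_def)
qed

lemma smooth_real_antiderivative:
  fixes g :: "real \<Rightarrow> real"
  assumes "\<And>x. (g has_real_derivative g' x) (at x)" "smooth g'"
  shows "smooth g"
proof -
  have "C_diff k g" for k
    using C_diff_real_SucI[OF assms(1), of k] assms(2) C_diff_SucD by (auto simp: smooth_def)
  then show ?thesis by (simp add: smooth_def)
qed

lemma smooth_cos: "smooth (cos :: real \<Rightarrow> real)"
proof -
  have "C_diff k (sin :: real \<Rightarrow> real) \<and> C_diff k (cos :: real \<Rightarrow> real)" for k
  proof (induction k)
    case 0 then show ?case by (auto intro: continuous_intros)
  next
    case (Suc k)
    have "C_diff k (\<lambda>x. - 1 * sin x :: real)" using Suc by (intro C_diff_mult C_diff_const) auto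
    then have "C_diff (Suc k) (cos :: real \<Rightarrow> real)"
      by (intro C_diff_real_SucI[where g' = "\<lambda>x. - 1 * sin x"]) (auto intro!: derivative_eq_intros)
    moreover have "C_diff (Suc k) (sin :: real \<Rightarrow> real)"
      by (rule C_diff_real_SucI[where g' = cos]) (use Suc in \<open>auto intro!: derivative_eq_intros\<close>)
    ultimately show ?case by blast
  qed
  then show ?thesis by (simp add: smooth_def)
qed

text \<open>The members with \<open>k > 0\<close> are only there to close the family under differentiation, which
  is how smoothness of \<open>flat 0\<close>, the function \<open>exp (- 1 / x)\<close> extended by zero, is proved.\<close>

definition flat :: "nat \<Rightarrow> real \<Rightarrow> real" where
  "flat k x = (if x > 0 then inverse x ^ k * exp (- inverse x) else 0)"

lemma flat_tendsto_0: "(flat k \<longlongrightarrow> 0) (at 0)"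
proof -
  have "((\<lambda>x::real. inverse x ^ k / exp (inverse x)) \<longlongrightarrow> 0) (at_right 0)"
    using filterlim_compose[OF tendsto_power_div_exp_0 filterlim_inverse_at_top_right] .
  then have r: "(flat k \<longlongrightarrow> 0) (at_right 0)"
    by (rule tendsto_cong[THEN iffD1, rotated])
       (auto simp: flat_def eventually_at_filter exp_minus divide_inverse)
  have l: "(flat k \<longlongrightarrow> 0) (at_left 0)"
    by (rule tendsto_eventually) (auto simp: flat_def eventually_at_filter)
  show ?thesis using l r by (simp add: filterlim_at_split)
qed

lemma flat_deriv: "(flat k has_real_derivative flat (k + 2) x - real k * flat (k + 1) x) (at x)"
proof -
  consider "x > 0" | "x < 0" | "x = 0" by linarith
  then show ?thesis
  proof cases
    case 1
    have "((\<lambda>x. inverse x ^ k * exp (- inverse x)) has_real_derivative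
        real k * (- (inverse x ^ Suc (Suc 0))) * inverse x ^ (k - 1) * exp (- inverse x)
        + exp (- inverse x) * (inverse x ^ Suc (Suc 0)) * inverse x ^ k) (at x)"
      using 1 by (intro derivative_eq_intros refl) auto
    also have "real k * (- (inverse x ^ Suc (Suc 0))) * inverse x ^ (k - 1) * exp (- inverse x)
        + exp (- inverse x) * (inverse x ^ Suc (Suc 0)) * inverse x ^ k
        = flat (k + 2) x - real k * flat (k + 1) x"
      by (cases k) (use 1 in \<open>simp_all add: flat_def algebra_simps\<close>)
    finally have "((\<lambda>x. inverse x ^ k * exp (- inverse x)) has_real_derivative
        flat (k + 2) x - real k * flat (k + 1) x) (at x)" .
    then show ?thesis
      by (rule has_field_derivative_transform_within_open[where S = "{0<..}"]) (use 1 in \<open>auto simp: flat_def\<close>)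
  next
    case 2
    have "((\<lambda>x. 0) has_real_derivative flat (k + 2) x - real k * flat (k + 1) x) (at x)"
      using 2 by (simp add: flat_def)
    then show ?thesis
      by (rule has_field_derivative_transform_within_open[where S = "{..<0}"]) (use 2 in \<open>auto simp: flat_def\<close>)
  next
    case 3
    have "(\<lambda>h. (flat k (0 + h) - flat k 0) / h) = flat (k + 1)"
      by (auto simp: flat_def fun_eq_iff field_simps)
    then show ?thesis using flat_tendsto_0[of "k + 1"] 3 by (simp add: DERIV_def flat_def)
  qed
qed

lemma smooth_flat: "smooth (flat k)"
proof -
  have "C_diff n (flat k)" for n
  proof (induction n arbitrary: k)
    case 0
    have "isCont (flat k) x" for x using flat_deriv DERIV_isCont by blast
    then show ?case by (simp add: continuous_at_imp_continuous_on)
  next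
    case (Suc n)
    have "C_diff n (\<lambda>x. flat (k + 2) x + (- real k) * flat (k + 1) x)"
      by (intro C_diff_add C_diff_mult C_diff_const Suc)
    then have "C_diff n (\<lambda>x. flat (k + 2) x - real k * flat (k + 1) x)" by simp
    then show ?case by (rule C_diff_real_SucI[OF flat_deriv])
  qed
  then show ?thesis by (simp add: smooth_def)
qed

lemma flat_bounds: "0 \<le> flat 0 x" "flat 0 x \<le> 1" "x \<le> 0 \<Longrightarrow> flat 0 x = 0"
  by (auto simp: flat_def)

text \<open>Dilating the argument turns the flat function into an approximation of the Heaviside function
  that is bounded and converges at every point. Every test function below is built from it, so
  that dominated convergence replaces mollification.\<close>

lemma flat_limit: "(\<lambda>n. flat 0 (real n * x)) \<longlonglongrightarrow> indicator {0<..} x"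
proof (cases "x > 0")
  case True
  have "(\<lambda>n. exp (- (inverse (real n) * inverse x))) \<longlonglongrightarrow> exp (- (0 * inverse x))"
    by (intro tendsto_intros lim_inverse_n)
  then have "(\<lambda>n. exp (- (inverse (real n) * inverse x))) \<longlonglongrightarrow> 1" by simp
  moreover have "\<forall>\<^sub>F n in sequentially. exp (- (inverse (real n) * inverse x)) = flat 0 (real n * x)"
    using eventually_gt_at_top[of 0] by eventually_elim (use True in \<open>simp add: flat_def\<close>)
  ultimately show ?thesis using True by (simp add: tendsto_cong)
next
  case False
  have "flat 0 (real n * x) = 0" for n
    by (rule flat_bounds) (use False in \<open>simp add: mult_nonneg_nonpos\<close>)
  then show ?thesis using False by simp
qed

section \<open>Test functions\<close>

text \<open>Being a function of \<open>cos (2 * pi * (y - m))\<close>, this bump is periodic and smooth at once; it lives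
  on the translates by integers of the interval of radius \<open>r\<close> around \<open>m\<close>.\<close>

definition torus_bump :: "nat \<Rightarrow> real \<Rightarrow> real \<Rightarrow> real \<Rightarrow> real" where
  "torus_bump n m r y = flat 0 (real n * (cos (2 * pi * (y - m)) - cos (2 * pi * r)))"

lemma cos_dist_int: "cos (2 * pi * z) = cos (2 * pi * \<bar>z - of_int k\<bar>)" for z :: real and k :: int
proof -
  have "cos (2 * pi * z) = cos (2 * pi * (z - of_int k))"
    by (rule cos_eq_periodic_intro) (auto simp: algebra_simps intro!: exI[of _ k])
  also have "\<dots> = cos \<bar>2 * pi * (z - of_int k)\<bar>" by (simp add: cos_abs_real)
  finally show ?thesis by (simp add: abs_mult)
qed

lemma near_int_if_cos_ge:
  fixes z r :: real
  assumes r: "0 < r" "r < 1/2" and ge: "cos (2 * pi * z) \<ge> cos (2 * pi * r)"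
  shows "\<exists>k::int. \<bar>z - of_int k\<bar> \<le> r"
proof -
  define t where "t = \<bar>z - of_int (round z)\<bar>"
  have t: "0 \<le> t" "t \<le> 1/2"
    using of_int_round_abs_le[of z] by (simp_all add: t_def abs_minus_commute)
  have "cos (2 * pi * t) \<ge> cos (2 * pi * r)"
    using ge cos_dist_int[of z "round z"] by (simp add: t_def)
  then have "t \<le> r" using cos_mono_le_eq[of "2 * pi * r" "2 * pi * t"] t r by simp
  then show ?thesis unfolding t_def by blast
qed

lemma cos_lt_iff_near_int:
  fixes z r :: real
  assumes "0 < r" "r < 1/2"
  shows "cos (2 * pi * z) > cos (2 * pi * r) \<longleftrightarrow> (\<exists>k::int. \<bar>z - of_int k\<bar> < r)"
proof -
  note per = cos_dist_int[of z]
  have cmp: "cos (2 * pi * t) > cos (2 * pi * r) \<longleftrightarrow> t < r" if "0 \<le> t" "t \<le> 1/2" for t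
    using cos_mono_less_eq[of "2 * pi * r" "2 * pi * t"] that assms by simp
  show ?thesis
  proof
    assume "cos (2 * pi * z) > cos (2 * pi * r)"
    moreover have "\<bar>z - of_int (round z)\<bar> \<le> 1/2" using of_int_round_abs_le[of z] by (simp add: abs_minus_commute)
    ultimately show "\<exists>k::int. \<bar>z - of_int k\<bar> < r"
      using per[of "round z"] cmp[of "\<bar>z - of_int (round z)\<bar>"] by auto
  next
    assume "\<exists>k::int. \<bar>z - of_int k\<bar> < r"
    then obtain k :: int where "\<bar>z - of_int k\<bar> < r" by blast
    then show "cos (2 * pi * z) > cos (2 * pi * r)"
      using per[of k] cmp[of "\<bar>z - of_int k\<bar>"] assms by auto
  qed
qed

lemma smooth_torus_bump: "smooth (torus_bump n m r)"
proof -
  have "smooth (\<lambda>y. flat 0 (real n * (cos (2 * pi * (y - m)) - cos (2 * pi * r))))"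
    by (intro smooth_compose[OF smooth_flat] smooth_mult smooth_const smooth_diff
          smooth_compose[OF smooth_cos] smooth_bounded_linear bounded_linear_ident)
  then show ?thesis by (simp add: torus_bump_def[abs_def])
qed

lemma torus_bump_bounds: "0 \<le> torus_bump n m r y" "torus_bump n m r y \<le> 1"
  by (simp_all add: torus_bump_def flat_bounds)

lemma torus_bump_plus_1: "torus_bump n m r (y + 1) = torus_bump n m r y"
proof -
  have "cos (2 * pi * (y + 1 - m)) = cos (2 * pi * (y - m))"
    by (rule cos_eq_periodic_intro) (auto simp: algebra_simps intro!: exI[of _ 1])
  then show ?thesis by (simp add: torus_bump_def)
qed

lemma torus_bump_translate: "torus_bump n 0 r (y - m) = torus_bump n m r y"
  by (simp add: torus_bump_def)

lemma torus_bump_limit: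
  assumes "0 < m - r" "m + r < 1" "0 < r" "0 \<le> y" "y \<le> 1"
  shows "(\<lambda>n. torus_bump n m r y) \<longlonglongrightarrow> indicator {m - r<..<m + r} y"
proof -
  have "(\<exists>k::int. \<bar>y - m - of_int k\<bar> < r) \<longleftrightarrow> \<bar>y - m\<bar> < r"
  proof
    assume "\<exists>k::int. \<bar>y - m - of_int k\<bar> < r"
    then obtain k :: int where k: "\<bar>y - m - of_int k\<bar> < r" by blast
    have "of_int k < (1::real)" "of_int k > (-1::real)"
      using k assms by linarith+
    then have "k = 0" by simp
    then show "\<bar>y - m\<bar> < r" using k by simp
  qed (auto intro!: exI[of _ 0])
  then have "indicator {0<..} (cos (2 * pi * (y - m)) - cos (2 * pi * r)) = (indicator {m - r<..<m + r} y :: real)"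
    using cos_lt_iff_near_int[of r "y - m"] assms by (auto simp: indicator_def abs_less_iff)
  with flat_limit[of "cos (2 * pi * (y - m)) - cos (2 * pi * r)"]
  show ?thesis by (simp add: torus_bump_def)
qed

lemma smooth_antiderivative_exists:
  fixes g :: "real \<Rightarrow> real"
  assumes "smooth g"
  obtains G where "smooth G" "\<And>x. (G has_real_derivative g x) (at x)"
proof -
  have "\<exists>F. \<forall>x. -\<infinity> < ereal x \<longrightarrow> ereal x < \<infinity> \<longrightarrow> (F has_vector_derivative g x) (at x)"
    by (rule einterval_antiderivative)
       (use smooth_continuous[OF assms] in \<open>auto simp: continuous_on_eq_continuous_at\<close>)
  then obtain F where "\<And>x. (F has_real_derivative g x) (at x)"
    by (auto simp: has_real_derivative_iff_has_vector_derivative)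
  then show ?thesis using that smooth_real_antiderivative[OF _ assms] by blast
qed

lemma has_real_derivative_shift:
  fixes G :: "real \<Rightarrow> real"
  assumes "\<And>x. (G has_real_derivative g x) (at x)"
  shows "((\<lambda>y. G (y - a)) has_real_derivative g (y - a)) (at y)"
proof -
  have "((\<lambda>y. y - a) has_real_derivative 1) (at y)" by (auto intro!: derivative_eq_intros)
  from DERIV_chain2[OF assms this] show ?thesis by simp
qed

lemma periodic1_I: "(\<And>x. f (x + 1) = f x) \<Longrightarrow> periodic1 f"
  by unfold_locales

text \<open>The difference of the indicators of two adjacent intervals of equal length has mean zero, hence
  a periodic primitive. Testing with smooth approximations of that primitive gives second
  differences of the primitive of the tested function. Equality of lengths matters: both
  approximations are translates of one bump, so the mean is zero before the limit too.\<close>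

lemma test_torus_step:
  fixes c \<delta> :: real
  assumes "0 < c" "0 < \<delta>" "c + 2 * \<delta> < 1"
  obtains \<Psi> where "\<And>n. test_torus (\<Psi> n)" "\<And>n y. \<bar>deriv (\<Psi> n) y\<bar> \<le> 1"
    "\<And>y. 0 \<le> y \<Longrightarrow> y \<le> 1 \<Longrightarrow> (\<lambda>n::nat. deriv (\<Psi> n) y) \<longlonglongrightarrow>
       indicator {c<..<c + \<delta>} y - indicator {c + \<delta><..<c + 2 * \<delta>} y"
proof -
  let ?r = "\<delta> / 2" and ?m = "c + \<delta> / 2" and ?m' = "c + 3 * \<delta> / 2"
  have "\<exists>G. smooth G \<and> (\<forall>x. (G has_real_derivative torus_bump n 0 ?r x) (at x))" for n
    using smooth_antiderivative_exists[OF smooth_torus_bump] by metis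
  then obtain G where G: "\<And>n. smooth (G n)" "\<And>n x. (G n has_real_derivative torus_bump n 0 ?r x) (at x)"
    by metis
  define \<Psi> where "\<Psi> n y = G n (y - ?m) - G n (y - ?m')" for n y
  have dP: "(\<Psi> n has_real_derivative torus_bump n ?m ?r y - torus_bump n ?m' ?r y) (at y)" for n y
  proof -
    have "((\<lambda>y. G n (y - ?m) - G n (y - ?m')) has_real_derivative
       torus_bump n 0 ?r (y - ?m) * 1 - torus_bump n 0 ?r (y - ?m') * 1) (at y)"
      unfolding mult_1_right by (intro DERIV_diff has_real_derivative_shift G(2))
    then show ?thesis by (simp add: \<Psi>_def[abs_def] torus_bump_translate)
  qed
  then have dP': "deriv (\<Psi> n) y = torus_bump n ?m ?r y - torus_bump n ?m' ?r y" for n y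
    using DERIV_imp_deriv by blast
  have sm: "smooth (\<Psi> n)" for n
    by (rule smooth_real_antiderivative[OF dP]) (intro smooth_diff smooth_torus_bump)
  \<comment> \<open>the increment of \<open>G n\<close> over a period is the mean of the bump, the same at every point\<close>
  have const: "G n (x + 1) - G n x = G n (x' + 1) - G n x'" for n x x'
  proof -
    have "((\<lambda>x. G n (x - (- 1)) - G n x) has_real_derivative
        torus_bump n 0 ?r (x - (- 1)) * 1 - torus_bump n 0 ?r x) (at x)" for x
      by (rule derivative_intros DERIV_chain2[OF G(2)] G(2) refl | (rule derivative_eq_intros | simp)+)+
    then have "\<forall>x. ((\<lambda>x. G n (x - (- 1)) - G n x) has_real_derivative 0) (at x)"
      by (simp add: torus_bump_plus_1)
    from DERIV_isconst_all[OF this, of x x'] show ?thesis by simp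
  qed
  have "\<Psi> n (y + 1) = \<Psi> n y" for n y
    using const[of n "y - ?m" "y - ?m'"] by (simp add: \<Psi>_def algebra_simps)
  then have "test_torus (\<Psi> n)" for n
    using sm by (simp add: test_torus_def periodic1_I)
  moreover have "\<bar>deriv (\<Psi> n) y\<bar> \<le> 1" for n y
    using torus_bump_bounds[of n ?m ?r y] torus_bump_bounds[of n ?m' ?r y] by (simp add: dP' abs_le_iff)
  moreover have "(\<lambda>n. deriv (\<Psi> n) y) \<longlonglongrightarrow>
       indicator {c<..<c + \<delta>} y - indicator {c + \<delta><..<c + 2 * \<delta>} y" if "0 \<le> y" "y \<le> 1" for y
  proof -
    have "(\<lambda>n. torus_bump n ?m ?r y - torus_bump n ?m' ?r y) \<longlonglongrightarrow>
       indicator {?m - ?r<..<?m + ?r} y - indicator {?m' - ?r<..<?m' + ?r} y"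
      by (intro tendsto_diff torus_bump_limit) (use assms that in \<open>auto simp: field_simps\<close>)
    then show ?thesis by (simp add: dP' add_divide_distrib[symmetric] algebra_simps)
  qed
  ultimately show ?thesis using that by blast
qed

text \<open>The counterpart on the line: the mean zero property becomes compact support of the primitive.\<close>

lemma test_line_step:
  fixes c \<delta> :: real
  assumes "0 < \<delta>"
  obtains \<eta> where "\<And>n. smooth (\<eta> n)" "\<And>n Z. Z \<notin> {c..c + 2 * \<delta>} \<Longrightarrow> \<eta> n Z = 0"
    "\<And>n Z. \<bar>deriv (\<eta> n) Z\<bar> \<le> 1"
    "\<And>Z. (\<lambda>n::nat. deriv (\<eta> n) Z) \<longlonglongrightarrow>
       indicator {c<..<c + \<delta>} Z - indicator {c + \<delta><..<c + 2 * \<delta>} Z"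
proof -
  define g where "g n x = flat 0 (real n * x) * flat 0 (real n * (\<delta> - x))" for n x
  have smg: "smooth (g n)" for n
    unfolding g_def[abs_def]
    by (intro smooth_mult smooth_compose[OF smooth_flat] smooth_const smooth_diff
          smooth_bounded_linear bounded_linear_ident)
  have g0: "g n x = 0" if "x \<le> 0 \<or> x \<ge> \<delta>" for n x
    using that flat_bounds(3)[of "real n * x"] flat_bounds(3)[of "real n * (\<delta> - x)"]
    by (auto simp: g_def mult_nonneg_nonpos)
  have gb: "0 \<le> g n x" "g n x \<le> 1" for n x
    using flat_bounds by (auto simp: g_def intro: mult_le_one)
  have glim: "(\<lambda>n. g n x) \<longlonglongrightarrow> indicator {0<..<\<delta>} x" for x
  proof -
    have "(\<lambda>n. g n x) \<longlonglongrightarrow> indicator {0<..} x * indicator {0<..} (\<delta> - x)"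
      unfolding g_def by (intro tendsto_mult flat_limit)
    moreover have "indicator {0<..} x * indicator {0<..} (\<delta> - x) = (indicator {0<..<\<delta>} x :: real)"
      by (auto simp: indicator_def)
    ultimately show ?thesis by simp
  qed
  have "\<exists>G. smooth G \<and> (\<forall>x. (G has_real_derivative g n x) (at x))" for n
    using smooth_antiderivative_exists[OF smg] by metis
  then obtain G where G: "\<And>n. smooth (G n)" "\<And>n x. (G n has_real_derivative g n x) (at x)"
    by metis
  have Gl: "G n x = G n x'" if "x \<le> x'" "x' \<le> 0 \<or> \<delta> \<le> x" for n x x'
  proof (cases "x = x'")
    case False
    have "\<exists>z>x. z < x' \<and> G n x' - G n x = (x' - x) * g n z"
      by (rule MVT2) (use that False G in auto)
    then obtain z where "z > x" "z < x'" "G n x' - G n x = (x' - x) * g n z" by blast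
    then show ?thesis using that g0[of z n] by auto
  qed simp
  define \<eta> where "\<eta> n y = G n (y - c) - G n (y - (c + \<delta>))" for n y
  have dP: "(\<eta> n has_real_derivative g n (y - c) - g n (y - (c + \<delta>))) (at y)" for n y
  proof -
    have "((\<lambda>y. G n (y - c) - G n (y - (c + \<delta>))) has_real_derivative
       g n (y - c) * 1 - g n (y - (c + \<delta>)) * 1) (at y)"
      unfolding mult_1_right by (intro DERIV_diff has_real_derivative_shift G(2))
    then show ?thesis by (simp add: \<eta>_def[abs_def])
  qed
  then have dP': "deriv (\<eta> n) y = g n (y - c) - g n (y - (c + \<delta>))" for n y
    using DERIV_imp_deriv by blast
  have sm: "smooth (\<eta> n)" for n
    by (rule smooth_real_antiderivative[OF dP])
       (intro smooth_diff smooth_compose[OF smg] smooth_const smooth_bounded_linear bounded_linear_ident)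
  moreover have "\<eta> n Z = 0" if "Z \<notin> {c..c + 2 * \<delta>}" for n Z
    using Gl[of "Z - (c + \<delta>)" "Z - c" n] that assms by (auto simp: \<eta>_def)
  moreover have "\<bar>deriv (\<eta> n) y\<bar> \<le> 1" for n y
    using gb[of n "y - c"] gb[of n "y - (c + \<delta>)"] by (simp add: dP' abs_le_iff)
  moreover have "(\<lambda>n. deriv (\<eta> n) y) \<longlonglongrightarrow>
       indicator {c<..<c + \<delta>} y - indicator {c + \<delta><..<c + 2 * \<delta>} y" for y
  proof -
    have "(\<lambda>n. g n (y - c) - g n (y - (c + \<delta>))) \<longlonglongrightarrow>
       indicator {0<..<\<delta>} (y - c) - indicator {0<..<\<delta>} (y - (c + \<delta>))"
      by (intro tendsto_diff glim)
    moreover have "(indicator {0<..<\<delta>} (y - c) :: real) = indicator {c<..<c + \<delta>} y"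
      "(indicator {0<..<\<delta>} (y - (c + \<delta>)) :: real) = indicator {c + \<delta><..<c + 2 * \<delta>} y"
      by (auto simp: indicator_def)
    ultimately show ?thesis by (simp add: dP')
  qed
  ultimately show ?thesis using that by blast
qed

abbreviation tensor :: "(real \<Rightarrow> real) \<Rightarrow> (real \<Rightarrow> real) \<Rightarrow> real \<times> real \<Rightarrow> real" where
  "tensor \<psi> \<eta> \<equiv> \<lambda>x. \<psi> (fst x) * \<eta> (snd x)"

text \<open>The closed set \<open>S\<close> is one over which the strip up to height \<open>b\<close> lies in the
  domain; it absorbs the dependence of the domain on \<open>y\<close>.\<close>

lemma test_Q_tensor:
  assumes \<psi>: "test_torus \<psi>" and \<eta>: "smooth \<eta>"
    and S: "closed S" "\<And>y. y \<notin> S \<Longrightarrow> \<psi> y = 0" and ab: "\<And>Z. Z \<notin> {a..b} \<Longrightarrow> \<eta> Z = 0"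
    and h: "0 < a" "\<And>y. y \<in> S \<Longrightarrow> b < h y"
  shows "test_Q h (tensor \<psi> \<eta>)"
proof -
  have "smooth (\<lambda>x::real \<times> real. \<psi> (fst x))" "smooth (\<lambda>x::real \<times> real. \<eta> (snd x))"
    using \<psi> \<eta> smooth_compose[OF _ smooth_bounded_linear[OF bounded_linear_fst]]
      smooth_compose[OF _ smooth_bounded_linear[OF bounded_linear_snd]]
    by (auto simp: test_torus_def)
  then have "smooth (tensor \<psi> \<eta>)" by (rule smooth_mult)
  moreover have "y_periodic (tensor \<psi> \<eta>)"
    using \<psi> by (auto simp: test_torus_def periodic_fun_simple'_def)
  moreover have cl: "closure {x. tensor \<psi> \<eta> x \<noteq> 0} \<subseteq> S \<times> {a..b}"
  proof (rule closure_minimal)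
    show "{x. tensor \<psi> \<eta> x \<noteq> 0} \<subseteq> S \<times> {a..b}"
    proof
      fix x assume "x \<in> {x. tensor \<psi> \<eta> x \<noteq> 0}"
      then show "x \<in> S \<times> {a..b}" using S(2)[of "fst x"] ab[of "snd x"] by (cases x) force
    qed
    show "closed (S \<times> {a..b})" using S(1) by (simp add: closed_Times)
  qed
  moreover have "S \<times> {a..b} \<subseteq> Q_lift h"
    using h by (fastforce simp: Q_lift_def)
  moreover have "compact (closure {x. tensor \<psi> \<eta> x \<noteq> 0} \<inter> ({0..1} \<times> UNIV))"
  proof -
    have "closure {x. tensor \<psi> \<eta> x \<noteq> 0} \<inter> ({0..1} \<times> UNIV) =
        closure {x. tensor \<psi> \<eta> x \<noteq> 0} \<inter> ({0..1} \<times> {a..b})"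
      using cl by auto
    then show ?thesis by (simp add: closed_Int_compact compact_Times)
  qed
  ultimately show ?thesis by (auto simp: test_Q_def)
qed

lemma dZ_tensor: "smooth \<eta> \<Longrightarrow> dZ (tensor \<psi> \<eta>) = tensor \<psi> (deriv \<eta>)"
  by (rule ext, unfold dZ_def, rule DERIV_imp_deriv)
     (auto intro!: DERIV_cmult smooth_real_deriv)

lemma dy_tensor: "smooth \<psi> \<Longrightarrow> dy (tensor \<psi> \<eta>) = tensor (deriv \<psi>) \<eta>"
  by (rule ext, unfold dy_def, rule DERIV_imp_deriv)
     (auto intro!: DERIV_cmult_right smooth_real_deriv)

lemma deriv_zero_outside:
  fixes f :: "real \<Rightarrow> real"
  assumes "closed S" "\<And>y. y \<notin> S \<Longrightarrow> f y = 0" "y \<notin> S"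
  shows "deriv f y = 0"
proof (rule DERIV_imp_deriv)
  have "((\<lambda>_. 0::real) has_real_derivative 0) (at y)" by simp
  then show "(f has_real_derivative 0) (at y)"
    by (rule has_field_derivative_transform_within_open[where S = "- S"]) (use assms in auto)
qed

section \<open>Measure theory on the line and in the plane\<close>

lemma borel_measurable_fst_plane [measurable]: "fst \<in> borel_measurable (borel :: (real \<times> real) measure)"
  and borel_measurable_snd_plane [measurable]: "snd \<in> borel_measurable (borel :: (real \<times> real) measure)"
  by (intro borel_measurable_continuous_onI continuous_intros)+

lemma AE_lebesgue_on_iff:
  assumes "S \<in> sets borel"
  shows "(AE x in lebesgue_on S. P x) \<longleftrightarrow> (AE x in lborel. x \<in> S \<longrightarrow> P x)"
  using assms by (subst AE_restrict_space_iff) (auto simp: AE_completion_iff)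

text \<open>Lebesgue measurable functions are replaced by Borel functions extended by zero, because Fubini's
  theorem is about the product of the two Borel--Lebesgue measures and not its completion.\<close>

lemma borel_version:
  fixes f :: "'a::euclidean_space \<Rightarrow> real"
  assumes S: "S \<in> sets borel" and f: "f \<in> borel_measurable (lebesgue_on S)"
  obtains f' where "f' \<in> borel_measurable borel" "AE x in lborel. x \<in> S \<longrightarrow> f x = f' x"
    "\<And>x. x \<notin> S \<Longrightarrow> f' x = 0"
proof -
  have "(\<lambda>x. indicator S x *\<^sub>R f x) \<in> borel_measurable lebesgue"
    using f S by (subst (asm) borel_measurable_restrict_space_iff) auto
  then obtain g where g: "g \<in> borel_measurable lborel" "AE x in lborel. indicator S x *\<^sub>R f x = g x"
    using completion_ex_borel_measurable_real by blast
  have "(\<lambda>x. indicator S x * g x) \<in> borel_measurable borel"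
    using g(1) S by simp
  moreover have "AE x in lborel. x \<in> S \<longrightarrow> f x = indicator S x * g x"
    using g(2) by eventually_elim auto
  ultimately show ?thesis by (rule that) auto
qed

lemma lebesgue_on_integral_eq:
  fixes f :: "'a::euclidean_space \<Rightarrow> real"
  assumes S: "S \<in> sets borel" and f': "f' \<in> borel_measurable borel"
    and eq: "AE x in lborel. x \<in> S \<longrightarrow> f x = f' x" and out: "\<And>x. x \<notin> S \<Longrightarrow> f' x = 0"
  shows "integral\<^sup>L (lebesgue_on S) f = integral\<^sup>L lborel f'"
    and "integrable (lebesgue_on S) f \<longleftrightarrow> integrable lborel f'"
    and "f \<in> borel_measurable (lebesgue_on S)"
proof -
  have eq': "AE x in lebesgue. f' x = indicator S x *\<^sub>R f x"
    unfolding AE_completion_iff using eq by eventually_elim (use out in \<open>auto simp: indicator_def\<close>)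
  have m': "f' \<in> borel_measurable lebesgue" using f' by (simp add: measurable_completion)
  then have m: "(\<lambda>x. indicator S x *\<^sub>R f x) \<in> borel_measurable lebesgue"
    using borel_measurable_AE[OF _ eq'] by blast
  have [simp]: "S \<inter> space lebesgue \<in> sets lebesgue" using S by auto
  show "f \<in> borel_measurable (lebesgue_on S)"
    using m borel_measurable_restrict_space_iff[OF \<open>S \<inter> space lebesgue \<in> sets lebesgue\<close>] by blast
  have "integral\<^sup>L (lebesgue_on S) f = integral\<^sup>L lebesgue f'"
    unfolding integral_restrict_space[OF \<open>S \<inter> space lebesgue \<in> sets lebesgue\<close>]
    by (rule integral_cong_AE) (use m m' eq' in auto)
  then show "integral\<^sup>L (lebesgue_on S) f = integral\<^sup>L lborel f'"
    using f' by (simp add: integral_completion)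
  have "integrable (lebesgue_on S) f \<longleftrightarrow> integrable lebesgue f'"
    unfolding integrable_restrict_space[OF \<open>S \<inter> space lebesgue \<in> sets lebesgue\<close>]
    by (rule integrable_cong_AE) (use m m' eq' in auto)
  then show "integrable (lebesgue_on S) f \<longleftrightarrow> integrable lborel f'"
    using f' by (simp add: integrable_completion)
qed

lemma integrable_mult_bounded:
  fixes f g :: "'a \<Rightarrow> real"
  assumes "integrable M f" "g \<in> borel_measurable M" "\<And>x. \<bar>g x\<bar> \<le> B"
  shows "integrable M (\<lambda>x. f x * g x)"
proof (rule Bochner_Integration.integrable_bound)
  show "integrable M (\<lambda>x. B * f x)" using assms by simp
  show "AE x in M. norm (f x * g x) \<le> norm (B * f x)"
  proof (rule AE_I2)
    fix x
    have "\<bar>g x\<bar> \<le> \<bar>B\<bar>" using assms(3)[of x] by linarith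
    then show "norm (f x * g x) \<le> norm (B * f x)"
      by (simp add: abs_mult mult_right_mono mult.commute[of "\<bar>f x\<bar>"])
  qed
qed (use assms in auto)

lemma L2_on_integrable:
  fixes f f' :: "'a::euclidean_space \<Rightarrow> real"
  assumes L2: "L2_on S f" and S: "S \<in> sets borel" "emeasure lborel S < \<infinity>"
    and f': "f' \<in> borel_measurable borel" "AE x in lborel. x \<in> S \<longrightarrow> f x = f' x" "\<And>x. x \<notin> S \<Longrightarrow> f' x = 0"
  shows "integrable lborel f'" "integrable lborel (\<lambda>x. (f' x)\<^sup>2)"
proof -
  have "integrable lborel (\<lambda>x. (f' x)\<^sup>2)"
  proof (subst lebesgue_on_integral_eq(2)[OF S(1), symmetric])
    show "AE x in lborel. x \<in> S \<longrightarrow> (f x)\<^sup>2 = (f' x)\<^sup>2" using f'(2) by eventually_elim auto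
    show "integrable (lebesgue_on S) (\<lambda>x. (f x)\<^sup>2)" using L2 by (simp add: L2_on_def)
  qed (use f' in auto)
  then show sq: "integrable lborel (\<lambda>x. (f' x)\<^sup>2)" .
  have "integrable lborel (\<lambda>x. indicator S x + (f' x)\<^sup>2)"
    using sq S by auto
  then show "integrable lborel f'"
  proof (rule Bochner_Integration.integrable_bound)
    show "AE x in lborel. norm (f' x) \<le> norm (indicator S x + (f' x)\<^sup>2)"
    proof (rule AE_I2)
      fix x
      show "norm (f' x) \<le> norm (indicator S x + (f' x)\<^sup>2)"
      proof (cases "x \<in> S")
        case True
        have "0 \<le> (\<bar>f' x\<bar> - 1/2)\<^sup>2" by simp
        then show ?thesis using True by (simp add: power2_eq_square algebra_simps abs_mult_self_eq)
      qed (simp add: f'(3))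
    qed
  qed (use f' in auto)
qed

lemma Fubini_plane:
  fixes F :: "real \<times> real \<Rightarrow> real"
  assumes "integrable lborel F"
  shows "(LINT y|lborel. LINT Z|lborel. F (y, Z)) = integral\<^sup>L lborel F"
    and "(LINT Z|lborel. LINT y|lborel. F (y, Z)) = integral\<^sup>L lborel F"
    and "integrable lborel (\<lambda>y. LINT Z|lborel. F (y, Z))"
    and "AE y in lborel. integrable lborel (\<lambda>Z. F (y, Z))"
proof -
  have F: "integrable (lborel \<Otimes>\<^sub>M lborel) F" by (simp add: assms lborel_prod)
  have F': "integrable (lborel \<Otimes>\<^sub>M lborel) (case_prod (\<lambda>y Z. F (y, Z)))" using F by simp
  show "(LINT y|lborel. LINT Z|lborel. F (y, Z)) = integral\<^sup>L lborel F"
    using lborel_pair.integral_fst'[OF F] by (simp add: lborel_prod)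
  then show "(LINT Z|lborel. LINT y|lborel. F (y, Z)) = integral\<^sup>L lborel F"
    using lborel_pair.Fubini_integral[OF F'] by simp
  show "integrable lborel (\<lambda>y. LINT Z|lborel. F (y, Z))"
    using lborel_pair.integrable_fst'[OF F] .
  show "AE y in lborel. integrable lborel (\<lambda>Z. F (y, Z))"
    using lborel_pair.AE_integrable_fst'[OF F] .
qed

lemma AE_plane_sections:
  fixes P :: "real \<times> real \<Rightarrow> bool"
  assumes "AE x in lborel. P x"
  shows "AE y in lborel. AE Z in lborel. P (y, Z)"
  by (rule lborel_pair.AE_pair) (use assms in \<open>simp only: lborel_prod\<close>)

lemma AE_plane_fst:
  assumes "AE y in lborel. P y"
  shows "AE x in (lborel :: (real \<times> real) measure). P (fst x)"
proof -
  obtain N where N: "N \<in> null_sets lborel" "{y. \<not> P y} \<subseteq> N"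
    using assms by (auto simp: eventually_ae_filter)
  have "emeasure (lborel \<Otimes>\<^sub>M lborel) (N \<times> (UNIV :: real set)) = emeasure lborel N * emeasure lborel (UNIV :: real set)"
    by (rule lborel.emeasure_pair_measure_Times) (use N in auto)
  then have "N \<times> (UNIV :: real set) \<in> null_sets (lborel \<Otimes>\<^sub>M lborel)"
    using N by (auto intro: pair_measureI simp: null_sets_def)
  then have "N \<times> (UNIV :: real set) \<in> null_sets lborel" by (simp add: lborel_prod)
  then show ?thesis by (rule AE_I') (use N(2) in auto)
qed

lemma integrable_tensor:
  fixes f g :: "real \<Rightarrow> real"
  assumes f: "integrable lborel f" and g: "integrable lborel g"
  shows "integrable lborel (tensor f g)"
proof -
  have [measurable]: "f \<in> borel_measurable lborel" "g \<in> borel_measurable lborel" using f g by auto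
  have "integrable (lborel \<Otimes>\<^sub>M lborel) (tensor f g)"
    by (rule lborel_pair.Fubini_integrable) (use f g in \<open>auto simp: abs_mult\<close>)
  then show ?thesis by (simp add: lborel_prod)
qed

text \<open>The positive and the negative part of \<open>D\<close> on the interval define finite measures that agree on half-lines,
  hence are equal, hence have the same density.\<close>

lemma AE_zero_if_intervals_zero:
  fixes D :: "real \<Rightarrow> real"
  assumes D: "integrable lborel D"
    and zero: "\<And>a b. A < a \<Longrightarrow> a < b \<Longrightarrow> b < B \<Longrightarrow> (LINT y|lborel. indicator {a<..<b} y * D y) = 0"
  shows "AE y in lborel. A < y \<and> y < B \<longrightarrow> D y = 0"
proof -
  define D0 where "D0 y = indicator {A<..<B} y * D y" for y
  have [measurable]: "D \<in> borel_measurable borel" using D by auto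
  have ind: "integrable lborel (\<lambda>y. indicator E y * f y)" if "integrable lborel f" "E \<in> sets borel" for E and f :: "real \<Rightarrow> real"
    using integrable_mult_bounded[OF that(1), of "indicator E" 1] that(2)
    by (simp add: mult.commute indicator_def)
  have D0: "integrable lborel D0" unfolding D0_def by (rule ind[OF D]) auto
  have half: "(LINT y|lborel. indicator {x<..} y * D0 y) = 0" for x
  proof -
    let ?a = "max A x"
    let ?E = "\<lambda>n::nat. {?a + inverse (real (Suc n))<..<B - inverse (real (Suc n))}"
    have "(\<lambda>n. LINT y|lborel. indicator (?E n) y * D y) \<longlonglongrightarrow> (LINT y|lborel. indicator {x<..} y * D0 y)"
    proof (rule integral_dominated_convergence)
      show "AE y in lborel. (\<lambda>n. indicator (?E n) y * D y) \<longlonglongrightarrow> indicator {x<..} y * D0 y"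
      proof (rule AE_I2)
        fix y
        have inv: "(\<lambda>n. inverse (real (Suc n))) \<longlonglongrightarrow> 0" by (rule LIMSEQ_inverse_real_of_nat)
        show "(\<lambda>n. indicator (?E n) y * D y) \<longlonglongrightarrow> indicator {x<..} y * D0 y"
        proof (cases "?a < y \<and> y < B")
          case True
          have "\<forall>\<^sub>F n in sequentially. inverse (real (Suc n)) < min (y - ?a) (B - y)"
            using order_tendstoD(2)[OF inv, of "min (y - ?a) (B - y)"] True by simp
          then have "\<forall>\<^sub>F n in sequentially. indicator {x<..} y * D0 y = indicator (?E n) y * D y"
            by eventually_elim (use True in \<open>auto simp: D0_def indicator_def\<close>)
          then show ?thesis by (rule tendsto_eventually[OF eventually_mono]) simp
        next
          case False
          have "y \<notin> ?E n" for n
          proof -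
            define e where "e = inverse (real (Suc n))"
            have "e > 0" by (simp add: e_def)
            then show ?thesis using False unfolding e_def[symmetric] by auto
          qed
          then have "(\<lambda>n. indicator (?E n) y * D y) = (\<lambda>n. 0)" by (simp add: fun_eq_iff)
          moreover have "indicator {x<..} y * D0 y = 0" using False by (auto simp: D0_def indicator_def)
          ultimately show ?thesis by (simp only: tendsto_const)
        qed
      qed
      show "integrable lborel (\<lambda>y. \<bar>D y\<bar>)" using D by auto
      show "AE y in lborel. norm (indicator (?E n) y * D y) \<le> \<bar>D y\<bar>" for n
        by (auto simp: indicator_def)
    qed (auto simp: D0_def)
    moreover have "(LINT y|lborel. indicator (?E n) y * D y) = 0" for n
    proof (cases "?a + inverse (real (Suc n)) < B - inverse (real (Suc n))")
      case True
      define e where "e = inverse (real (Suc n))"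
      have "e > 0" by (simp add: e_def)
      then show ?thesis using True unfolding e_def[symmetric]
        by (intro zero) (auto simp: max_def split: if_splits)
    next
      case False
      then have "?E n = {}" by simp
      then show ?thesis by (simp only:) simp
    qed
    ultimately show ?thesis by (simp only: LIMSEQ_const_iff)
  qed
  have [measurable]: "D0 \<in> borel_measurable borel" by (simp add: D0_def[abs_def])
  have em: "emeasure (density lborel (\<lambda>y. ennreal (s * D0 y))) {x<..} =
      ennreal (LINT y|lborel. indicator {x<..} y * max 0 (s * D0 y))" for s x
  proof -
    have "emeasure (density lborel (\<lambda>y. ennreal (s * D0 y))) {x<..} =
       (\<integral>\<^sup>+ y. ennreal (indicator {x<..} y * max 0 (s * D0 y)) \<partial>lborel)"
      by (subst emeasure_density)
         (auto intro!: nn_integral_cong simp: indicator_def max_def ennreal_neg)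
    also have "\<dots> = ennreal (LINT y|lborel. indicator {x<..} y * max 0 (s * D0 y))"
      by (rule nn_integral_eq_integral) (use D0 in \<open>auto intro!: ind\<close>)
    finally show ?thesis .
  qed
  have "density lborel (\<lambda>y. ennreal (1 * D0 y)) = density lborel (\<lambda>y. ennreal ((-1) * D0 y))"
  proof (rule measure_eqI_lessThan)
    fix x
    have "(LINT y|lborel. indicator {x<..} y * max 0 (1 * D0 y)) -
          (LINT y|lborel. indicator {x<..} y * max 0 ((-1) * D0 y)) =
          (LINT y|lborel. indicator {x<..} y * max 0 (1 * D0 y) - indicator {x<..} y * max 0 ((-1) * D0 y))"
      by (rule Bochner_Integration.integral_diff[symmetric]) (use D0 in \<open>auto intro!: ind\<close>)
    also have "\<dots> = (LINT y|lborel. indicator {x<..} y * D0 y)"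
      by (rule Bochner_Integration.integral_cong) (auto simp: indicator_def)
    finally have "(LINT y|lborel. indicator {x<..} y * max 0 (1 * D0 y)) =
          (LINT y|lborel. indicator {x<..} y * max 0 ((-1) * D0 y))" using half by simp
    then show "emeasure (density lborel (\<lambda>y. ennreal (1 * D0 y))) {x<..} =
         emeasure (density lborel (\<lambda>y. ennreal ((-1) * D0 y))) {x<..}"
      unfolding em by simp
    show "emeasure (density lborel (\<lambda>y. ennreal (1 * D0 y))) {x<..} < \<infinity>"
      unfolding em by simp
  qed auto
  then have "AE y in lborel. ennreal (1 * D0 y) = ennreal ((-1) * D0 y)"
    by (rule sigma_finite_measure.density_unique[OF sigma_finite_lborel, rotated -1]) auto
  then show ?thesis
  proof eventually_elim
    case (elim y)
    then have "D0 y = 0"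
      by (metis ennreal_eq_0_iff ennreal_neg mult_1 mult_minus1 neg_le_0_iff_le nle_le order_antisym)
    then show ?case by (auto simp: D0_def)
  qed
qed

lemma AE_zero_on_open:
  fixes D :: "real \<Rightarrow> real"
  assumes D: "integrable lborel D" and U: "open U"
    and zero: "\<And>a b. a < b \<Longrightarrow> {a..b} \<subseteq> U \<Longrightarrow> (LINT y|lborel. indicator {a<..<b} y * D y) = 0"
  shows "AE y in lborel. y \<in> U \<longrightarrow> D y = 0"
proof -
  have "AE y in lborel. \<forall>A\<in>\<rat>. \<forall>B\<in>\<rat>. {A<..<B} \<subseteq> U \<longrightarrow> A < y \<and> y < B \<longrightarrow> D y = 0"
  proof -
    have "AE y in lborel. A < y \<and> y < B \<longrightarrow> D y = 0" if "{A<..<B} \<subseteq> U" for A B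
      by (rule AE_zero_if_intervals_zero[OF D], rule zero) (use that in auto)
    then have "AE y in lborel. {A<..<B} \<subseteq> U \<longrightarrow> A < y \<and> y < B \<longrightarrow> D y = 0" for A B
      by (cases "{A<..<B} \<subseteq> U") auto
    then show ?thesis by (simp add: AE_ball_countable countable_rat)
  qed
  then show ?thesis
  proof eventually_elim
    case (elim y)
    show ?case
    proof
      assume "y \<in> U"
      then obtain e where e: "e > 0" "ball y e \<subseteq> U" using U openE by blast
      obtain A where A: "A \<in> \<rat>" "y - e < A" "A < y" using Rats_dense_in_real[of "y - e" y] e by auto
      obtain B where B: "B \<in> \<rat>" "y < B" "B < y + e" using Rats_dense_in_real[of y "y + e"] e by auto
      have "{A<..<B} \<subseteq> U" using A B e(2) by (auto simp: ball_def dist_real_def abs_if subset_iff)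
      then show "D y = 0" using elim A B by blast
    qed
  qed
qed

text \<open>After subtraction of the chord the function vanishes at both ends. At an interior maximum \<open>m\<close> the
  vanishing second difference with step \<open>min m (L - m)\<close> propagates the maximal value to an end
  point, so the maximum is zero; likewise for the minimum. Rational parameters are enough by
  continuity, which is what makes the hypothesis accessible to arguments that discard one null
  set per test function.\<close>

lemma linear_if_second_differences_vanish:
  fixes F :: "real \<Rightarrow> real"
  assumes L: "0 < L" and cont: "continuous_on {0..L} F" and F0: "F 0 = 0"
    and sd: "\<And>c d. c \<in> \<rat> \<Longrightarrow> d \<in> \<rat> \<Longrightarrow> 0 < c \<Longrightarrow> 0 < d \<Longrightarrow> c + 2 * d < L \<Longrightarrow>
      F (c + 2 * d) - F (c + d) = F (c + d) - F c"
    and Z: "0 \<le> Z" "Z \<le> L"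
  shows "F Z = Z / L * F L"
proof -
  have sd': "F (c + 2 * d) - F (c + d) = F (c + d) - F c" if cd: "0 \<le> c" "0 < d" "c + 2 * d \<le> L" for c d
  proof -
    have "\<exists>q\<in>\<rat>. c < q \<and> q < c + inverse (real (Suc n))" for n
      using Rats_dense_in_real[of c "c + inverse (real (Suc n))"] by simp
    then obtain cc where cc: "\<And>n. cc n \<in> \<rat>" "\<And>n. c < cc n" "\<And>n. cc n < c + inverse (real (Suc n))" by metis
    have "\<exists>q\<in>\<rat>. d - 2 * inverse (real (Suc n)) < q \<and> q < d - inverse (real (Suc n))" for n
      using Rats_dense_in_real[of "d - 2 * inverse (real (Suc n))" "d - inverse (real (Suc n))"] by simp
    then obtain dd where dd: "\<And>n. dd n \<in> \<rat>" "\<And>n. d - 2 * inverse (real (Suc n)) < dd n"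
      "\<And>n. dd n < d - inverse (real (Suc n))" by metis
    have inv: "(\<lambda>n. inverse (real (Suc n))) \<longlonglongrightarrow> 0" by (rule LIMSEQ_inverse_real_of_nat)
    have lcc: "cc \<longlonglongrightarrow> c"
      by (rule tendsto_sandwich[of "\<lambda>_. c" _ _ "\<lambda>n. c + inverse (real (Suc n))"])
         (use tendsto_add[OF tendsto_const inv, of c] cc in \<open>auto intro!: always_eventually less_imp_le\<close>)
    have ldd: "dd \<longlonglongrightarrow> d"
    proof (rule tendsto_sandwich[of "\<lambda>n. d - 2 * inverse (real (Suc n))" _ _ "\<lambda>n. d - inverse (real (Suc n))"])
      show "(\<lambda>n. d - 2 * inverse (real (Suc n))) \<longlonglongrightarrow> d"
        using tendsto_diff[OF tendsto_const tendsto_mult[OF tendsto_const inv], of d 2] by simp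
      show "(\<lambda>n. d - inverse (real (Suc n))) \<longlonglongrightarrow> d"
        using tendsto_diff[OF tendsto_const inv, of d] by simp
    qed (use dd in \<open>auto intro!: always_eventually less_imp_le\<close>)
    have pos: "\<forall>\<^sub>F n in sequentially. 0 < dd n" using order_tendstoD(1)[OF ldd] cd by blast
    have sm: "cc n + 2 * dd n < L" for n using cc(3)[of n] dd(3)[of n] cd inverse_positive_iff_positive[of "real (Suc n)"] by linarith
    have lim: "(\<lambda>n. F (x n)) \<longlonglongrightarrow> F x0" if "x \<longlonglongrightarrow> x0" "x0 \<in> {0..L}" "\<forall>\<^sub>F n in sequentially. x n \<in> {0..L}" for x x0
      by (rule continuous_on_tendsto_compose[OF cont that])
    have c0: "0 < cc n" for n using cc(2)[of n] cd by linarith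
    have "(\<lambda>n. F (cc n + 2 * dd n) - F (cc n + dd n) - (F (cc n + dd n) - F (cc n))) \<longlonglongrightarrow>
       F (c + 2 * d) - F (c + d) - (F (c + d) - F c)"
    proof (intro tendsto_diff lim tendsto_add tendsto_mult tendsto_const lcc ldd)
      show "\<forall>\<^sub>F n in sequentially. cc n + 2 * dd n \<in> {0..L}"
        using pos by eventually_elim (use sm c0 in \<open>auto intro!: less_imp_le add_pos_pos\<close>)
      show "\<forall>\<^sub>F n in sequentially. cc n \<in> {0..L}"
        using pos
      proof eventually_elim
        case (elim n) then show ?case using sm[of n] c0[of n] by simp
      qed
      have *: "\<forall>\<^sub>F n in sequentially. cc n + dd n \<in> {0..L}"
        using pos
      proof eventually_elim
        case (elim n) then show ?case using sm[of n] c0[of n] by simp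
      qed
      show "\<forall>\<^sub>F n in sequentially. cc n + dd n \<in> {0..L}" "\<forall>\<^sub>F n in sequentially. cc n + dd n \<in> {0..L}" by fact+
    qed (use cd in auto)
    moreover have "\<forall>\<^sub>F n in sequentially. F (cc n + 2 * dd n) - F (cc n + dd n) - (F (cc n + dd n) - F (cc n)) = 0"
      using pos by eventually_elim (use sd cc(1) dd(1) sm c0 in simp)
    ultimately have "F (c + 2 * d) - F (c + d) - (F (c + d) - F c) = 0"
      by (rule LIMSEQ_unique[OF _ tendsto_eventually])
    then show ?thesis by simp
  qed
  have nonpos: "G z \<le> 0"
    if G: "continuous_on {0..L} G" "G 0 = 0" "G L = 0"
      "\<And>c d. 0 \<le> c \<Longrightarrow> 0 < d \<Longrightarrow> c + 2 * d \<le> L \<Longrightarrow> G (c + 2 * d) - G (c + d) = G (c + d) - G c"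
      and z: "z \<in> {0..L}" for G :: "real \<Rightarrow> real" and z
  proof -
    obtain m where m: "m \<in> {0..L}" "\<And>z. z \<in> {0..L} \<Longrightarrow> G z \<le> G m"
      using continuous_attains_sup[of "{0..L}" G] G(1) L by auto
    have "G m \<le> 0"
    proof (cases "0 < m \<and> m < L")
      case True
      define d where "d = min m (L - m)"
      have d: "d > 0" "m - d \<ge> 0" "m + d \<le> L" "m - d = 0 \<or> m + d = L" using True by (auto simp: d_def)
      have "G (m - d + 2 * d) - G (m - d + d) = G (m - d + d) - G (m - d)"
        by (rule G(4)) (use d in auto)
      then have "G (m + d) + G (m - d) = 2 * G m" by (simp add: add.commute[of m])
      moreover have "G (m + d) \<le> G m" "G (m - d) \<le> G m" using d True by (auto intro!: m(2))
      ultimately have "G (m - d) = G m" "G (m + d) = G m" by linarith+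
      then show ?thesis using d(4) G by auto
    next
      case False
      then have "m = 0 \<or> m = L" using m(1) by auto
      then show ?thesis using G by auto
    qed
    then show ?thesis using m(2)[OF z] by linarith
  qed
  define q where "q = F L / L"
  have qsd: "F (c + 2 * d) - q * (c + 2 * d) - (F (c + d) - q * (c + d)) =
      F (c + d) - q * (c + d) - (F c - q * c)"
    if "0 \<le> c" "0 < d" "c + 2 * d \<le> L" for c d
    using sd'[OF that] by (simp add: algebra_simps)
  have qsd': "q * (c + 2 * d) - F (c + 2 * d) - (q * (c + d) - F (c + d)) =
      q * (c + d) - F (c + d) - (q * c - F c)"
    if "0 \<le> c" "0 < d" "c + 2 * d \<le> L" for c d
    using sd'[OF that] by (simp add: algebra_simps)
  have "F Z - q * Z \<le> 0"
    by (rule nonpos[where G = "\<lambda>Z. F Z - q * Z" and z = Z])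
       (use L Z F0 qsd in \<open>auto intro!: continuous_intros cont simp: q_def\<close>)
  moreover have "q * Z - F Z \<le> 0"
    by (rule nonpos[where G = "\<lambda>Z. q * Z - F Z" and z = Z])
       (use L Z F0 qsd' in \<open>auto intro!: continuous_intros cont simp: q_def\<close>)
  ultimately show ?thesis by (simp add: q_def field_simps)
qed

section \<open>Weak derivatives\<close>

lemma integrable_indicator_mult:
  fixes f :: "real \<Rightarrow> real"
  assumes "integrable lborel f" "E \<in> sets borel"
  shows "integrable lborel (\<lambda>y. indicator E y * f y)"
  using integrable_mult_bounded[OF assms(1), of "indicator E" 1] assms(2)
  by (simp add: mult.commute indicator_def)

lemma integral_eq_LINT:
  fixes f :: "real \<Rightarrow> real"
  assumes "integrable lborel f" "E \<in> sets borel"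
  shows "f integrable_on E" "integral E f = (LINT y|lborel. indicator E y * f y)"
proof -
  have "set_integrable lborel E f"
    using integrable_indicator_mult[OF assms] by (simp add: set_integrable_def)
  from set_borel_integral_eq_integral[OF this]
  show "f integrable_on E" "integral E f = (LINT y|lborel. indicator E y * f y)"
    by (simp_all add: set_lebesgue_integral_def)
qed

lemma primitive_continuous:
  fixes f :: "real \<Rightarrow> real"
  assumes "integrable lborel f"
  shows "continuous_on {a..b} (\<lambda>y. integral {a..y} f)"
  by (intro indefinite_integral_continuous_1 integral_eq_LINT assms) auto

lemma primitive_diff:
  fixes f :: "real \<Rightarrow> real"
  assumes "integrable lborel f" "z \<le> a" "a \<le> b"
  shows "integral {z..b} f - integral {z..a} f = (LINT y|lborel. indicator {a<..<b} y * f y)"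
proof -
  have "integral {z..a} f + integral {a..b} f = integral {z..b} f"
    using assms by (intro Henstock_Kurzweil_Integration.integral_combine integral_eq_LINT) auto
  moreover have "integral {a..b} f = integral {a<..<b} f" by (rule integral_open_interval_real)
  ultimately show ?thesis using integral_eq_LINT(2)[OF assms(1), of "{a<..<b}"] by simp
qed

lemma primitive_second_difference:
  fixes f :: "real \<Rightarrow> real"
  assumes f: "integrable lborel f" and c: "0 \<le> c" and d: "0 \<le> d"
    and zero: "(LINT y|lborel. f y * (indicator {c<..<c + d} y - indicator {c + d<..<c + 2 * d} y)) = 0"
  shows "integral {0..c + 2 * d} f - integral {0..c + d} f = integral {0..c + d} f - integral {0..c} f"
proof -
  have "(LINT y|lborel. f y * (indicator {c<..<c + d} y - indicator {c + d<..<c + 2 * d} y)) =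
    (LINT y|lborel. indicator {c<..<c + d} y * f y - indicator {c + d<..<c + 2 * d} y * f y)"
    by (simp add: algebra_simps)
  also have "\<dots> = (LINT y|lborel. indicator {c<..<c + d} y * f y) - (LINT y|lborel. indicator {c + d<..<c + 2 * d} y * f y)"
    by (intro Bochner_Integration.integral_diff integrable_indicator_mult f) auto
  also have "\<dots> = (integral {0..c + d} f - integral {0..c} f) - (integral {0..c + 2 * d} f - integral {0..c + d} f)"
    using c d by (simp add: primitive_diff[OF f])
  finally show ?thesis using zero by simp
qed

lemma integral_mult_bounded_limit:
  fixes f :: "'a \<Rightarrow> real"
  assumes f: "integrable M f" and E: "\<And>n. E n \<in> borel_measurable M" "\<And>n x. \<bar>E n x\<bar> \<le> 1"
    and e: "e \<in> borel_measurable M" and lim: "\<And>x. f x \<noteq> 0 \<Longrightarrow> (\<lambda>n. E n x) \<longlonglongrightarrow> e x"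
  shows "(\<lambda>n. LINT x|M. f x * E n x) \<longlonglongrightarrow> (LINT x|M. f x * e x)"
proof (rule integral_dominated_convergence)
  show "integrable M (\<lambda>x. \<bar>f x\<bar>)" using f by simp
  show "AE x in M. norm (f x * E n x) \<le> \<bar>f x\<bar>" for n
    using E(2)[of n] by (auto simp: abs_mult intro!: mult_left_le)
  show "AE x in M. (\<lambda>n. f x * E n x) \<longlonglongrightarrow> f x * e x"
  proof (rule AE_I2)
    fix x show "(\<lambda>n. f x * E n x) \<longlonglongrightarrow> f x * e x"
      by (cases "f x = 0") (auto intro!: tendsto_mult lim)
  qed
qed (use f E e in auto)

lemma smooth_borel: "smooth f \<Longrightarrow> f \<in> borel_measurable borel" for f :: "'a::euclidean_space \<Rightarrow> real"
  by (simp add: borel_measurable_continuous_onI smooth_continuous)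

lemma integrable_mult_continuous:
  fixes F k :: "real \<Rightarrow> real"
  assumes F: "integrable lborel F" "\<And>y. y \<notin> {a..b} \<Longrightarrow> F y = 0" and k: "continuous_on UNIV k"
  shows "integrable lborel (\<lambda>y. F y * k y)"
proof -
  have "compact (k ` {a..b})"
    using k by (intro compact_continuous_image) (auto intro: continuous_on_subset)
  then obtain B where B: "\<And>y. y \<in> {a..b} \<Longrightarrow> \<bar>k y\<bar> \<le> B"
    using compact_imp_bounded bounded_iff by (metis image_eqI real_norm_def)
  have m: "k \<in> borel_measurable borel" using k by (rule borel_measurable_continuous_onI)
  have "integrable lborel (\<lambda>y. F y * (indicator {a..b} y * k y))"
    by (rule integrable_mult_bounded[OF F(1), of _ "max 0 B"])
       (use B m in \<open>fastforce simp: indicator_def\<close>)+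
  moreover have "(\<lambda>y. F y * (indicator {a..b} y * k y)) = (\<lambda>y. F y * k y)"
    using F(2) by (auto simp: fun_eq_iff indicator_def)
  ultimately show ?thesis by simp
qed

text \<open>The primitive of \<open>f\<close> has vanishing second differences, hence is linear.\<close>

lemma du_Bois_Reymond_torus:
  fixes f :: "real \<Rightarrow> real"
  assumes f: "integrable lborel f" and out: "\<And>y. y \<notin> {0..1} \<Longrightarrow> f y = 0"
    and zero: "\<And>\<psi>. test_torus \<psi> \<Longrightarrow> (LINT y|lborel. f y * deriv \<psi> y) = 0"
  shows "AE y in lborel. y \<in> {0..1} \<longrightarrow> f y = integral {0..1} f"
proof -
  let ?F = "\<lambda>y. integral {0..y} f"
  have lin: "?F z = z * ?F 1" if "0 \<le> z" "z \<le> 1" for z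
  proof -
    have "?F z = z / 1 * ?F 1"
    proof (rule linear_if_second_differences_vanish)
      fix c d :: real assume cd: "0 < c" "0 < d" "c + 2 * d < 1"
      obtain \<Psi> where \<Psi>: "\<And>n. test_torus (\<Psi> n)" "\<And>n y. \<bar>deriv (\<Psi> n) y\<bar> \<le> 1"
        "\<And>y. 0 \<le> y \<Longrightarrow> y \<le> 1 \<Longrightarrow> (\<lambda>n::nat. deriv (\<Psi> n) y) \<longlonglongrightarrow>
           indicator {c<..<c + d} y - indicator {c + d<..<c + 2 * d} y"
        using test_torus_step[OF cd] by blast
      have "(\<lambda>n. LINT y|lborel. f y * deriv (\<Psi> n) y) \<longlonglongrightarrow>
        (LINT y|lborel. f y * (indicator {c<..<c + d} y - indicator {c + d<..<c + 2 * d} y))"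
      proof (rule integral_mult_bounded_limit[OF f])
        show "deriv (\<Psi> n) \<in> borel_measurable lborel" for n
          using \<Psi>(1) by (simp add: smooth_borel smooth_real_deriv test_torus_def)
        show "(\<lambda>n. deriv (\<Psi> n) y) \<longlonglongrightarrow> indicator {c<..<c + d} y - indicator {c + d<..<c + 2 * d} y"
          if "f y \<noteq> 0" for y using that out[of y] \<Psi>(3) by auto
      qed (use \<Psi>(2) in auto)
      then have "(LINT y|lborel. f y * (indicator {c<..<c + d} y - indicator {c + d<..<c + 2 * d} y)) = 0"
        by (simp add: zero \<Psi>(1) LIMSEQ_const_iff)
      then show "?F (c + 2 * d) - ?F (c + d) = ?F (c + d) - ?F c"
        by (intro primitive_second_difference f) (use cd in auto)
    qed (use that primitive_continuous[OF f] in auto)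
    then show ?thesis by simp
  qed
  define q where "q = ?F 1"
  let ?D = "\<lambda>y. f y - indicator {0..1} y * q"
  have "AE y in lborel. 0 < y \<and> y < 1 \<longrightarrow> ?D y = 0"
  proof (rule AE_zero_if_intervals_zero)
    show "integrable lborel ?D" using f by simp
    fix a b :: real assume ab: "0 < a" "a < b" "b < 1"
    have "(LINT y|lborel. indicator {a<..<b} y * ?D y) =
        (LINT y|lborel. indicator {a<..<b} y * f y - indicator {a<..<b} y * q)"
      by (rule Bochner_Integration.integral_cong) (use ab in \<open>auto simp: indicator_def\<close>)
    also have "\<dots> = (LINT y|lborel. indicator {a<..<b} y * f y) - (LINT y|lborel. indicator {a<..<b} y * q)"
    proof (rule Bochner_Integration.integral_diff)
      show "integrable lborel (\<lambda>y. indicator {a<..<b} y * q)"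
        by (intro integrable_mult_left integrable_real_indicator) (use ab in auto)
    qed (auto intro: integrable_indicator_mult f)
    also have "\<dots> = ?F b - ?F a - (b - a) * q"
      using ab by (simp add: primitive_diff[OF f, of 0 a b])
    also have "\<dots> = 0" using lin[of a] lin[of b] ab by (simp add: q_def algebra_simps)
    finally show "(LINT y|lborel. indicator {a<..<b} y * ?D y) = 0" .
  qed
  moreover have "AE y in lborel. y \<noteq> (0::real)" "AE y in lborel. y \<noteq> (1::real)"
    by (rule AE_lborel_singleton)+
  ultimately show ?thesis
    by eventually_elim (auto simp: q_def)
qed

text \<open>By Fubini, the primitive of \<open>g\<close> also has weak derivative \<open>g\<close>; the difference to \<open>f\<close> is constant
  by the previous lemma.\<close>

lemma weak_derivative_torus:
  fixes f g :: "real \<Rightarrow> real"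
  assumes f: "integrable lborel f" "\<And>y. y \<notin> {0..1} \<Longrightarrow> f y = 0"
    and g: "integrable lborel g" "\<And>y. y \<notin> {0..1} \<Longrightarrow> g y = 0"
    and weak: "\<And>\<psi>. test_torus \<psi> \<Longrightarrow> (LINT y|lborel. f y * deriv \<psi> y) = - (LINT y|lborel. g y * \<psi> y)"
  shows "integral {0..1} g = 0"
    and "\<exists>c. AE y in lborel. y \<in> {0..1} \<longrightarrow> f y = c + integral {0..y} g"
proof -
  have "test_torus (\<lambda>_. 1)" by (simp add: test_torus_def smooth_const periodic1_I)
  from weak[OF this] have "(LINT y|lborel. g y) = 0" by simp
  moreover have "integral {0..1} g = (LINT y|lborel. g y)"
    unfolding integral_eq_LINT(2)[OF g(1) atLeastAtMost_borel]
    by (rule Bochner_Integration.integral_cong) (use g(2) in \<open>auto simp: indicator_def\<close>)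
  ultimately show g0: "integral {0..1} g = 0" by simp
  define H where "H y = indicator {0..1} y * integral {0..y} g" for y
  have H: "integrable lborel H"
  proof -
    have "integrable lborel (\<lambda>y. indicator {0..1} y *\<^sub>R integral {0..y} g)"
      by (rule borel_integrable_compact) (auto intro: primitive_continuous g)
    then show ?thesis by (simp add: H_def[abs_def])
  qed
  have parts: "(LINT y|lborel. H y * deriv \<psi> y) = - (LINT y|lborel. g y * \<psi> y)" if \<psi>: "test_torus \<psi>" for \<psi>
  proof -
    have sm: "smooth \<psi>" "smooth (deriv \<psi>)" and d: "\<And>x. (\<psi> has_real_derivative deriv \<psi> x) (at x)"
      using \<psi> smooth_real_deriv by (auto simp: test_torus_def)
    \<comment> \<open>integrated in its second argument, \<open>K\<close> gives \<open>g y * (\<psi> 1 - \<psi> y)\<close>; in its first, \<open>H t * deriv \<psi> t\<close>\<close>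
    define K where "K x = g (fst x) * (indicator {0..1} (snd x) * deriv \<psi> (snd x)) * indicator {x. fst x < snd x} x"
      for x :: "real \<times> real"
    have e: "integrable lborel (\<lambda>t. indicator {0..1} t * deriv \<psi> t)"
    proof -
      have "integrable lborel (\<lambda>t. indicator {0..1} t *\<^sub>R deriv \<psi> t)"
        by (rule borel_integrable_compact)
           (use smooth_continuous[OF sm(2)] in \<open>auto intro: continuous_on_subset\<close>)
      then show ?thesis by simp
    qed
    have [measurable]: "{x::real \<times> real. fst x < snd x} \<in> sets borel" by measurable
    have K: "integrable lborel K"
      unfolding K_def
      by (rule integrable_mult_bounded[where B = 1, OF integrable_tensor[OF g(1) e]])
         (auto simp: indicator_def)
    have 1: "(LINT t|lborel. K (y, t)) = g y * (\<psi> 1 - \<psi> y)" for y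
    proof (cases "y \<in> {0..1}")
      case True
      have "(LINT t|lborel. K (y, t)) = (LINT t|lborel. g y * (indicator {y<..<1} t * (indicator {0..1} t * deriv \<psi> t)))"
      proof (rule integral_cong_AE)
        show "AE t in lborel. K (y, t) = g y * (indicator {y<..<1} t * (indicator {0..1} t * deriv \<psi> t))"
          using AE_lborel_singleton[of 1]
          by eventually_elim (use True in \<open>auto simp: K_def indicator_def\<close>)
      qed (use smooth_borel[OF sm(2)] in \<open>auto simp: K_def\<close>)
      also have "\<dots> = g y * integral {y<..<1} (\<lambda>t. indicator {0..1} t * deriv \<psi> t)"
        using integral_eq_LINT(2)[OF e, of "{y<..<1}"] by simp
      also have "integral {y<..<1} (\<lambda>t. indicator {0..1} t * deriv \<psi> t) = integral {y..1} (deriv \<psi>)"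
        unfolding integral_open_interval_real[symmetric]
        by (rule Henstock_Kurzweil_Integration.integral_cong) (use True in \<open>auto simp: indicator_def\<close>)
      also have "integral {y..1} (deriv \<psi>) = \<psi> 1 - \<psi> y"
        by (rule integral_unique, rule fundamental_theorem_of_calculus)
           (use True d in \<open>auto simp: has_real_derivative_iff_has_vector_derivative[symmetric] intro: has_field_derivative_at_within\<close>)
      finally show ?thesis .
    next
      case False
      then show ?thesis using g(2)[OF False] by (simp add: K_def)
    qed
    have 2: "(LINT y|lborel. K (y, t)) = H t * deriv \<psi> t" for t
    proof -
      have "(LINT y|lborel. K (y, t)) = (LINT y|lborel. indicator {0..1} t * deriv \<psi> t * (indicator {0..t} y * g y))"
      proof (rule integral_cong_AE)
        show "AE y in lborel. K (y, t) = indicator {0..1} t * deriv \<psi> t * (indicator {0..t} y * g y)"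
          using AE_lborel_singleton[of t]
          by eventually_elim (use g(2) in \<open>auto simp: K_def indicator_def\<close>)
      qed (use g in \<open>auto simp: K_def\<close>)
      also have "\<dots> = indicator {0..1} t * deriv \<psi> t * integral {0..t} g"
        using integral_eq_LINT(2)[OF g(1), of "{0..t}"] by simp
      finally show ?thesis by (simp add: H_def)
    qed
    have bdd: "integrable lborel (\<lambda>y. g y * \<psi> y)"
      by (rule integrable_mult_continuous[OF g smooth_continuous[OF sm(1)]])
    have "(LINT y|lborel. H y * deriv \<psi> y) = (LINT y|lborel. g y * (\<psi> 1 - \<psi> y))"
      using Fubini_plane(1,2)[OF K] 1 2 by simp
    also have "\<dots> = (LINT y|lborel. g y * \<psi> 1) - (LINT y|lborel. g y * \<psi> y)"
      using g(1) bdd by (simp add: right_diff_distrib)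
    also have "\<dots> = - (LINT y|lborel. g y * \<psi> y)"
      using \<open>(LINT y|lborel. g y) = 0\<close> by simp
    finally show ?thesis .
  qed
  have dint: "integrable lborel (\<lambda>y. F y * deriv \<psi> y)"
    if "integrable lborel F" "\<And>y. y \<notin> {0..1} \<Longrightarrow> F y = 0" "test_torus \<psi>" for F \<psi>
    by (rule integrable_mult_continuous[OF that(1,2)])
       (use that(3) smooth_real_deriv smooth_continuous in \<open>auto simp: test_torus_def\<close>)
  have H0: "H y = 0" if "y \<notin> {0..1}" for y using that by (simp add: H_def)
  have "AE y in lborel. y \<in> {0..1} \<longrightarrow> f y - H y = integral {0..1} (\<lambda>y. f y - H y)"
  proof (rule du_Bois_Reymond_torus)
    fix \<psi> assume \<psi>: "test_torus \<psi>"
    show "(LINT y|lborel. (f y - H y) * deriv \<psi> y) = 0"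
      using weak[OF \<psi>] parts[OF \<psi>] dint[OF f \<psi>] dint[OF H H0 \<psi>] by (simp add: left_diff_distrib)
  qed (use f H H0 in auto)
  then show "\<exists>c. AE y in lborel. y \<in> {0..1} \<longrightarrow> f y = c + integral {0..y} g"
    by (intro exI[of _ "integral {0..1} (\<lambda>y. f y - H y)"], eventually_elim) (auto simp: H_def)
qed

text \<open>Independence of the height is expressed through primitives along vertical segments, because these
  are continuous and therefore determined, on each segment, by countably many tests. The products
  used as tests are supported over small intervals of \<open>y\<close>, on which a box of given height fits
  under the graph of \<open>h\<close>.\<close>

lemma vertical_du_Bois_Reymond:
  fixes f :: "real \<times> real \<Rightarrow> real"
  assumes f: "integrable lborel f" and out: "\<And>x. fst x \<notin> {0..1} \<Longrightarrow> f x = 0"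
    and h: "continuous_on UNIV h" "periodic1 h" "\<And>y. 0 < h y"
    and zero: "\<And>\<psi> \<eta> S a b. \<lbrakk>test_torus \<psi>; smooth \<eta>; closed S; \<And>y. y \<notin> S \<Longrightarrow> \<psi> y = 0;
       \<And>Z. Z \<notin> {a..b} \<Longrightarrow> \<eta> Z = 0; 0 < a; \<And>y. y \<in> S \<Longrightarrow> b < h y\<rbrakk>
       \<Longrightarrow> (LINT x|lborel. f x * tensor \<psi> (deriv \<eta>) x) = 0"
  shows "AE y in lborel. y \<in> {0..1} \<longrightarrow> (\<forall>Z\<in>{0..h y}.
     integral {0..Z} (\<lambda>t. f (y, t)) = Z / h y * integral {0..h y} (\<lambda>t. f (y, t)))"
proof -
  define st where "st c d Z = indicator {c<..<c + d} Z - (indicator {c + d<..<c + 2 * d} Z :: real)" for c d Z :: real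
  have st_meas [measurable]: "st c d \<in> borel_measurable borel" for c d by (simp add: st_def[abs_def])
  have st_bd: "\<bar>st c d Z\<bar> \<le> 1" for c d Z by (auto simp: st_def indicator_def)
  define D where "D c d y = (LINT Z|lborel. f (y, Z) * st c d Z)" for c d y
  have "(\<lambda>x::real \<times> real. st c d (snd x)) \<in> borel_measurable lborel" for c d
    by simp
  then have fst_int: "integrable lborel (\<lambda>x. f x * st c d (snd x))" for c d
    by (rule integrable_mult_bounded[OF f]) (rule st_bd)
  have D_int: "integrable lborel (D c d)" for c d
    using Fubini_plane(3)[OF fst_int] by (simp add: D_def[abs_def])
  have D0: "AE y in lborel. y \<in> {0<..<1} \<inter> {y. c + 2 * d < h y} \<longrightarrow> D c d y = 0" if cd: "0 < c" "0 < d" for c d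
  proof (rule AE_zero_on_open[OF D_int])
    show "open ({0<..<1} \<inter> {y. c + 2 * d < h y})"
      using open_Collect_less[OF continuous_on_const h(1)] by auto
    fix \<alpha> \<beta> :: real assume ab: "\<alpha> < \<beta>" "{\<alpha>..\<beta>} \<subseteq> {0<..<1} \<inter> {y. c + 2 * d < h y}"
    define m r where "m = (\<alpha> + \<beta>) / 2" and "r = (\<beta> - \<alpha>) / 2"
    have "\<alpha> \<in> {\<alpha>..\<beta>}" "\<beta> \<in> {\<alpha>..\<beta>}" using ab(1) by auto
    then have "\<alpha> \<in> {0<..<1}" "\<beta> \<in> {0<..<1}" using ab(2) by blast+
    then have ab1: "0 < \<alpha>" "\<beta> < 1" "m - r = \<alpha>" "m + r = \<beta>"
      by (auto simp: m_def r_def field_simps)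
    have mr: "0 < r" "r < 1/2" using ab ab1(1,2) by (auto simp: r_def)
    obtain \<eta> where \<eta>: "\<And>n. smooth (\<eta> n)" "\<And>n Z. Z \<notin> {c..c + 2 * d} \<Longrightarrow> \<eta> n Z = 0"
      "\<And>n Z. \<bar>deriv (\<eta> n) Z\<bar> \<le> 1"
      "\<And>Z. (\<lambda>n::nat. deriv (\<eta> n) Z) \<longlonglongrightarrow> st c d Z"
      unfolding st_def using test_line_step[OF cd(2), of c] by blast
    let ?S = "{y. cos (2 * pi * (y - m)) \<ge> cos (2 * pi * r)}"
    have tt: "test_torus (torus_bump n m r)" for n
      by (simp add: test_torus_def smooth_torus_bump periodic1_I torus_bump_plus_1)
    have zero_n: "(LINT x|lborel. f x * tensor (torus_bump n m r) (deriv (\<eta> n)) x) = 0" for n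
    proof (rule zero[OF tt \<eta>(1)])
      show "closed ?S" by (intro closed_Collect_le continuous_intros)
      show "torus_bump n m r y = 0" if "y \<notin> ?S" for y
        unfolding torus_bump_def by (rule flat_bounds(3)) (use that in \<open>simp add: mult_nonneg_nonpos\<close>)
      show "c + 2 * d < h y" if yS: "y \<in> ?S" for y
      proof -
        obtain k :: int where k: "\<bar>y - m - of_int k\<bar> \<le> r"
          using near_int_if_cos_ge[OF mr, of "y - m"] yS by blast
        then have "y - of_int k \<in> {\<alpha>..\<beta>}" using ab1 by (auto simp: abs_le_iff)
        then have "c + 2 * d < h (y - of_int k)" using ab by auto
        interpret periodic_fun_simple' h by (rule h(2))
        show ?thesis using \<open>c + 2 * d < h (y - of_int k)\<close> by (simp add: minus_of_int)
      qed
    qed (use \<eta>(2) cd in auto)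
    have "(\<lambda>n. LINT x|lborel. f x * tensor (torus_bump n m r) (deriv (\<eta> n)) x) \<longlonglongrightarrow>
      (LINT x|lborel. f x * tensor (indicator {\<alpha><..<\<beta>}) (st c d) x)"
    proof (rule integral_mult_bounded_limit[OF f])
      show "tensor (torus_bump n m r) (deriv (\<eta> n)) \<in> borel_measurable lborel" for n
        using smooth_borel[OF smooth_torus_bump] smooth_borel[OF smooth_real_deriv(2)[OF \<eta>(1)]] by simp
      show "\<bar>tensor (torus_bump n m r) (deriv (\<eta> n)) x\<bar> \<le> 1" for n x
        using torus_bump_bounds[of n m r "fst x"] \<eta>(3)[of n "snd x"] by (simp add: abs_mult mult_le_one)
      show "(\<lambda>n. tensor (torus_bump n m r) (deriv (\<eta> n)) x) \<longlonglongrightarrow> tensor (indicator {\<alpha><..<\<beta>}) (st c d) x"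
        if "f x \<noteq> 0" for x
      proof (rule tendsto_mult[OF _ \<eta>(4)])
        have "fst x \<in> {0..1}" using that out by blast
        then show "(\<lambda>n. torus_bump n m r (fst x)) \<longlonglongrightarrow> indicator {\<alpha><..<\<beta>} (fst x)"
          using torus_bump_limit[of m r "fst x"] ab1 mr by simp
      qed
    qed simp
    then have lim0: "(LINT x|lborel. f x * tensor (indicator {\<alpha><..<\<beta>}) (st c d) x) = 0"
      unfolding zero_n by (simp add: LIMSEQ_const_iff)
    have "integrable lborel (\<lambda>x. f x * tensor (indicator {\<alpha><..<\<beta>}) (st c d) x)"
      by (rule integrable_mult_bounded[OF f, of _ 1])
         (use st_bd in \<open>auto simp: abs_mult mult_le_one indicator_le_1\<close>)
    from Fubini_plane(1)[OF this] lim0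
    have "(LINT y|lborel. LINT Z|lborel. indicator {\<alpha><..<\<beta>} y * (f (y, Z) * st c d Z)) = 0"
      by (simp add: ac_simps)
    then show "(LINT y|lborel. indicator {\<alpha><..<\<beta>} y * D c d y) = 0"
      by (simp add: D_def)
  qed
  have "AE y in lborel. \<forall>c\<in>\<rat>. \<forall>d\<in>\<rat>. 0 < c \<longrightarrow> 0 < d \<longrightarrow>
     y \<in> {0<..<1} \<inter> {y. c + 2 * d < h y} \<longrightarrow> D c d y = 0"
  proof -
    have "AE y in lborel. 0 < c \<longrightarrow> 0 < d \<longrightarrow> y \<in> {0<..<1} \<inter> {y. c + 2 * d < h y} \<longrightarrow> D c d y = 0" for c d
      by (cases "0 < c \<and> 0 < d") (use D0 in auto)
    then show ?thesis by (simp only: AE_ball_countable[OF countable_rat]) blast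
  qed
  moreover have "AE y in lborel. y \<noteq> (0::real)" "AE y in lborel. y \<noteq> (1::real)"
    by (rule AE_lborel_singleton)+
  moreover note Fubini_plane(4)[OF f]
  ultimately show ?thesis
  proof eventually_elim
    case (elim y)
    show ?case
    proof (intro impI ballI)
      fix Z assume y: "y \<in> {0..1}" and Z: "Z \<in> {0..h y}"
      show "integral {0..Z} (\<lambda>t. f (y, t)) = Z / h y * integral {0..h y} (\<lambda>t. f (y, t))"
      proof (rule linear_if_second_differences_vanish)
        fix c d :: real assume cd: "c \<in> \<rat>" "d \<in> \<rat>" "0 < c" "0 < d" "c + 2 * d < h y"
        then have "D c d y = 0" using elim y by force
        then show "integral {0..c + 2 * d} (\<lambda>t. f (y, t)) - integral {0..c + d} (\<lambda>t. f (y, t)) =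
           integral {0..c + d} (\<lambda>t. f (y, t)) - integral {0..c} (\<lambda>t. f (y, t))"
          by (intro primitive_second_difference elim) (use cd in \<open>auto simp: D_def st_def\<close>)
      qed (use h(3) Z primitive_continuous elim in auto)
    qed
  qed
qed

section \<open>Traces\<close>

lemma smooth_dZ:
  assumes "smooth \<phi>"
  shows "((\<lambda>Z. \<phi> (y, Z)) has_real_derivative dZ \<phi> (y, Z)) (at Z)" "smooth (dZ \<phi>)"
proof -
  have C: "C_diff (Suc k) \<phi>" for k using assms by (simp add: smooth_def)
  have d: "((\<lambda>Z. \<phi> (y, Z)) has_real_derivative frechet_derivative \<phi> (at (y, Z)) (0, 1)) (at Z)" for y Z
  proof -
    note D = C_diff_has_derivative[OF C[of 0], of "(y, Z)"]
    have "((\<lambda>Z. (y, Z)) has_derivative (\<lambda>d. (0, d))) (at Z)"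
      by (auto intro!: derivative_eq_intros)
    from has_derivative_compose[OF this D]
    have 1: "((\<lambda>Z. \<phi> (y, Z)) has_derivative (\<lambda>d. frechet_derivative \<phi> (at (y, Z)) (0, d))) (at Z)" .
    have 2: "frechet_derivative \<phi> (at (y, Z)) (0, d) = frechet_derivative \<phi> (at (y, Z)) (0, 1) * d" for d
    proof -
      have "frechet_derivative \<phi> (at (y, Z)) (d *\<^sub>R (0, 1)) = d *\<^sub>R frechet_derivative \<phi> (at (y, Z)) (0, 1)"
        by (rule linear_scale[OF has_derivative_linear[OF D]])
      then show ?thesis unfolding scaleR_Pair real_scaleR_def mult_zero_right mult_1_right
        by (rule trans) (rule mult.commute)
    qed
    have "(\<lambda>d. frechet_derivative \<phi> (at (y, Z)) (0, d)) = (*) (frechet_derivative \<phi> (at (y, Z)) (0, 1))"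
      by (rule ext) (rule 2)
    with 1 show ?thesis unfolding has_field_derivative_def by (rule back_subst)
  qed
  have eq: "dZ \<phi> x = frechet_derivative \<phi> (at x) (0, 1)" for x
    unfolding dZ_def using DERIV_imp_deriv[OF d[of "fst x" "snd x"]] by simp
  show "((\<lambda>Z. \<phi> (y, Z)) has_real_derivative dZ \<phi> (y, Z)) (at Z)" unfolding eq by (rule d)
  have "dZ \<phi> = (\<lambda>x. frechet_derivative \<phi> (at x) (0, 1))" using eq by (simp add: fun_eq_iff)
  moreover have "C_diff k (\<lambda>x. frechet_derivative \<phi> (at x) (0, 1))" for k using C[of k] by simp
  ultimately show "smooth (dZ \<phi>)" by (simp add: smooth_def)
qed

text \<open>From \<open>\<bar>F\<bar> \<le> \<epsilon> + F\<^sup>2 / \<epsilon>\<close> on \<open>S\<close>, with a suitable \<open>\<epsilon>\<close>.\<close>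

lemma L2_limit_imp_L1_limit:
  fixes F :: "nat \<Rightarrow> 'a::euclidean_space \<Rightarrow> real"
  assumes S: "S \<in> sets borel" "emeasure lborel S < \<infinity>"
    and F: "\<And>n. integrable lborel (F n)" "\<And>n. integrable lborel (\<lambda>x. (F n x)\<^sup>2)" "\<And>n x. x \<notin> S \<Longrightarrow> F n x = 0"
    and lim: "(\<lambda>n. LINT x|lborel. (F n x)\<^sup>2) \<longlonglongrightarrow> 0"
  shows "(\<lambda>n. LINT x|lborel. \<bar>F n x\<bar>) \<longlonglongrightarrow> 0"
proof (rule LIMSEQ_I)
  fix e :: real assume e: "0 < e"
  define m where "m = measure lborel S"
  define \<epsilon> where "\<epsilon> = e / (2 * (m + 1))"
  have m: "0 \<le> m" by (simp add: m_def)
  have \<epsilon>: "0 < \<epsilon>" "\<epsilon> * m < e / 2" using e m by (auto simp: \<epsilon>_def field_simps)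
  obtain N where N: "\<And>n. n \<ge> N \<Longrightarrow> norm ((LINT x|lborel. (F n x)\<^sup>2) - 0) < \<epsilon> * (e / 2)"
    using LIMSEQ_D[OF lim, of "\<epsilon> * (e / 2)"] e \<epsilon> by auto
  show "\<exists>N. \<forall>n\<ge>N. norm ((LINT x|lborel. \<bar>F n x\<bar>) - 0) < e"
  proof (intro exI allI impI)
    fix n assume "n \<ge> N"
    have pw: "\<bar>F n x\<bar> \<le> \<epsilon> * indicator S x + (F n x)\<^sup>2 / \<epsilon>" for x
    proof (cases "x \<in> S")
      case True
      have "0 \<le> (\<bar>F n x\<bar> - \<epsilon>)\<^sup>2 + \<epsilon> * \<bar>F n x\<bar>" using \<epsilon> by simp
      then have "\<epsilon> * \<bar>F n x\<bar> \<le> \<epsilon> * \<epsilon> + (F n x)\<^sup>2"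
        by (simp add: power2_eq_square algebra_simps abs_mult_self_eq)
      then show ?thesis using True \<epsilon> by (simp add: field_simps)
    qed (simp add: F)
    have iS: "integrable lborel (\<lambda>x. \<epsilon> * indicator S x)"
      using S by (intro integrable_mult_right integrable_real_indicator) auto
    have "(LINT x|lborel. \<bar>F n x\<bar>) \<le> (LINT x|lborel. \<epsilon> * indicator S x + (F n x)\<^sup>2 / \<epsilon>)"
      by (rule integral_mono) (use pw F iS in auto)
    also have "\<dots> = \<epsilon> * m + (LINT x|lborel. (F n x)\<^sup>2) / \<epsilon>"
      using iS F(2) S by (simp add: m_def)
    also have "\<dots> < e / 2 + e / 2"
    proof -
      have "(LINT x|lborel. (F n x)\<^sup>2) < \<epsilon> * (e / 2)" using N[OF \<open>n \<ge> N\<close>] by auto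
      then have "(LINT x|lborel. (F n x)\<^sup>2) / \<epsilon> < e / 2" using \<epsilon> by (simp add: field_simps)
      then show ?thesis using \<epsilon> by linarith
    qed
    finally show "norm ((LINT x|lborel. \<bar>F n x\<bar>) - 0) < e" by simp
  qed
qed

text \<open>Used to read off the boundary value at \<open>Z = h y\<close> from two representations of the velocity that
  coincide almost everywhere on a vertical segment.\<close>

lemma AE_interval_eq_imp_eq_at_end:
  fixes f g :: "real \<Rightarrow> real"
  assumes L: "0 < L" and cont: "continuous_on {0..L} f" "continuous_on {0..L} g"
    and eq: "AE Z in lborel. 0 < Z \<and> Z < L \<longrightarrow> f Z = g Z"
  shows "f L = g L"
proof -
  have "\<exists>Z. max 0 (L - inverse (real (Suc n))) < Z \<and> Z < L \<and> f Z = g Z" for n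
  proof (rule ccontr)
    let ?I = "{max 0 (L - inverse (real (Suc n)))<..<L}"
    assume "\<not> ?thesis"
    then have "AE Z in lborel. Z \<notin> ?I" using eq by (auto elim!: eventually_mono)
    then have "?I \<in> null_sets lborel" by (subst AE_iff_null_sets) auto
    then have "emeasure lborel ?I = 0" by (rule null_setsD1)
    then show False using L by (simp add: max_def split: if_splits)
  qed
  then obtain z where z: "\<And>n. max 0 (L - inverse (real (Suc n))) < z n" "\<And>n. z n < L" "\<And>n. f (z n) = g (z n)"
    by metis
  have inv: "(\<lambda>n. inverse (real (Suc n))) \<longlonglongrightarrow> 0" by (rule LIMSEQ_inverse_real_of_nat)
  have "(\<lambda>n. L - inverse (real (Suc n))) \<longlonglongrightarrow> L" using tendsto_diff[OF tendsto_const inv, of L] by simp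
  then have lz: "z \<longlonglongrightarrow> L"
    using z(1,2) by (intro tendsto_sandwich[OF _ _ \<open>(\<lambda>n. L - inverse (real (Suc n))) \<longlonglongrightarrow> L\<close> tendsto_const])
       (auto intro!: always_eventually less_imp_le)
  have zin: "\<forall>\<^sub>F n in sequentially. z n \<in> {0..L}" using z by (auto intro!: always_eventually less_imp_le)
  have "(\<lambda>n. f (z n)) \<longlonglongrightarrow> f L" "(\<lambda>n. g (z n)) \<longlonglongrightarrow> g L"
    using L by (auto intro!: continuous_on_tendsto_compose[OF cont(1) lz _ zin] continuous_on_tendsto_compose[OF cont(2) lz _ zin])
  then show ?thesis unfolding z(3) by (rule LIMSEQ_unique)
qed

lemma torus_fun_bounds:
  assumes h: "continuous_on UNIV h" "periodic1 h" "\<And>y. 0 < h y"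
  obtains b B :: real where "0 < b" "\<And>y. b < h y" "\<And>y. h y < B"
proof -
  have c: "continuous_on {0..1} h" using h(1) continuous_on_subset by blast
  have "\<exists>y0\<in>{0..1}. \<forall>y\<in>{0..1}. h y0 \<le> h y" "\<exists>y1\<in>{0..1}. \<forall>y\<in>{0..1}. h y \<le> h y1"
    by (rule continuous_attains_inf continuous_attains_sup; use c in simp)+
  then obtain y0 y1 where y0: "\<And>y. y \<in> {0..1} \<Longrightarrow> h y0 \<le> h y"
    and y1: "\<And>y. y \<in> {0..1} \<Longrightarrow> h y \<le> h y1"
    by blast
  have red: "\<exists>y'\<in>{0..1}. h y = h y'" for y
  proof
    interpret periodic_fun_simple' h by (rule h(2))
    show "h y = h (frac y)" by (simp add: frac_def minus_of_int)
    show "frac y \<in> {0..1}" using frac_lt_1[of y] by (simp add: less_imp_le)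
  qed
  show ?thesis
  proof
    show "0 < h y0 / 2" using h(3) by simp
    show "h y0 / 2 < h y" for y
    proof -
      obtain y' where "y' \<in> {0..1}" "h y = h y'" using red by blast
      then show ?thesis using y0[of y'] h(3)[of y0] by simp
    qed
    show "h y < h y1 + 1" for y
    proof -
      obtain y' where "y' \<in> {0..1}" "h y = h y'" using red by blast
      then show ?thesis using y1[of y'] by simp
    qed
  qed
qed

lemma Q_borel:
  assumes "continuous_on UNIV h"
  shows "Q h \<in> sets borel"
proof -
  have [measurable]: "h \<in> borel_measurable borel" using assms by (rule borel_measurable_continuous_onI)
  have "Q h = {x \<in> space borel. 0 \<le> fst x \<and> fst x \<le> 1 \<and> 0 < snd x \<and> snd x < h (fst x)}"
    by (auto simp: Q_def)
  also have "\<dots> \<in> sets borel" by measurable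
  finally show ?thesis .
qed

lemma Q_finite:
  fixes h :: "real \<Rightarrow> real" and B :: real
  assumes "\<And>y. h y < B"
  shows "emeasure lborel (Q h) < \<infinity>"
proof -
  have "Q h \<subseteq> cbox (0, 0) (1, B)"
    using assms by (auto simp: Q_def intro!: less_imp_le[OF order.strict_trans[of _ "h _"]])
  then have "emeasure lborel (Q h) \<le> emeasure lborel (cbox (0::real, 0::real) (1, B))"
    by (rule emeasure_mono) simp
  then show ?thesis by (rule order.strict_trans1[OF _ emeasure_lborel_cbox_finite])
qed

lemma continuous_indicator_square_integrable:
  fixes \<phi> :: "'a::euclidean_space \<Rightarrow> real"
  assumes \<phi>: "continuous_on UNIV \<phi>" and S: "S \<in> sets borel" "emeasure lborel S < \<infinity>" "bounded S"
  shows "integrable lborel (\<lambda>x. indicator S x * \<phi> x)" "integrable lborel (\<lambda>x. (indicator S x * \<phi> x)\<^sup>2)"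
proof -
  have "compact (\<phi> ` closure S)"
    using S \<phi> by (intro compact_continuous_image) (auto intro: continuous_on_subset)
  then obtain B where B: "\<And>x. x \<in> closure S \<Longrightarrow> \<bar>\<phi> x\<bar> \<le> B"
    using compact_imp_bounded bounded_iff by (metis image_eqI real_norm_def)
  then have B': "\<bar>indicator S x * \<phi> x\<bar> \<le> max 0 B" for x
    using closure_subset[of S] by (auto simp: indicator_def abs_mult le_max_iff_disj)
  have i: "integrable lborel (indicator S :: 'a \<Rightarrow> real)" using S by (intro integrable_real_indicator) auto
  have m: "\<phi> \<in> borel_measurable borel" using \<phi> by (rule borel_measurable_continuous_onI)
  have m': "(\<lambda>x. indicator S x * \<phi> x) \<in> borel_measurable borel" using m S by simp
  have "integrable lborel (\<lambda>x. indicator S x * (indicator S x * \<phi> x))"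
    by (rule integrable_mult_bounded[OF i _ B']) (use m' in simp)
  moreover have "(\<lambda>x. indicator S x * (indicator S x * \<phi> x)) = (\<lambda>x. indicator S x * \<phi> x)"
    by (auto simp: indicator_def)
  ultimately show 1: "integrable lborel (\<lambda>x. indicator S x * \<phi> x)" by simp
  have "integrable lborel (\<lambda>x. (indicator S x * \<phi> x) * (indicator S x * \<phi> x))"
    by (rule integrable_mult_bounded[OF 1 _ B']) (use m' in simp)
  then show "integrable lborel (\<lambda>x. (indicator S x * \<phi> x)\<^sup>2)" by (simp add: power2_eq_square)
qed

lemma square_integrable_diff:
  fixes f g :: "'a \<Rightarrow> real"
  assumes [measurable]: "f \<in> borel_measurable M" "g \<in> borel_measurable M"
    and "integrable M (\<lambda>x. (f x)\<^sup>2)" "integrable M (\<lambda>x. (g x)\<^sup>2)"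
  shows "integrable M (\<lambda>x. (f x - g x)\<^sup>2)"
proof (rule Bochner_Integration.integrable_bound)
  show "integrable M (\<lambda>x. 2 * (f x)\<^sup>2 + 2 * (g x)\<^sup>2)" using assms by simp
  have "norm ((f x - g x)\<^sup>2) \<le> norm (2 * (f x)\<^sup>2 + 2 * (g x)\<^sup>2)" for x
  proof -
    have "0 \<le> (f x + g x)\<^sup>2" by simp
    then have "(f x - g x)\<^sup>2 \<le> 2 * (f x)\<^sup>2 + 2 * (g x)\<^sup>2"
      by (simp add: power2_sum power2_diff)
    then show ?thesis by simp
  qed
  then show "AE x in M. norm ((f x - g x)\<^sup>2) \<le> norm (2 * (f x)\<^sup>2 + 2 * (g x)\<^sup>2)" by simp
qed simp

lemma Q_bounded:
  assumes "\<And>y. h y < B"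
  shows "bounded (Q h)"
proof (rule bounded_subset[OF bounded_cbox])
  show "Q h \<subseteq> cbox (0, 0) (1, B)"
    using assms by (auto simp: Q_def intro!: less_imp_le[OF order.strict_trans[of _ "h _"]])
qed

lemma L2_approximation_L1:
  fixes v :: "'a::euclidean_space \<Rightarrow> real"
  assumes S: "S \<in> sets borel" "emeasure lborel S < \<infinity>" "bounded S"
    and v: "L2_on S v" and V: "V \<in> borel_measurable borel" "AE x in lborel. x \<in> S \<longrightarrow> v x = V x" "\<And>x. x \<notin> S \<Longrightarrow> V x = 0"
    and \<phi>: "\<And>n. continuous_on UNIV (\<phi> n)"
    and lim: "(\<lambda>n. LINT x|lebesgue_on S. (\<phi> n x - v x)\<^sup>2) \<longlonglongrightarrow> 0"
  shows "integrable lborel (\<lambda>x. \<bar>indicator S x * \<phi> n x - V x\<bar>)"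
    and "(\<lambda>n. LINT x|lborel. \<bar>indicator S x * \<phi> n x - V x\<bar>) \<longlonglongrightarrow> 0"
proof -
  have iV: "integrable lborel V" "integrable lborel (\<lambda>x. (V x)\<^sup>2)"
    by (rule L2_on_integrable[OF v S(1,2) V(1,2)], erule V(3))+
  note i\<phi> = continuous_indicator_square_integrable[OF \<phi> S]
  have i: "integrable lborel (\<lambda>x. indicator S x * \<phi> n x - V x)" for n
    using iV(1) i\<phi>(1) by (rule Bochner_Integration.integrable_diff[rotated])
  then show "integrable lborel (\<lambda>x. \<bar>indicator S x * \<phi> n x - V x\<bar>)" by simp
  have m\<phi>: "\<phi> n \<in> borel_measurable borel" for n using \<phi> by (rule borel_measurable_continuous_onI)
  show "(\<lambda>n. LINT x|lborel. \<bar>indicator S x * \<phi> n x - V x\<bar>) \<longlonglongrightarrow> 0"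
  proof (rule L2_limit_imp_L1_limit[OF S(1,2) i])
    show "integrable lborel (\<lambda>x. (indicator S x * \<phi> n x - V x)\<^sup>2)" for n
      by (rule square_integrable_diff) (use iV i\<phi> m\<phi> V S in auto)
    have "(LINT x|lebesgue_on S. (\<phi> n x - v x)\<^sup>2) = (LINT x|lborel. (indicator S x * \<phi> n x - V x)\<^sup>2)" for n
    proof (rule lebesgue_on_integral_eq(1)[OF S(1)])
      show "AE x in lborel. x \<in> S \<longrightarrow> (\<phi> n x - v x)\<^sup>2 = (indicator S x * \<phi> n x - V x)\<^sup>2"
        using V(2) by eventually_elim auto
    qed (use m\<phi> V(1) S in \<open>simp_all add: V(3)\<close>)
    then show "(\<lambda>n. LINT x|lborel. (indicator S x * \<phi> n x - V x)\<^sup>2) \<longlonglongrightarrow> 0" using lim by simp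
  qed (simp add: V(3))
qed

text \<open>For smooth functions this is the fundamental theorem of calculus on vertical segments. The
  approximating sequence of the trace converges, together with its \<open>Z\<close>-derivative and its boundary
  values, in \<open>L\<^sup>1\<close>; along a subsequence the three errors, integrated over a vertical segment,
  tend to zero for almost every \<open>y\<close>.

  The weak derivative \<open>W\<close> is part of the conclusion: the two traces come with derivatives
  that are not identified with each other here.\<close>

lemma trace_formula:
  assumes h: "continuous_on UNIV h" "periodic1 h" "\<And>y. 0 < h y"
    and b: "continuous_on UNIV b" "\<And>y. 0 \<le> b y" "\<And>y. b y \<le> h y"
    and tr: "has_trace h v b (\<lambda>_. g)"
    and V: "V \<in> borel_measurable borel" "AE x in lborel. x \<in> Q h \<longrightarrow> v x = V x" "\<And>x. x \<notin> Q h \<Longrightarrow> V x = 0"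
  obtains W where "integrable lborel W" "\<And>x. x \<notin> Q h \<Longrightarrow> W x = 0"
    "\<And>\<phi>. test_Q h \<phi> \<Longrightarrow> (LINT x|lborel. V x * dZ \<phi> x) = - (LINT x|lborel. W x * \<phi> x)"
    "AE y in lborel. y \<in> {0..1} \<longrightarrow> (AE Z in lborel. 0 < Z \<and> Z < h y \<longrightarrow>
       V (y, Z) = g + integral {0..Z} (\<lambda>t. W (y, t)) - integral {0..b y} (\<lambda>t. W (y, t)))"
proof -
  obtain H0 H where "0 < H0" "\<And>y. H0 < h y" and H: "\<And>y. h y < H"
    using torus_fun_bounds[OF h] by blast
  note SQ = Q_borel[OF h(1)] Q_finite[OF H] Q_bounded[OF H]
  obtain w \<phi> where w: "L2_on (Q h) w" "weak_dZ h v w"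
    and \<phi>': "\<forall>n::nat. smooth (\<phi> n) \<and> y_periodic (\<phi> n)"
    and l1: "(\<lambda>n. LINT x|lebesgue_on (Q h). (\<phi> n x - v x)\<^sup>2) \<longlonglongrightarrow> 0"
    and l2: "(\<lambda>n. LINT x|lebesgue_on (Q h). (dZ (\<phi> n) x - w x)\<^sup>2) \<longlonglongrightarrow> 0"
    and l3: "(\<lambda>n. LINT y|lebesgue_on {0..1}. (\<phi> n (y, b y) - g)\<^sup>2) \<longlonglongrightarrow> 0"
    and v: "L2_on (Q h) v"
    using tr unfolding has_trace_def by (elim conjE exE) (rule that)
  have \<phi>: "\<And>n. smooth (\<phi> n)" using \<phi>' by blast
  obtain W where W: "W \<in> borel_measurable borel" "AE x in lborel. x \<in> Q h \<longrightarrow> w x = W x" "\<And>x. x \<notin> Q h \<Longrightarrow> W x = 0"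
    using borel_version[OF SQ(1), of w] w(1) unfolding L2_on_def by blast
  have iW: "integrable lborel W" by (rule L2_on_integrable(1)[OF w(1) SQ(1,2) W])
  have iV: "integrable lborel V" by (rule L2_on_integrable(1)[OF v SQ(1,2) V])
  have d: "continuous_on UNIV (dZ (\<phi> n))" for n using smooth_dZ(2)[OF \<phi>] smooth_continuous by blast
  have A: "integrable lborel (\<lambda>x. \<bar>indicator (Q h) x * \<phi> n x - V x\<bar>)"
    "(\<lambda>n. LINT x|lborel. \<bar>indicator (Q h) x * \<phi> n x - V x\<bar>) \<longlonglongrightarrow> 0" for n
    by (rule L2_approximation_L1[OF SQ v V(1,2) _ smooth_continuous[OF \<phi>] l1], erule V(3))+
  have R: "integrable lborel (\<lambda>x. \<bar>indicator (Q h) x * dZ (\<phi> n) x - W x\<bar>)"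
    "(\<lambda>n. LINT x|lborel. \<bar>indicator (Q h) x * dZ (\<phi> n) x - W x\<bar>) \<longlonglongrightarrow> 0" for n
    by (rule L2_approximation_L1[OF SQ w(1) W(1,2) _ d l2], erule W(3))+
  have cb: "continuous_on UNIV (\<lambda>y. \<phi> n (y, b y))" for n
    by (rule continuous_on_compose2[OF smooth_continuous[OF \<phi>[of n]]])
       (auto intro!: continuous_on_Pair continuous_on_id b(1))
  have L2g: "L2_on {0..1::real} (\<lambda>_. g)" using tr unfolding has_trace_def by blast
  have B: "integrable lborel (\<lambda>y. \<bar>indicator {0..1} y * \<phi> n (y, b y) - indicator {0..1} y * g\<bar>)"
      "(\<lambda>n. LINT y|lborel. \<bar>indicator {0..1} y * \<phi> n (y, b y) - indicator {0..1} y * g\<bar>) \<longlonglongrightarrow> 0" for n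
    by (rule L2_approximation_L1[OF _ _ _ L2g _ _ _ cb l3]; simp)+
  \<comment> \<open>the error of the \<open>n\<close>-th approximation on the vertical segment over \<open>y\<close>\<close>
  define u where "u n y = (LINT Z|lborel. \<bar>indicator (Q h) (y, Z) * \<phi> n (y, Z) - V (y, Z)\<bar>)
     + \<bar>indicator {0..1} y * \<phi> n (y, b y) - indicator {0..1} y * g\<bar>
     + (LINT Z|lborel. \<bar>indicator (Q h) (y, Z) * dZ (\<phi> n) (y, Z) - W (y, Z)\<bar>)" for n y
  have iu: "integrable lborel (u n)" for n
    unfolding u_def using Fubini_plane(3)[OF A(1)] Fubini_plane(3)[OF R(1)] B(1)
    by (intro Bochner_Integration.integrable_add) auto
  have "(\<lambda>n. (LINT x|lborel. \<bar>indicator (Q h) x * \<phi> n x - V x\<bar>)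
      + (LINT y|lborel. \<bar>indicator {0..1} y * \<phi> n (y, b y) - indicator {0..1} y * g\<bar>)
      + (LINT x|lborel. \<bar>indicator (Q h) x * dZ (\<phi> n) x - W x\<bar>)) \<longlonglongrightarrow> 0 + 0 + 0"
    by (intro tendsto_add A(2) B(2) R(2))
  moreover have "(LINT y|lborel. u n y) = (LINT x|lborel. \<bar>indicator (Q h) x * \<phi> n x - V x\<bar>)
      + (LINT y|lborel. \<bar>indicator {0..1} y * \<phi> n (y, b y) - indicator {0..1} y * g\<bar>)
      + (LINT x|lborel. \<bar>indicator (Q h) x * dZ (\<phi> n) x - W x\<bar>)" for n
    unfolding u_def Fubini_plane(1)[OF A(1), symmetric] Fubini_plane(1)[OF R(1), symmetric]
    using Fubini_plane(3)[OF A(1)] Fubini_plane(3)[OF R(1)] B(1) by simp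
  moreover have u0: "0 \<le> u n y" for n y by (simp add: u_def)
  ultimately have "(\<lambda>n. LINT y|lborel. norm (u n y)) \<longlonglongrightarrow> 0" by simp
  then obtain r where r: "strict_mono r" "AE y in lborel. (\<lambda>n. u (r n) y) \<longlonglongrightarrow> 0"
    using tendsto_L1_AE_subseq[of lborel u, OF iu] by blast
  have secA: "AE y in lborel. \<forall>n. integrable lborel (\<lambda>Z. \<bar>indicator (Q h) (y, Z) * \<phi> n (y, Z) - V (y, Z)\<bar>)"
    using Fubini_plane(4)[OF A(1)] by (simp add: AE_all_countable)
  have secR: "AE y in lborel. \<forall>n. integrable lborel (\<lambda>Z. \<bar>indicator (Q h) (y, Z) * dZ (\<phi> n) (y, Z) - W (y, Z)\<bar>)"
    using Fubini_plane(4)[OF R(1)] by (simp add: AE_all_countable)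
  show ?thesis
  proof (rule that[OF iW W(3)])
    fix \<theta> assume t: "test_Q h \<theta>"
    then have sm: "smooth \<theta>" by (simp add: test_Q_def)
    have "(LINT x|lebesgue_on (Q h). v x * dZ \<theta> x) = (LINT x|lborel. V x * dZ \<theta> x)"
    proof (rule lebesgue_on_integral_eq(1)[OF SQ(1)])
      show "AE x in lborel. x \<in> Q h \<longrightarrow> v x * dZ \<theta> x = V x * dZ \<theta> x" using V(2) by eventually_elim auto
    qed (use V smooth_borel[OF smooth_dZ(2)[OF sm]] in auto)
    moreover have "(LINT x|lebesgue_on (Q h). w x * \<theta> x) = (LINT x|lborel. W x * \<theta> x)"
    proof (rule lebesgue_on_integral_eq(1)[OF SQ(1)])
      show "AE x in lborel. x \<in> Q h \<longrightarrow> w x * \<theta> x = W x * \<theta> x" using W(2) by eventually_elim auto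
    qed (use W smooth_borel[OF sm] in auto)
    ultimately show "(LINT x|lborel. V x * dZ \<theta> x) = - (LINT x|lborel. W x * \<theta> x)"
      using w(2) t by (simp add: weak_dZ_def)
  next
    show "AE y in lborel. y \<in> {0..1} \<longrightarrow> (AE Z in lborel. 0 < Z \<and> Z < h y \<longrightarrow>
       V (y, Z) = g + integral {0..Z} (\<lambda>t. W (y, t)) - integral {0..b y} (\<lambda>t. W (y, t)))"
      using r(2) secA secR Fubini_plane(4)[OF iW] Fubini_plane(4)[OF iV]
    proof eventually_elim
      case (elim y)
      show ?case
      proof
        assume y: "y \<in> {0..1}"
        define T where "T Z = integral {0..Z} (\<lambda>t. W (y, t)) - integral {0..b y} (\<lambda>t. W (y, t))" for Z
        define E where "E Z = indicator {0..h y} Z * \<bar>V (y, Z) - g - T Z\<bar>" for Z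
        have Qy: "indicator (Q h) (y, t) = (indicator {0<..<h y} t :: real)" for t
          using y by (auto simp: Q_def indicator_def)
        have bound: "\<bar>V (y, Z) - g - T Z\<bar> \<le> \<bar>indicator (Q h) (y, Z) * \<phi> n (y, Z) - V (y, Z)\<bar> + u n y"
          if Z: "0 < Z" "Z < h y" for Z n
        proof -
          let ?d = "\<lambda>t. dZ (\<phi> n) (y, t)"
          let ?R = "\<lambda>t. indicator {0<..<h y} t * ?d t - W (y, t)"
          have iR: "integrable lborel (\<lambda>t. \<bar>?R t\<bar>)" using elim(3) by (simp add: Qy)
          have mR: "?R \<in> borel_measurable lborel"
          proof -
            have "(\<lambda>t. ?d t) \<in> borel_measurable borel"
              by (intro borel_measurable_continuous_onI continuous_on_compose2[OF d]) (auto intro!: continuous_intros)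
            then show ?thesis using elim(4) by auto
          qed
          have iR': "integrable lborel ?R"
            using iR mR by (rule Bochner_Integration.integrable_bound) auto
          have ftc: "(?d has_integral (\<phi> n (y, z) - \<phi> n (y, 0))) {0..z}" if "0 \<le> z" for z
            by (rule fundamental_theorem_of_calculus)
               (use that smooth_dZ(1)[OF \<phi>] in \<open>auto simp: has_real_derivative_iff_has_vector_derivative[symmetric]
                   intro: has_field_derivative_at_within\<close>)
          have prim: "integral {0..z} ?R = \<phi> n (y, z) - \<phi> n (y, 0) - integral {0..z} (\<lambda>t. W (y, t))"
            if z: "0 \<le> z" "z \<le> h y" for z
          proof -
            have "integral {0..z} ?R = integral {0..z} (\<lambda>t. ?d t - W (y, t))"
              unfolding integral_open_interval_real[of 0 z]
              by (rule Henstock_Kurzweil_Integration.integral_cong) (use z in \<open>auto simp: indicator_def\<close>)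
            also have "\<dots> = integral {0..z} ?d - integral {0..z} (\<lambda>t. W (y, t))"
              by (rule Henstock_Kurzweil_Integration.integral_diff)
                 (use ftc[OF z(1)] integral_eq_LINT(1)[OF elim(4)] in \<open>auto simp: integrable_on_def\<close>)
            finally show ?thesis using ftc[OF z(1)] by (simp add: integral_unique)
          qed
          have mono: "\<bar>integral {0..z2} ?R - integral {0..z1} ?R\<bar> \<le> (LINT t|lborel. \<bar>?R t\<bar>)" if "0 \<le> z1" "z1 \<le> z2" for z1 z2
          proof -
            have "\<bar>integral {0..z2} ?R - integral {0..z1} ?R\<bar> = \<bar>LINT t|lborel. indicator {z1<..<z2} t * ?R t\<bar>"
              using primitive_diff[OF iR' that] by simp
            also have "\<dots> \<le> (LINT t|lborel. \<bar>indicator {z1<..<z2} t * ?R t\<bar>)"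
              using integral_norm_bound[of lborel "\<lambda>t. indicator {z1<..<z2} t * ?R t"] by simp
            also have "\<dots> \<le> (LINT t|lborel. \<bar>?R t\<bar>)"
              by (rule integral_mono[OF integrable_abs[OF integrable_indicator_mult[OF iR']] iR])
                 (auto simp: indicator_def)
            finally show ?thesis .
          qed
          have "\<bar>integral {0..Z} ?R - integral {0..b y} ?R\<bar> \<le> (LINT t|lborel. \<bar>?R t\<bar>)"
          proof (cases "b y \<le> Z")
            case True then show ?thesis using mono[of "b y" Z] b(2) by simp
          next
            case False then show ?thesis using mono[of Z "b y"] Z by (simp add: abs_minus_commute)
          qed
          moreover have "integral {0..Z} ?R - integral {0..b y} ?R = \<phi> n (y, Z) - \<phi> n (y, b y) - T Z"
          proof -
            have "integral {0..Z} ?R = \<phi> n (y, Z) - \<phi> n (y, 0) - integral {0..Z} (\<lambda>t. W (y, t))"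
              by (rule prim) (use Z in auto)
            moreover have "integral {0..b y} ?R = \<phi> n (y, b y) - \<phi> n (y, 0) - integral {0..b y} (\<lambda>t. W (y, t))"
              by (rule prim) (rule b(2), rule b(3))
            ultimately show ?thesis unfolding T_def by linarith
          qed
          ultimately have T1: "\<bar>\<phi> n (y, Z) - \<phi> n (y, b y) - T Z\<bar> \<le> (LINT t|lborel. \<bar>?R t\<bar>)" by simp
          have "u n y = (LINT Z|lborel. \<bar>indicator (Q h) (y, Z) * \<phi> n (y, Z) - V (y, Z)\<bar>)
             + \<bar>\<phi> n (y, b y) - g\<bar> + (LINT t|lborel. \<bar>?R t\<bar>)"
            using y by (simp add: u_def Qy)
          moreover have "0 \<le> (LINT Z|lborel. \<bar>indicator (Q h) (y, Z) * \<phi> n (y, Z) - V (y, Z)\<bar>)" by simp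
          moreover have "indicator (Q h) (y, Z) * \<phi> n (y, Z) = \<phi> n (y, Z)" using Z by (simp add: Qy)
          ultimately show ?thesis using T1 by (simp only:)
        qed
        have contT: "continuous_on {0..h y} T"
          unfolding T_def by (intro continuous_intros primitive_continuous elim)
        have iE0: "integrable lborel (\<lambda>Z. indicator {0..h y} Z * (V (y, Z) - g - T Z))"
        proof -
          have "integrable lborel (\<lambda>Z. indicator {0..h y} Z *\<^sub>R (g + T Z))"
            by (rule borel_integrable_compact) (auto intro!: continuous_intros contT)
          from Bochner_Integration.integrable_diff[OF integrable_indicator_mult[OF elim(5), of "{0..h y}"] this]
          show ?thesis by (simp add: algebra_simps)
        qed
        have iE: "integrable lborel E"
          using integrable_abs[OF iE0] by (simp add: E_def[abs_def] abs_mult)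
        have "(LINT Z|lborel. E Z) \<le> (1 + h y) * u n y" for n
        proof -
          let ?A = "\<lambda>Z. \<bar>indicator (Q h) (y, Z) * \<phi> n (y, Z) - V (y, Z)\<bar>"
          have iI: "integrable lborel (\<lambda>Z. indicator {0..h y} Z * u n y)"
            by (intro integrable_mult_left integrable_real_indicator) (use h(3) in \<open>auto simp: less_imp_le\<close>)
          have "(LINT Z|lborel. E Z) \<le> (LINT Z|lborel. ?A Z + indicator {0..h y} Z * u n y)"
          proof (rule integral_mono_AE[OF iE])
            show "AE Z in lborel. E Z \<le> ?A Z + indicator {0..h y} Z * u n y"
              using AE_lborel_singleton[of 0] AE_lborel_singleton[of "h y"]
            proof eventually_elim
              case (elim Z)
              show ?case
              proof (cases "0 < Z \<and> Z < h y")
                case True then show ?thesis using bound[of Z n] by (simp add: E_def)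
              next
                case False then show ?thesis using elim by (auto simp: E_def indicator_def)
              qed
            qed
          qed (use elim(2) iI in auto)
          also have "\<dots> = (LINT Z|lborel. ?A Z) + h y * u n y"
            using elim(2) iI h(3)[of y] by simp
          also have "\<dots> \<le> u n y + h y * u n y" by (simp add: u_def)
          finally show ?thesis by (simp add: algebra_simps)
        qed
        then have "\<And>n. (LINT Z|lborel. E Z) \<le> (1 + h y) * u (r n) y" by blast
        moreover have "(\<lambda>n. (1 + h y) * u (r n) y) \<longlonglongrightarrow> (1 + h y) * 0"
          by (intro tendsto_mult tendsto_const elim)
        ultimately have "(LINT Z|lborel. E Z) \<le> 0"
          by (intro LIMSEQ_le_const[where X = "\<lambda>n. (1 + h y) * u (r n) y"]) auto
        moreover have E0: "0 \<le> E Z" for Z by (simp add: E_def)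
        moreover have "0 \<le> (LINT Z|lborel. E Z)" by (rule Bochner_Integration.integral_nonneg) (rule E0)
        ultimately have "(LINT Z|lborel. E Z) = 0" by linarith
        then have "AE Z in lborel. E Z = 0"
          using integral_nonneg_eq_0_iff_AE[OF iE] E0 by simp
        then show "AE Z in lborel. 0 < Z \<and> Z < h y \<longrightarrow>
            V (y, Z) = g + integral {0..Z} (\<lambda>t. W (y, t)) - integral {0..b y} (\<lambda>t. W (y, t))"
          by eventually_elim (auto simp: E_def T_def)
      qed
    qed
  qed
qed

section \<open>Momentum equation\<close>

lemma LINT_tensor:
  fixes f g :: "real \<Rightarrow> real"
  assumes "integrable lborel f" "integrable lborel g"
  shows "(LINT x|lborel. tensor f g x) = (LINT y|lborel. f y) * (LINT Z|lborel. g Z)"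
  using Fubini_plane(1)[OF integrable_tensor[OF assms]] by simp

lemma integrable_compact_support:
  fixes k :: "real \<Rightarrow> real"
  assumes k: "continuous_on UNIV k" "\<And>Z. Z \<notin> {a..b} \<Longrightarrow> k Z = 0"
  shows "integrable lborel k"
proof -
  have "integrable lborel (\<lambda>Z. indicator {a..b} Z *\<^sub>R k Z)"
    by (rule borel_integrable_compact) (use k(1) in \<open>auto intro: continuous_on_subset\<close>)
  moreover have "(\<lambda>Z. indicator {a..b} Z *\<^sub>R k Z) = k" using k(2) by (auto simp: fun_eq_iff indicator_def)
  ultimately show ?thesis by simp
qed

lemma bounded_compact_support:
  fixes k :: "real \<Rightarrow> real"
  assumes k: "continuous_on UNIV k" "\<And>Z. Z \<notin> {a..b} \<Longrightarrow> k Z = 0"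
  obtains B where "\<And>Z. \<bar>k Z\<bar> \<le> B"
proof -
  have "compact (k ` {a..b})"
    using k by (intro compact_continuous_image) (auto intro: continuous_on_subset)
  then obtain B where B: "\<And>y. y \<in> {a..b} \<Longrightarrow> \<bar>k y\<bar> \<le> B"
    using compact_imp_bounded bounded_iff by (metis image_eqI real_norm_def)
  have "\<bar>k Z\<bar> \<le> max 0 B" for Z
  proof (cases "Z \<in> {a..b}")
    case True then show ?thesis using B[of Z] by simp
  next
    case False then show ?thesis using k(2)[of Z] by simp
  qed
  then show ?thesis using that by blast
qed

lemma integral_deriv_compact_support:
  fixes k :: "real \<Rightarrow> real"
  assumes k: "\<And>Z. (k has_real_derivative k' Z) (at Z)" "continuous_on UNIV k'"
    and supp: "\<And>Z. Z \<notin> {a..b} \<Longrightarrow> k Z = 0"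
  shows "(LINT Z|lborel. k' Z) = 0"
proof -
  let ?a = "min a b - 1" and ?b = "max a b + 1"
  have k'0: "k' Z = 0" if "Z \<notin> {a..b}" for Z
    using deriv_zero_outside[of "{a..b}" k Z] supp that DERIV_imp_deriv[OF k(1)[of Z]] by simp
  have "(LINT Z|lborel. k' Z) = (LINT Z|lborel. k' Z * indicator {?a..?b} Z)"
  proof (rule Bochner_Integration.integral_cong[OF refl])
    show "k' Z = k' Z * indicator {?a..?b} Z" for Z
      using k'0[of Z] by (cases "Z \<in> {a..b}") (auto simp: indicator_def)
  qed
  also have "\<dots> = k ?b - k ?a"
    by (rule integral_FTC_Icc_real) (use k in \<open>auto simp: continuous_on_eq_continuous_at\<close>)
  also have "\<dots> = 0"
  proof -
    have "k ?a = 0" by (rule supp) auto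
    moreover have "k ?b = 0" by (rule supp) auto
    ultimately show ?thesis by simp
  qed
  finally show ?thesis .
qed

lemma integral_by_parts_compact_support:
  assumes "smooth \<eta>" "\<And>Z. Z \<notin> {a..b} \<Longrightarrow> \<eta> Z = 0"
  shows "(LINT Z|lborel. \<eta> Z) = - (LINT Z|lborel. Z * deriv \<eta> Z)"
proof -
  note d = smooth_real_deriv[OF assms(1)]
  have c: "continuous_on UNIV \<eta>" "continuous_on UNIV (\<lambda>Z. Z * deriv \<eta> Z)"
    using assms(1) by (intro continuous_on_mult continuous_on_id smooth_continuous d(2); simp)+
  have "deriv \<eta> Z = 0" if "Z \<notin> {a..b}" for Z
    by (rule deriv_zero_outside[of "{a..b}"]) (use assms that in auto)
  then have i: "integrable lborel \<eta>" "integrable lborel (\<lambda>Z. Z * deriv \<eta> Z)"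
    by (auto intro!: integrable_compact_support[of _ a b] c assms(2))
  have "(LINT Z|lborel. \<eta> Z + Z * deriv \<eta> Z) = 0"
  proof (rule integral_deriv_compact_support[where k = "\<lambda>Z. Z * \<eta> Z"])
    show "((\<lambda>Z. Z * \<eta> Z) has_real_derivative \<eta> Z + Z * deriv \<eta> Z) (at Z)" for Z
      by (auto intro!: derivative_eq_intros d(1))
    show "continuous_on UNIV (\<lambda>Z. \<eta> Z + Z * deriv \<eta> Z)" by (intro continuous_intros c)
    show "Z * \<eta> Z = 0" if "Z \<notin> {a..b}" for Z using assms(2)[OF that] by simp
  qed
  then show ?thesis using i by simp
qed

lemma integrable_mult_fst:
  fixes F :: "real \<times> real \<Rightarrow> real"
  assumes F: "integrable lborel F" "\<And>x. fst x \<notin> {a..b} \<Longrightarrow> F x = 0" and k: "continuous_on UNIV k"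
  shows "integrable lborel (\<lambda>x. F x * k (fst x))"
proof -
  have "compact (k ` {a..b})"
    using k by (intro compact_continuous_image) (auto intro: continuous_on_subset)
  then obtain B where B: "\<And>y. y \<in> {a..b} \<Longrightarrow> \<bar>k y\<bar> \<le> B"
    using compact_imp_bounded bounded_iff by (metis image_eqI real_norm_def)
  have m: "k \<in> borel_measurable borel" using k by (rule borel_measurable_continuous_onI)
  have "integrable lborel (\<lambda>x. F x * (indicator {a..b} (fst x) * k (fst x)))"
    by (rule integrable_mult_bounded[OF F(1), of _ "max 0 B"])
       (use B m in \<open>fastforce simp: indicator_def\<close>)+
  moreover have "(\<lambda>x. F x * (indicator {a..b} (fst x) * k (fst x))) = (\<lambda>x. F x * k (fst x))"
  proof
    fix x show "F x * (indicator {a..b} (fst x) * k (fst x)) = F x * k (fst x)"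
      using F(2)[of x] by (cases "fst x \<in> {a..b}") auto
  qed
  ultimately show ?thesis by simp
qed

text \<open>Products of a function of \<open>y\<close> and a function of \<open>Z\<close> separate the momentum equation. A fixed
  vertical profile of positive integral identifies \<open>G\<close>, a weighted vertical average of \<open>V\<close>, as the
  weak derivative of the pressure \<open>P\<close>. Since \<open>\<integral> \<eta> = - \<integral> Z \<eta>'\<close>, an arbitrary profile then
  gives that \<open>\<mu> W - G Z\<close> is constant in \<open>Z\<close>, which is stated for its primitive in \<open>Z\<close>.\<close>

lemma momentum_reduction:
  fixes V :: "real \<times> real \<Rightarrow> real" and P :: "real \<Rightarrow> real"
  assumes h: "continuous_on UNIV h" "periodic1 h" "\<And>y. 0 < h y" and \<mu>: "0 < \<mu>"
    and V: "integrable lborel V" "\<And>x. x \<notin> Q h \<Longrightarrow> V x = 0"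
    and P: "integrable lborel P" "\<And>y. y \<notin> {0..1} \<Longrightarrow> P y = 0"
    and mom: "\<And>\<psi> \<eta>. test_torus \<psi> \<Longrightarrow> smooth \<eta> \<Longrightarrow> test_Q h (tensor \<psi> \<eta>) \<Longrightarrow>
      - \<mu> * (LINT x|lborel. V x * tensor \<psi> (deriv (deriv \<eta>)) x)
      - (LINT x|lborel. indicator (Q h) x * (P (fst x) * tensor (deriv \<psi>) \<eta> x)) = 0"
  obtains G where "integrable lborel G" "\<And>y. y \<notin> {0..1} \<Longrightarrow> G y = 0"
    "\<And>\<psi>. test_torus \<psi> \<Longrightarrow> (LINT y|lborel. P y * deriv \<psi> y) = - (LINT y|lborel. G y * \<psi> y)"
    "\<And>W. \<lbrakk>integrable lborel W; \<And>x. x \<notin> Q h \<Longrightarrow> W x = 0;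
       \<And>\<phi>. test_Q h \<phi> \<Longrightarrow> (LINT x|lborel. V x * dZ \<phi> x) = - (LINT x|lborel. W x * \<phi> x)\<rbrakk> \<Longrightarrow>
       AE y in lborel. y \<in> {0..1} \<longrightarrow> (\<forall>Z\<in>{0..h y}.
         \<mu> * integral {0..Z} (\<lambda>t. W (y, t)) - G y * Z\<^sup>2 / 2 =
         Z / h y * (\<mu> * integral {0..h y} (\<lambda>t. W (y, t)) - G y * (h y)\<^sup>2 / 2))"
proof -
  obtain h0 H where h0: "0 < h0" "\<And>y. h0 < h y" and H: "\<And>y. h y < H" using torus_fun_bounds[OF h] by blast
  have [measurable]: "h \<in> borel_measurable borel" using h(1) by (rule borel_measurable_continuous_onI)
  have [measurable]: "Q h \<in> sets borel" by (rule Q_borel[OF h(1)])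
  have [measurable]: "V \<in> borel_measurable borel" using V by auto
  define adm where "adm \<psi> \<eta> S a b \<longleftrightarrow> test_torus \<psi> \<and> smooth \<eta> \<and> closed S \<and> (\<forall>y. y \<notin> S \<longrightarrow> \<psi> y = 0) \<and>
     (\<forall>Z. Z \<notin> {a..b} \<longrightarrow> \<eta> Z = 0) \<and> 0 < a \<and> (\<forall>y\<in>S. b < h y)"
    for \<psi> \<eta> :: "real \<Rightarrow> real" and S and a b :: real
  have tQ: "test_Q h (tensor \<psi> \<eta>)" if "adm \<psi> \<eta> S a b" for \<psi> \<eta> S a b
    by (rule test_Q_tensor[of \<psi> \<eta> S a b]) (use that in \<open>auto simp: adm_def\<close>)
  have adm_deriv: "adm \<psi> (deriv \<eta>) S a b" if "adm \<psi> \<eta> S a b" for \<psi> \<eta> S a b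
    using that deriv_zero_outside[of "{a..b}" \<eta>] smooth_real_deriv(2) by (auto simp: adm_def)
  have M: "\<mu> * (LINT x|lborel. V x * tensor \<psi> (deriv (deriv \<eta>)) x) =
      - (LINT y|lborel. P y * deriv \<psi> y) * (LINT Z|lborel. \<eta> Z)" if adm: "adm \<psi> \<eta> S a b" for \<psi> \<eta> S a b
  proof -
    have sm: "smooth \<psi>" "smooth \<eta>" using adm by (auto simp: adm_def test_torus_def)
    have "indicator (Q h) x * (P (fst x) * tensor (deriv \<psi>) \<eta> x) = tensor (\<lambda>y. P y * deriv \<psi> y) \<eta> x" for x
    proof (cases "P (fst x) * tensor (deriv \<psi>) \<eta> x = 0")
      case False
      then have "fst x \<in> {0..1}" "fst x \<in> S" "snd x \<in> {a..b}"
        using P(2)[of "fst x"] deriv_zero_outside[of S \<psi> "fst x"] adm by (auto simp: adm_def)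
      then have "x \<in> Q h" using adm by (cases x) (fastforce simp: adm_def Q_def)
      then show ?thesis by simp
    qed auto
    then have "(LINT x|lborel. indicator (Q h) x * (P (fst x) * tensor (deriv \<psi>) \<eta> x)) =
        (LINT x|lborel. tensor (\<lambda>y. P y * deriv \<psi> y) \<eta> x)" by (simp only:)
    also have "\<dots> = (LINT y|lborel. P y * deriv \<psi> y) * (LINT Z|lborel. \<eta> Z)"
    proof (rule LINT_tensor)
      show "integrable lborel (\<lambda>y. P y * deriv \<psi> y)"
        by (rule integrable_mult_continuous[OF P smooth_continuous[OF smooth_real_deriv(2)[OF sm(1)]]])
      show "integrable lborel \<eta>"
        by (rule integrable_compact_support[of _ a b]) (use sm smooth_continuous adm in \<open>auto simp: adm_def\<close>)
    qed
    finally show ?thesis using mom[OF _ sm(2) tQ[OF adm]] adm by (simp add: adm_def)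
  qed
  \<comment> \<open>a vertical profile supported below the minimum of \<open>h\<close>, which can be used over the whole torus\<close>
  define \<eta>0 where "\<eta>0 Z = flat 0 (Z - h0 / 3) * flat 0 (2 * h0 / 3 - Z)" for Z
  have sm0: "smooth \<eta>0"
    unfolding \<eta>0_def[abs_def]
    by (intro smooth_mult smooth_compose[OF smooth_flat] smooth_const smooth_diff
          smooth_bounded_linear bounded_linear_ident)
  have supp0: "\<eta>0 Z = 0" if "Z \<notin> {h0 / 3..2 * h0 / 3}" for Z
    using that by (auto simp: \<eta>0_def flat_def)
  have adm0: "adm \<psi> \<eta>0 UNIV (h0 / 3) (2 * h0 / 3)" if "test_torus \<psi>" for \<psi>
  proof -
    have "2 * h0 / 3 < h y" for y using h0(2)[of y] h0(1) by simp
    then show ?thesis using that sm0 supp0 h0 by (auto simp: adm_def)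
  qed
  define m where "m = (LINT Z|lborel. \<eta>0 Z)"
  have m: "0 < m"
  proof -
    have i0: "integrable lborel \<eta>0"
      by (rule integrable_compact_support[OF smooth_continuous[OF sm0] supp0])
    have nn: "0 \<le> \<eta>0 Z" for Z by (simp add: \<eta>0_def flat_bounds)
    have "0 \<le> m" unfolding m_def by (rule Bochner_Integration.integral_nonneg) (rule nn)
    moreover have "m \<noteq> 0"
    proof
      assume "m = 0"
      then have "AE Z in lborel. \<eta>0 Z = 0"
        using integral_nonneg_eq_0_iff_AE[OF i0] nn by (simp add: m_def)
      then have "AE Z in lborel. Z \<notin> {h0/3<..<2*h0/3}"
        by eventually_elim (auto simp: \<eta>0_def flat_def)
      then have "{h0/3<..<2*h0/3} \<in> null_sets lborel" by (subst AE_iff_null_sets) auto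
      then have "emeasure lborel {h0/3<..<2*h0/3} = 0" by (rule null_setsD1)
      then show False using h0 by simp
    qed
    ultimately show ?thesis by simp
  qed
  have smd0: "smooth (deriv (deriv \<eta>0))" using sm0 smooth_real_deriv(2) by blast
  have suppd0: "deriv (deriv \<eta>0) Z = 0" if "Z \<notin> {h0/3..2*h0/3}" for Z
    by (intro deriv_zero_outside[of "{h0/3..2*h0/3}"]) (use that supp0 in auto)
  obtain B0 where B0: "\<And>Z. \<bar>deriv (deriv \<eta>0) Z\<bar> \<le> B0"
    using bounded_compact_support[OF smooth_continuous[OF smd0] suppd0] by blast
  define G where "G y = \<mu> / m * (LINT Z|lborel. V (y, Z) * deriv (deriv \<eta>0) Z)" for y
  have iV0: "integrable lborel (\<lambda>x. V x * deriv (deriv \<eta>0) (snd x))"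
    by (rule integrable_mult_bounded[OF V(1) _ B0])
       (use smooth_borel[OF smd0] in simp)
  have G: "integrable lborel G"
    unfolding G_def using Fubini_plane(3)[OF iV0] by simp
  have Gout: "G y = 0" if "y \<notin> {0..1}" for y
  proof -
    have "V (y, Z) = 0" for Z using V(2)[of "(y, Z)"] that by (auto simp: Q_def)
    then show ?thesis by (simp add: G_def)
  qed
  have WD: "(LINT y|lborel. P y * deriv \<psi> y) = - (LINT y|lborel. G y * \<psi> y)" if t: "test_torus \<psi>" for \<psi>
  proof -
    have sm: "smooth \<psi>" using t by (simp add: test_torus_def)
    have "V x * deriv (deriv \<eta>0) (snd x) = 0" if "fst x \<notin> {0..1}" for x
    proof -
      have "x \<notin> Q h" using that by (auto simp: Q_def)
      then show ?thesis using V(2) by simp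
    qed
    from integrable_mult_fst[OF iV0 this smooth_continuous[OF sm]]
    have iV1: "integrable lborel (\<lambda>x. V x * tensor \<psi> (deriv (deriv \<eta>0)) x)"
      by (simp add: ac_simps)
    have "(LINT x|lborel. V x * tensor \<psi> (deriv (deriv \<eta>0)) x) =
        (LINT y|lborel. LINT Z|lborel. \<psi> y * (V (y, Z) * deriv (deriv \<eta>0) Z))"
      using Fubini_plane(1)[OF iV1] by (simp add: ac_simps)
    also have "\<dots> = (LINT y|lborel. m / \<mu> * (G y * \<psi> y))"
      using m \<mu> by (simp add: G_def mult.commute)
    also have "\<dots> = m / \<mu> * (LINT y|lborel. G y * \<psi> y)" by simp
    finally have "m * (LINT y|lborel. G y * \<psi> y) = - (LINT y|lborel. P y * deriv \<psi> y) * m"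
      using M[OF adm0[OF t]] \<mu> by (simp add: m_def)
    then have "m * (LINT y|lborel. G y * \<psi> y) = m * - (LINT y|lborel. P y * deriv \<psi> y)"
      by (simp add: mult.commute)
    then show ?thesis using m by (simp only: mult_left_cancel[OF less_imp_neq[OF m, symmetric]] minus_minus)
  qed
  show ?thesis
  proof (rule that[OF G Gout WD])
    fix W :: "real \<times> real \<Rightarrow> real"
    assume W: "integrable lborel W" "\<And>x. x \<notin> Q h \<Longrightarrow> W x = 0"
      and weak: "\<And>\<phi>. test_Q h \<phi> \<Longrightarrow> (LINT x|lborel. V x * dZ \<phi> x) = - (LINT x|lborel. W x * \<phi> x)"
    define f2 where "f2 x = tensor G (\<lambda>_. 1) x * (indicator (Q h) x * snd x)" for x
    have f2: "integrable lborel f2"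
    proof -
      have "integrable lborel (\<lambda>x. tensor G (indicator {0..H}) x * (indicator (Q h) x * snd x))"
      proof (rule integrable_mult_bounded[where B = H])
        show "integrable lborel (tensor G (indicator {0..H}))"
          by (intro integrable_tensor G integrable_real_indicator) (auto simp: emeasure_lborel_Icc_eq)
        show "\<bar>indicator (Q h) x * snd x\<bar> \<le> H" for x :: "real \<times> real"
        proof -
          have "0 < H" using H[of 0] h(3)[of 0] by simp
          then show ?thesis using H[of "fst x"] by (cases x) (auto simp: Q_def indicator_def)
        qed
      qed measurable
      moreover have "tensor G (indicator {0..H}) x * (indicator (Q h) x * snd x) = f2 x" for x
        using less_trans[OF _ H[of "fst x"], of "snd x"]
        by (cases x) (auto simp: f2_def Q_def indicator_def intro: less_imp_le)
      ultimately show ?thesis by simp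
    qed
    define f where "f x = \<mu> * W x - f2 x" for x
    have f: "integrable lborel f" unfolding f_def using W(1) f2 by simp
    have fout: "f x = 0" if "fst x \<notin> {0..1}" for x
    proof -
      have "x \<notin> Q h" using that by (auto simp: Q_def)
      then show ?thesis using W(2) by (simp add: f_def f2_def)
    qed
    have "AE y in lborel. y \<in> {0..1} \<longrightarrow> (\<forall>Z\<in>{0..h y}.
       integral {0..Z} (\<lambda>t. f (y, t)) = Z / h y * integral {0..h y} (\<lambda>t. f (y, t)))"
    proof (rule vertical_du_Bois_Reymond[OF f fout h])
      fix \<psi> \<eta> S a b
      assume "test_torus \<psi>" "smooth \<eta>" "closed S" "\<And>y. y \<notin> S \<Longrightarrow> \<psi> y = 0"
         "\<And>Z. Z \<notin> {a..b} \<Longrightarrow> \<eta> Z = 0" "0 < a" "\<And>y. y \<in> S \<Longrightarrow> b < h y"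
      then have adm: "adm \<psi> \<eta> S a b" by (auto simp: adm_def)
      have sm: "smooth \<psi>" "smooth \<eta>" and t: "test_torus \<psi>" using adm by (auto simp: adm_def test_torus_def)
      note adm' = adm_deriv[OF adm]
      have smd: "smooth (deriv \<eta>)" using sm smooth_real_deriv by blast
      have suppd: "\<And>Z. Z \<notin> {a..b} \<Longrightarrow> deriv \<eta> Z = 0" using adm' by (auto simp: adm_def)
      obtain Bd where Bd: "\<And>Z. \<bar>deriv \<eta> Z\<bar> \<le> Bd"
        using bounded_compact_support[OF smooth_continuous[OF smd] suppd] by blast
      have itest: "integrable lborel (\<lambda>x. F x * tensor \<psi> (deriv \<eta>) x)"
        if F: "integrable lborel F" "\<And>x. fst x \<notin> {0..1} \<Longrightarrow> F x = 0" for F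
      proof -
        have "integrable lborel (\<lambda>x. F x * \<psi> (fst x) * deriv \<eta> (snd x))"
        proof (rule integrable_mult_bounded[OF _ _ Bd])
          show "integrable lborel (\<lambda>x. F x * \<psi> (fst x))"
            by (rule integrable_mult_fst[OF F smooth_continuous[OF sm(1)]])
          show "(\<lambda>x::real \<times> real. deriv \<eta> (snd x)) \<in> borel_measurable lborel"
            using smooth_borel[OF smd] by simp
        qed
        then show ?thesis by (simp add: mult.assoc)
      qed
      have "(LINT x|lborel. V x * tensor \<psi> (deriv (deriv \<eta>)) x) = - (LINT x|lborel. W x * tensor \<psi> (deriv \<eta>) x)"
        using weak[OF tQ[OF adm']] dZ_tensor[OF smd, of \<psi>] by simp
      then have 1: "\<mu> * (LINT x|lborel. W x * tensor \<psi> (deriv \<eta>) x) =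
         - (LINT y|lborel. G y * \<psi> y) * (LINT Z|lborel. \<eta> Z)"
        using M[OF adm] WD[OF t] by simp
      have "f2 x * tensor \<psi> (deriv \<eta>) x = tensor (\<lambda>y. G y * \<psi> y) (\<lambda>Z. Z * deriv \<eta> Z) x" for x
      proof (cases "G (fst x) * tensor \<psi> (deriv \<eta>) x = 0")
        case False
        then have "fst x \<in> {0..1}" "fst x \<in> S" "snd x \<in> {a..b}"
          using Gout[of "fst x"] suppd adm by (auto simp: adm_def)
        then have "x \<in> Q h" using adm by (cases x) (fastforce simp: adm_def Q_def)
        then show ?thesis by (simp add: f2_def)
      qed (auto simp: f2_def)
      then have "(LINT x|lborel. f2 x * tensor \<psi> (deriv \<eta>) x) =
          (LINT x|lborel. tensor (\<lambda>y. G y * \<psi> y) (\<lambda>Z. Z * deriv \<eta> Z) x)" by (simp only:)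
      also have "\<dots> = (LINT y|lborel. G y * \<psi> y) * (LINT Z|lborel. Z * deriv \<eta> Z)"
      proof (rule LINT_tensor)
        show "integrable lborel (\<lambda>y. G y * \<psi> y)"
          by (rule integrable_mult_continuous[OF G Gout smooth_continuous[OF sm(1)]])
        show "integrable lborel (\<lambda>Z. Z * deriv \<eta> Z)"
          by (rule integrable_compact_support[of _ a b])
             (use suppd smooth_continuous[OF smd] in \<open>auto intro!: continuous_intros\<close>)
      qed
      also have "(LINT Z|lborel. Z * deriv \<eta> Z) = - (LINT Z|lborel. \<eta> Z)"
        using integral_by_parts_compact_support[OF sm(2), of a b] adm by (auto simp: adm_def)
      finally have 2: "(LINT x|lborel. f2 x * tensor \<psi> (deriv \<eta>) x) = - (LINT y|lborel. G y * \<psi> y) * (LINT Z|lborel. \<eta> Z)"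
        by simp
      have iW: "integrable lborel (\<lambda>x. W x * tensor \<psi> (deriv \<eta>) x)"
        by (rule itest[OF W(1)]) (use W(2) in \<open>auto simp: Q_def\<close>)
      have if2: "integrable lborel (\<lambda>x. f2 x * tensor \<psi> (deriv \<eta>) x)"
        by (rule itest[OF f2]) (auto simp: f2_def Q_def)
      have "(LINT x|lborel. f x * tensor \<psi> (deriv \<eta>) x) =
          (LINT x|lborel. \<mu> * (W x * tensor \<psi> (deriv \<eta>) x) - f2 x * tensor \<psi> (deriv \<eta>) x)"
        by (simp add: f_def algebra_simps)
      also have "\<dots> = \<mu> * (LINT x|lborel. W x * tensor \<psi> (deriv \<eta>) x) - (LINT x|lborel. f2 x * tensor \<psi> (deriv \<eta>) x)"
        using iW if2 by simp
      finally show "(LINT x|lborel. f x * tensor \<psi> (deriv \<eta>) x) = 0" using 1 2 by simp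
    qed
    then show "AE y in lborel. y \<in> {0..1} \<longrightarrow> (\<forall>Z\<in>{0..h y}.
         \<mu> * integral {0..Z} (\<lambda>t. W (y, t)) - G y * Z\<^sup>2 / 2 =
         Z / h y * (\<mu> * integral {0..h y} (\<lambda>t. W (y, t)) - G y * (h y)\<^sup>2 / 2))"
      using Fubini_plane(4)[OF W(1)]
    proof eventually_elim
      case (elim y)
      show ?case
      proof
        assume y: "y \<in> {0..1}"
        have F: "integral {0..Z} (\<lambda>t. f (y, t)) = \<mu> * integral {0..Z} (\<lambda>t. W (y, t)) - G y * Z\<^sup>2 / 2"
          if Z: "Z \<in> {0..h y}" for Z
        proof -
          have "integral {0..Z} (\<lambda>t. f (y, t)) = integral {0..Z} (\<lambda>t. \<mu> * W (y, t) - G y * t)"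
            unfolding integral_open_interval_real[of 0 Z]
            by (rule Henstock_Kurzweil_Integration.integral_cong)
               (use y Z in \<open>auto simp: f_def f2_def Q_def indicator_def\<close>)
          also have "\<dots> = \<mu> * integral {0..Z} (\<lambda>t. W (y, t)) - G y * Z\<^sup>2 / 2"
          proof (rule integral_unique, rule has_integral_diff)
            show "((\<lambda>t. \<mu> * W (y, t)) has_integral \<mu> * integral {0..Z} (\<lambda>t. W (y, t))) {0..Z}"
              by (intro has_integral_mult_right integrable_integral integral_eq_LINT(1) elim) auto
            have "((\<lambda>t. G y * t) has_integral (G y * Z\<^sup>2 / 2 - G y * 0\<^sup>2 / 2)) {0..Z}"
              by (rule fundamental_theorem_of_calculus)
                 (use Z in \<open>auto intro!: derivative_eq_intros simp: has_real_derivative_iff_has_vector_derivative[symmetric]\<close>)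
            then show "((\<lambda>t. G y * t) has_integral G y * Z\<^sup>2 / 2) {0..Z}" by simp
          qed
          finally show ?thesis .
        qed
        show "\<forall>Z\<in>{0..h y}. \<mu> * integral {0..Z} (\<lambda>t. W (y, t)) - G y * Z\<^sup>2 / 2 =
         Z / h y * (\<mu> * integral {0..h y} (\<lambda>t. W (y, t)) - G y * (h y)\<^sup>2 / 2)"
        proof
          fix Z assume Z: "Z \<in> {0..h y}"
          have "h y \<in> {0..h y}" using h(3)[of y] by simp
          from F[OF this] F[OF Z] show "\<mu> * integral {0..Z} (\<lambda>t. W (y, t)) - G y * Z\<^sup>2 / 2 =
             Z / h y * (\<mu> * integral {0..h y} (\<lambda>t. W (y, t)) - G y * (h y)\<^sup>2 / 2)"
            using elim(1) y Z by metis
        qed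
      qed
    qed
  qed
qed

section \<open>Reynolds equation\<close>

text \<open>The velocity is a Couette--Poiseuille profile on almost every vertical segment, being a quadratic
  polynomial in \<open>Z\<close> with leading coefficient \<open>G / (2 \<mu>)\<close> and prescribed end values. Its vertical
  integral is \<open>s h / 2 - G h\<^sup>3 / (12 \<mu>)\<close>, so that conservation of mass becomes the Reynolds
  equation with a constant flux \<open>C\<close>.\<close>

lemma solution_reduction:
  assumes h: "continuous_on UNIV h" "periodic1 h" "\<And>y. 0 < h y" and \<mu>: "0 < \<mu>"
    and sol: "is_solution h p \<mu> s M rmax \<rho> v"
  obtains G c C where "integrable lborel G" "integral {0..1} G = 0"
    "AE y in lborel. y \<in> {0..1} \<longrightarrow> p (\<rho> y) = c + integral {0..y} G"
    "AE y in lborel. y \<in> {0..1} \<longrightarrow> \<rho> y * (s * h y / 2 - G y * h y ^ 3 / (12 * \<mu>)) = C"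
    "AE x in lborel. x \<in> Q h \<longrightarrow> v x = G (fst x) / (2 * \<mu>) * (snd x * (snd x - h (fst x))) + s * (1 - snd x / h (fst x))"
proof -
  obtain h0 H where h0: "0 < h0" "\<And>y. h0 < h y" and H: "\<And>y. h y < H" using torus_fun_bounds[OF h] by blast
  note SQ = Q_borel[OF h(1)] Q_finite[OF H] Q_bounded[OF H]
  have [measurable]: "h \<in> borel_measurable borel" using h(1) by (rule borel_measurable_continuous_onI)
  have [measurable]: "Q h \<in> sets borel" by (rule SQ(1))
  have \<rho>: "\<rho> \<in> borel_measurable (lebesgue_on {0..1})"
    and \<rho>01: "AE y in lebesgue_on {0..1}. 0 \<le> \<rho> y \<and> \<rho> y \<le> rmax"
    and P2: "L2_on {0..1} (\<lambda>y. p (\<rho> y))"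
    and v2: "L2_on (Q h) v"
    and tr0: "has_trace h v (\<lambda>_. 0) (\<lambda>_. s)" and trh: "has_trace h v h (\<lambda>_. 0)"
    and cont_eq: "\<And>\<psi>. test_torus \<psi> \<Longrightarrow> (LINT y|lebesgue_on {0..1}. flux h \<rho> v y * deriv \<psi> y) = 0"
    and mom: "\<And>\<phi>. test_Q h \<phi> \<Longrightarrow> - \<mu> * (LINT x|lebesgue_on (Q h). v x * dZ (dZ \<phi>) x)
        - (LINT x|lebesgue_on (Q h). p (\<rho> (fst x)) * dy \<phi> x) = 0"
    using sol by (simp_all add: is_solution_def in_V_def)
  have \<rho>b: "AE y in lborel. y \<in> {0..1} \<longrightarrow> 0 \<le> \<rho> y \<and> \<rho> y \<le> rmax"
    using \<rho>01 by (subst (asm) AE_lebesgue_on_iff) auto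
  obtain V where V: "V \<in> borel_measurable borel" "AE x in lborel. x \<in> Q h \<longrightarrow> v x = V x" "\<And>x. x \<notin> Q h \<Longrightarrow> V x = 0"
    using borel_version[OF SQ(1), of v] v2 unfolding L2_on_def by blast
  have iV: "integrable lborel V" by (rule L2_on_integrable(1)[OF v2 SQ(1,2) V])
  obtain r where r: "r \<in> borel_measurable borel" "AE y in lborel. y \<in> {0..1} \<longrightarrow> \<rho> y = r y" "\<And>y. y \<notin> {0..1} \<Longrightarrow> r y = 0"
    by (rule borel_version[OF atLeastAtMost_borel \<rho>]) (rule that)
  obtain P where P: "P \<in> borel_measurable borel" "AE y in lborel. y \<in> {0..1} \<longrightarrow> p (\<rho> y) = P y" "\<And>y. y \<notin> {0..1} \<Longrightarrow> P y = 0"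
    by (rule borel_version[OF atLeastAtMost_borel P2[unfolded L2_on_def, THEN conjunct1]]) (rule that)
  have iP: "integrable lborel P" by (rule L2_on_integrable(1)[OF P2 _ _ P]) auto
  obtain W where W: "integrable lborel W" "\<And>x. x \<notin> Q h \<Longrightarrow> W x = 0"
    "\<And>\<phi>. test_Q h \<phi> \<Longrightarrow> (LINT x|lborel. V x * dZ \<phi> x) = - (LINT x|lborel. W x * \<phi> x)"
    "AE y in lborel. y \<in> {0..1} \<longrightarrow> (AE Z in lborel. 0 < Z \<and> Z < h y \<longrightarrow>
       V (y, Z) = s + integral {0..Z} (\<lambda>t. W (y, t)) - integral {0..0} (\<lambda>t. W (y, t)))"
    by (rule trace_formula[OF h continuous_on_const _ _ tr0 V]) (use h(3) in \<open>auto simp: less_imp_le\<close>)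
  obtain W' where W': "integrable lborel W'"
    "AE y in lborel. y \<in> {0..1} \<longrightarrow> (AE Z in lborel. 0 < Z \<and> Z < h y \<longrightarrow>
       V (y, Z) = 0 + integral {0..Z} (\<lambda>t. W' (y, t)) - integral {0..h y} (\<lambda>t. W' (y, t)))"
    by (rule trace_formula[OF h h(1) _ _ trh V]) (use h(3) in \<open>auto simp: less_imp_le\<close>)
  obtain G where G: "integrable lborel G" "\<And>y. y \<notin> {0..1} \<Longrightarrow> G y = 0"
    "\<And>\<psi>. test_torus \<psi> \<Longrightarrow> (LINT y|lborel. P y * deriv \<psi> y) = - (LINT y|lborel. G y * \<psi> y)"
    and lin: "AE y in lborel. y \<in> {0..1} \<longrightarrow> (\<forall>Z\<in>{0..h y}.
         \<mu> * integral {0..Z} (\<lambda>t. W (y, t)) - G y * Z\<^sup>2 / 2 =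
         Z / h y * (\<mu> * integral {0..h y} (\<lambda>t. W (y, t)) - G y * (h y)\<^sup>2 / 2))"
  proof (rule momentum_reduction[OF h \<mu> iV V(3) iP P(3)])
    fix \<psi> \<eta> assume t: "test_torus \<psi>" "smooth \<eta>" and tQ: "test_Q h (tensor \<psi> \<eta>)"
    have sm: "smooth \<psi>" "smooth (deriv \<psi>)" "smooth (deriv \<eta>)" "smooth (deriv (deriv \<eta>))"
      using t smooth_real_deriv(2) by (auto simp: test_torus_def)
    note mb [measurable] = smooth_borel[OF sm(2)] smooth_borel[OF sm(4)] smooth_borel[OF t(2)]
    note [measurable] = V(1) P(1)
    have "(LINT x|lebesgue_on (Q h). v x * tensor \<psi> (deriv (deriv \<eta>)) x) =
        (LINT x|lborel. V x * tensor \<psi> (deriv (deriv \<eta>)) x)"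
    proof (rule lebesgue_on_integral_eq(1)[OF SQ(1)])
      show "AE x in lborel. x \<in> Q h \<longrightarrow> v x * tensor \<psi> (deriv (deriv \<eta>)) x = V x * tensor \<psi> (deriv (deriv \<eta>)) x"
        using V(2) by eventually_elim auto
      show "(\<lambda>x. V x * tensor \<psi> (deriv (deriv \<eta>)) x) \<in> borel_measurable borel"
        using smooth_borel[OF sm(1)] by measurable
    qed (simp add: V(3))
    moreover have "(LINT x|lebesgue_on (Q h). p (\<rho> (fst x)) * tensor (deriv \<psi>) \<eta> x) =
        (LINT x|lborel. indicator (Q h) x * (P (fst x) * tensor (deriv \<psi>) \<eta> x))"
    proof (rule lebesgue_on_integral_eq(1)[OF SQ(1)])
      show "AE x in lborel. x \<in> Q h \<longrightarrow> p (\<rho> (fst x)) * tensor (deriv \<psi>) \<eta> x =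
          indicator (Q h) x * (P (fst x) * tensor (deriv \<psi>) \<eta> x)"
        using AE_plane_fst[OF P(2)] by eventually_elim (auto simp: Q_def)
      show "(\<lambda>x. indicator (Q h) x * (P (fst x) * tensor (deriv \<psi>) \<eta> x)) \<in> borel_measurable borel"
        by measurable
    qed simp
    ultimately show "- \<mu> * (LINT x|lborel. V x * tensor \<psi> (deriv (deriv \<eta>)) x)
      - (LINT x|lborel. indicator (Q h) x * (P (fst x) * tensor (deriv \<psi>) \<eta> x)) = 0"
      using mom[OF tQ] by (simp add: dZ_tensor[OF t(2)] dZ_tensor[OF sm(3)] dy_tensor[OF sm(1)])
  next
    fix G assume "integrable lborel G" "\<And>y. y \<notin> {0..1} \<Longrightarrow> G y = 0"
      "\<And>\<psi>. test_torus \<psi> \<Longrightarrow> (LINT y|lborel. P y * deriv \<psi> y) = - (LINT y|lborel. G y * \<psi> y)"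
      and *: "\<And>W. \<lbrakk>integrable lborel W; \<And>x. x \<notin> Q h \<Longrightarrow> W x = 0;
       \<And>\<phi>. test_Q h \<phi> \<Longrightarrow> (LINT x|lborel. V x * dZ \<phi> x) = - (LINT x|lborel. W x * \<phi> x)\<rbrakk> \<Longrightarrow>
       AE y in lborel. y \<in> {0..1} \<longrightarrow> (\<forall>Z\<in>{0..h y}.
         \<mu> * integral {0..Z} (\<lambda>t. W (y, t)) - G y * Z\<^sup>2 / 2 =
         Z / h y * (\<mu> * integral {0..h y} (\<lambda>t. W (y, t)) - G y * (h y)\<^sup>2 / 2))"
    then show thesis using *[OF W(1-3)] by (intro that)
  qed
  have [measurable]: "G \<in> borel_measurable borel" using G(1) by auto
  obtain c where c: "AE y in lborel. y \<in> {0..1} \<longrightarrow> P y = c + integral {0..y} G"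
    using weak_derivative_torus(2)[OF iP P(3) G] by blast
  have G0: "integral {0..1} G = 0" by (rule weak_derivative_torus(1)[OF iP P(3) G])
  define U where "U y Z = G y / (2 * \<mu>) * (Z * (Z - h y)) + s * (1 - Z / h y)" for y Z
  have VU: "AE y in lborel. y \<in> {0..1} \<longrightarrow> (AE Z in lborel. 0 < Z \<and> Z < h y \<longrightarrow> V (y, Z) = U y Z)"
    using W(4) W'(2) lin Fubini_plane(4)[OF W(1)] Fubini_plane(4)[OF W'(1)]
  proof eventually_elim
    case (elim y)
    show ?case
    proof
      assume y: "y \<in> {0..1}"
      let ?w = "\<lambda>Z. integral {0..Z} (\<lambda>t. W (y, t))" and ?w' = "\<lambda>Z. integral {0..Z} (\<lambda>t. W' (y, t))"
      have hy: "0 < h y" by (rule h(3))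
      have e1: "AE Z in lborel. 0 < Z \<and> Z < h y \<longrightarrow> V (y, Z) = s + ?w Z" using elim(1) y by simp
      have e2: "AE Z in lborel. 0 < Z \<and> Z < h y \<longrightarrow> V (y, Z) = ?w' Z - ?w' (h y)" using elim(2) y by simp
      have "s + ?w (h y) = ?w' (h y) - ?w' (h y)"
      proof (rule AE_interval_eq_imp_eq_at_end[where f = "\<lambda>Z. s + ?w Z" and g = "\<lambda>Z. ?w' Z - ?w' (h y)", OF hy])
        show "AE Z in lborel. 0 < Z \<and> Z < h y \<longrightarrow> s + ?w Z = ?w' Z - ?w' (h y)"
          using e1 e2 by eventually_elim auto
      qed (intro continuous_intros primitive_continuous elim)+
      then have wh: "?w (h y) = - s" by simp
      show "AE Z in lborel. 0 < Z \<and> Z < h y \<longrightarrow> V (y, Z) = U y Z"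
      proof (rule eventually_mono[OF e1])
        fix Z assume Z: "0 < Z \<and> Z < h y \<longrightarrow> V (y, Z) = s + ?w Z"
        show "0 < Z \<and> Z < h y \<longrightarrow> V (y, Z) = U y Z"
        proof
          assume zz: "0 < Z \<and> Z < h y"
          have "\<mu> * ?w Z - G y * Z\<^sup>2 / 2 = Z / h y * (\<mu> * ?w (h y) - G y * (h y)\<^sup>2 / 2)"
          proof -
            have "Z \<in> {0..h y}" using zz by simp
            with elim(3) y show ?thesis by blast
          qed
          then have "\<mu> * ?w Z = G y * Z\<^sup>2 / 2 - Z / h y * (\<mu> * s + G y * (h y)\<^sup>2 / 2)"
            by (simp add: wh algebra_simps)
          then have "?w Z = (G y * Z\<^sup>2 / 2 - Z / h y * (\<mu> * s + G y * (h y)\<^sup>2 / 2)) / \<mu>"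
            using \<mu> by (simp add: field_simps)
          also have "\<dots> = U y Z - s"
            using \<mu> hy by (simp add: U_def field_simps power2_eq_square)
          finally show "V (y, Z) = U y Z" using Z zz by simp
        qed
      qed
    qed
  qed
  have VU2: "AE x in lborel. x \<in> Q h \<longrightarrow> V x = U (fst x) (snd x)"
  proof -
    have "AE x in lborel \<Otimes>\<^sub>M lborel. x \<in> Q h \<longrightarrow> V x = U (fst x) (snd x)"
    proof (rule lborel_pair.AE_pair_measure)
      show "AE y in lborel. AE Z in lborel. (y, Z) \<in> Q h \<longrightarrow> V (y, Z) = U (fst (y, Z)) (snd (y, Z))"
        using VU
      proof eventually_elim
        case (elim y)
        show ?case
        proof (cases "y \<in> {0..1}")
          case True
          with elim have "AE Z in lborel. 0 < Z \<and> Z < h y \<longrightarrow> V (y, Z) = U y Z" by simp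
          then show ?thesis by eventually_elim (auto simp: Q_def)
        qed (auto simp: Q_def)
      qed
      note [measurable] = V(1)
      have "{x. x \<in> Q h \<longrightarrow> V x = U (fst x) (snd x)} \<in> sets borel"
        unfolding U_def by measurable
      then show "{x \<in> space (lborel \<Otimes>\<^sub>M lborel). x \<in> Q h \<longrightarrow> V x = U (fst x) (snd x)} \<in> sets (lborel \<Otimes>\<^sub>M lborel)"
        unfolding lborel_prod by simp
    qed
    then show ?thesis by (simp only: lborel_prod)
  qed
  have UI: "(LINT Z|lebesgue_on {0..h y}. \<rho> y * v (y, Z)) = \<rho> y * (s * h y / 2 - G y * h y ^ 3 / (12 * \<mu>))"
    if AEZ: "AE Z in lborel. (y, Z) \<in> Q h \<longrightarrow> v (y, Z) = U y Z" and y: "y \<in> {0..1}" for y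
  proof -
    have hy: "0 < h y" by (rule h(3))
    have "(LINT Z|lebesgue_on {0..h y}. \<rho> y * v (y, Z)) = (LINT Z|lborel. (\<rho> y * U y Z) * indicator {0..h y} Z)"
    proof (rule lebesgue_on_integral_eq(1))
      show "AE Z in lborel. Z \<in> {0..h y} \<longrightarrow> \<rho> y * v (y, Z) = \<rho> y * U y Z * indicator {0..h y} Z"
        using AEZ AE_lborel_singleton[of 0] AE_lborel_singleton[of "h y"]
        by eventually_elim (use y in \<open>auto simp: Q_def\<close>)
      show "(\<lambda>Z. \<rho> y * U y Z * indicator {0..h y} Z) \<in> borel_measurable borel"
        unfolding U_def by measurable
    qed auto
    also have "\<dots> = (let F = \<lambda>Z. \<rho> y * (G y / (2 * \<mu>) * (Z ^ 3 / 3 - h y * Z\<^sup>2 / 2) + s * (Z - Z\<^sup>2 / (2 * h y))) in F (h y) - F 0)"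
      unfolding Let_def
    proof (rule integral_FTC_Icc_real)
      fix Z
      show "((\<lambda>Z. \<rho> y * (G y / (2 * \<mu>) * (Z ^ 3 / 3 - h y * Z\<^sup>2 / 2) + s * (Z - Z\<^sup>2 / (2 * h y))))
          has_real_derivative \<rho> y * U y Z) (at Z)"
        unfolding U_def by (rule derivative_eq_intros refl | use hy in \<open>simp add: field_simps power2_eq_square\<close>)+
      show "isCont (\<lambda>Z. \<rho> y * U y Z) Z" unfolding U_def using hy by (intro continuous_intros) auto
    qed (use hy in simp)
    also have "\<dots> = \<rho> y * (s * h y / 2 - G y * h y ^ 3 / (12 * \<mu>))"
      using hy \<mu> by (simp add: Let_def field_simps power2_eq_square power3_eq_cube)
    finally show ?thesis .
  qed
  have vU: "AE x in lborel. x \<in> Q h \<longrightarrow> v x = U (fst x) (snd x)"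
    using V(2) VU2 by eventually_elim auto
  define fl where "fl y = indicator {0..1} y * (r y * (s * h y / 2 - G y * h y ^ 3 / (12 * \<mu>)))" for y
  have flux_eq: "AE y in lborel. y \<in> {0..1} \<longrightarrow> flux h \<rho> v y = fl y"
    using AE_plane_sections[OF vU] r(2)
  proof eventually_elim
    case (elim y)
    show ?case
    proof
      assume y: "y \<in> {0..1}"
      have "flux h \<rho> v y = \<rho> y * (s * h y / 2 - G y * h y ^ 3 / (12 * \<mu>))"
        unfolding flux_def by (rule UI[OF _ y]) (use elim(1) in simp)
      then show "flux h \<rho> v y = fl y" using y elim(2) by (simp add: fl_def)
    qed
  qed
  have ifl: "integrable lborel fl"
  proof (rule Bochner_Integration.integrable_bound)
    have "integrable lborel (\<lambda>y. indicator {0..1} y * (s * h y / 2))"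
    proof -
      have "integrable lborel (\<lambda>y. indicator {0..1} y *\<^sub>R (s * h y / 2))"
        by (rule borel_integrable_compact) (use h(1) in \<open>auto intro!: continuous_intros intro: continuous_on_subset\<close>)
      then show ?thesis by simp
    qed
    moreover have "integrable lborel (\<lambda>y. G y * (h y ^ 3 / (12 * \<mu>)))"
      by (rule integrable_mult_continuous[OF G(1,2)]) (use \<mu> h(1) in \<open>auto intro!: continuous_intros\<close>)
    ultimately show "integrable lborel (\<lambda>y. rmax * (indicator {0..1} y * (s * h y / 2) - G y * (h y ^ 3 / (12 * \<mu>))))"
      by simp
    show "fl \<in> borel_measurable lborel" using r(1) by (simp add: fl_def[abs_def])
    show "AE y in lborel. norm (fl y) \<le> norm (rmax * (indicator {0..1} y * (s * h y / 2) - G y * (h y ^ 3 / (12 * \<mu>))))"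
      using \<rho>b r(2)
    proof eventually_elim
      case (elim y)
      show ?case
      proof (cases "y \<in> {0..1}")
        case True
        then have "\<bar>r y\<bar> \<le> \<bar>rmax\<bar>" using elim by auto
        then show ?thesis using True by (simp add: fl_def abs_mult mult_right_mono)
      qed (simp add: fl_def)
    qed
  qed
  have "AE y in lborel. y \<in> {0..1} \<longrightarrow> fl y = integral {0..1} fl"
  proof (rule du_Bois_Reymond_torus[OF ifl])
    fix \<psi> assume t: "test_torus \<psi>"
    have sm: "smooth (deriv \<psi>)" using t smooth_real_deriv(2) by (auto simp: test_torus_def)
    have "(LINT y|lebesgue_on {0..1}. flux h \<rho> v y * deriv \<psi> y) = (LINT y|lborel. fl y * deriv \<psi> y)"
    proof (rule lebesgue_on_integral_eq(1))
      show "AE y in lborel. y \<in> {0..1} \<longrightarrow> flux h \<rho> v y * deriv \<psi> y = fl y * deriv \<psi> y"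
        using flux_eq by eventually_elim auto
      show "(\<lambda>y. fl y * deriv \<psi> y) \<in> borel_measurable borel"
        using ifl smooth_borel[OF sm] by (intro borel_measurable_times) auto
    qed (auto simp: fl_def)
    then show "(LINT y|lborel. fl y * deriv \<psi> y) = 0" using cont_eq[OF t] by simp
  qed (simp add: fl_def)
  then have "AE y in lborel. y \<in> {0..1} \<longrightarrow> \<rho> y * (s * h y / 2 - G y * h y ^ 3 / (12 * \<mu>)) = integral {0..1} fl"
    using r(2) by eventually_elim (auto simp: fl_def)
  moreover have "AE y in lborel. y \<in> {0..1} \<longrightarrow> p (\<rho> y) = c + integral {0..y} G"
    using P(2) c by eventually_elim auto
  ultimately show ?thesis using that[OF G(1) G0 _ _ vU[unfolded U_def]] by blast
qed

section \<open>Pressure, comparison and uniqueness\<close>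

lemma strict_mono_on_if_deriv_pos:
  fixes p :: "real \<Rightarrow> real"
  assumes c: "continuous_on {0..<rmax} p" and d: "p C1_differentiable_on {0<..<rmax}"
    and pos: "\<And>r. r \<in> {0<..<rmax} \<Longrightarrow> deriv p r > 0"
  shows "strict_mono_on {0..<rmax} p"
proof (rule strict_mono_onI)
  fix a b assume ab: "a \<in> {0..<rmax}" "b \<in> {0..<rmax}" "a < b"
  obtain D where D: "\<And>x. x \<in> {0<..<rmax} \<Longrightarrow> (p has_real_derivative D x) (at x)"
    using d unfolding C1_differentiable_on_def has_real_derivative_iff_has_vector_derivative by blast
  show "p a < p b"
  proof (rule DERIV_pos_imp_increasing_open[OF ab(3)])
    show "\<exists>y. (p has_real_derivative y) (at x) \<and> 0 < y" if "a < x" "x < b" for x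
      using D[of x] pos[of x] DERIV_imp_deriv[OF D[of x]] that ab by auto
    show "continuous_on {a..b} p" using c by (rule continuous_on_subset) (use ab in auto)
  qed
qed

lemma blowup_range:
  fixes p :: "real \<Rightarrow> real"
  assumes c: "continuous_on {0..<rmax} p" and r: "0 < rmax" and lim: "filterlim p at_top (at_left rmax)"
    and z: "p 0 \<le> z"
  obtains x where "x \<in> {0..<rmax}" "p x = z"
proof -
  have "\<forall>\<^sub>F x in at_left rmax. z \<le> p x" using lim by (simp add: filterlim_at_top)
  moreover have "\<forall>\<^sub>F x in at_left rmax. x \<in> {0<..<rmax}" using eventually_at_left_field r by auto
  ultimately have "\<forall>\<^sub>F x in at_left rmax. z \<le> p x \<and> x \<in> {0<..<rmax}" by (rule eventually_conj)
  then obtain b where b: "z \<le> p b" "0 < b" "b < rmax"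
    using eventually_happens'[OF trivial_limit_at_left_real] by fastforce
  have "\<exists>x\<ge>0. x \<le> b \<and> p x = z"
    by (rule IVT') (use b z c in \<open>auto intro: continuous_on_subset\<close>)
  then show ?thesis using that b by force
qed

lemma not_null_interval:
  fixes a b :: real
  assumes "a < b" "AE y in lborel. y \<notin> {a<..<b}"
  shows False
proof -
  have "{a<..<b} \<in> null_sets lborel" using assms(2) by (subst AE_iff_null_sets) auto
  then have "emeasure lborel {a<..<b} = 0" by (rule null_setsD1)
  then show False using assms(1) by simp
qed

lemma AE_nonneg_imp_nonneg:
  fixes f :: "real \<Rightarrow> real"
  assumes f: "continuous_on {0..1} f" and ae: "AE y in lborel. y \<in> {0..1} \<longrightarrow> 0 \<le> f y" and y: "y \<in> {0..1}"
  shows "0 \<le> f y"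
proof (rule ccontr)
  assume "\<not> 0 \<le> f y"
  then have neg: "f y < 0" by simp
  obtain d where d: "d > 0" "\<And>x. x \<in> {0..1} \<Longrightarrow> dist x y < d \<Longrightarrow> dist (f x) (f y) < - f y"
    using f y neg unfolding continuous_on_iff by (metis neg_0_less_iff_less)
  have "AE x in lborel. x \<notin> {max 0 (y - d)<..<min 1 (y + d)}"
    using ae
  proof eventually_elim
    case (elim x)
    show ?case
    proof
      assume x: "x \<in> {max 0 (y - d)<..<min 1 (y + d)}"
      then have "x \<in> {0..1}" "dist x y < d" by (auto simp: dist_real_def)
      then show False using d(2)[of x] elim by (auto simp: dist_real_def)
    qed
  qed
  then show False by (rule not_null_interval[rotated]) (use d y in auto)
qed

lemma primitive_strict_increasing:
  fixes G :: "real \<Rightarrow> real"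
  assumes G: "integrable lborel G" and ab: "0 \<le> a" "a < b"
    and pos: "AE y in lborel. a < y \<and> y < b \<longrightarrow> 0 < G y"
  shows "integral {0..a} G < integral {0..b} G"
proof -
  let ?f = "\<lambda>y. indicator {a<..<b} y * G y"
  have eq: "integral {0..b} G - integral {0..a} G = (LINT y|lborel. ?f y)"
    by (rule primitive_diff[OF G]) (use ab in auto)
  have i: "integrable lborel ?f" by (rule integrable_indicator_mult[OF G]) simp
  have nn: "AE y in lborel. 0 \<le> ?f y" using pos by eventually_elim (auto simp: indicator_def)
  have "0 \<le> (LINT y|lborel. ?f y)" using nn by (rule integral_nonneg_AE)
  moreover have "(LINT y|lborel. ?f y) \<noteq> 0"
  proof
    assume "(LINT y|lborel. ?f y) = 0"
    then have "AE y in lborel. ?f y = 0" using integral_nonneg_eq_0_iff_AE[OF i nn] by simp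
    then have "AE y in lborel. y \<notin> {a<..<b}"
      using pos by eventually_elim auto
    then show False by (rule not_null_interval[OF ab(2)])
  qed
  ultimately show ?thesis using eq by linarith
qed

text \<open>The pressure gradient that produces the flux \<open>C\<close> at film thickness \<open>H\<close> and density \<open>r\<close>.\<close>

definition reynolds_slope :: "real \<Rightarrow> real \<Rightarrow> real \<Rightarrow> real \<Rightarrow> real \<Rightarrow> real" where
  "reynolds_slope \<mu> s C H r = 12 * \<mu> / H ^ 3 * (s * H / 2 - C / r)"

text \<open>The density is a continuous function \<open>R\<close> of the continuous pressure \<open>q\<close>, and \<open>q\<close> takes its least
  possible value \<open>p 0\<close> exactly where \<open>R\<close> vanishes.

  If \<open>C \<le> 0\<close>, then the pressure increases strictly wherever the density is positive. Starting from a
  point of positive density, it never comes back to \<open>p 0\<close>, so it increases all around the torus,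
  which is impossible. If \<open>C > 0\<close>, then the pressure decreases strictly to the right of a zero of \<open>R\<close>,
  where the term with \<open>C / R\<close> dominates, and falls below \<open>p 0\<close>. Hence the density is
  positive and the Reynolds equation can be solved for the pressure gradient, which is
  continuous.\<close>

lemma pressure_regularity:
  fixes p \<rho> h G :: "real \<Rightarrow> real"
  assumes p: "continuous_on {0..<rmax} p" "strict_mono_on {0..<rmax} p"
      "\<forall>z\<ge>p 0. \<exists>r\<in>{0..<rmax}. p r = z" and rmax: "0 < rmax"
    and h: "continuous_on UNIV h" "\<And>y. 0 < h y" "h 0 = h 1"
    and pos: "0 < \<mu>" "0 < s" "0 < M"
    and G: "integrable lborel G" "integral {0..1} G = 0"
    and \<rho>: "AE y in lborel. y \<in> {0..1} \<longrightarrow> 0 \<le> \<rho> y \<and> \<rho> y < rmax"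
    and pc: "AE y in lborel. y \<in> {0..1} \<longrightarrow> p (\<rho> y) = c + integral {0..y} G"
    and fl: "AE y in lborel. y \<in> {0..1} \<longrightarrow> \<rho> y * (s * h y / 2 - G y * h y ^ 3 / (12 * \<mu>)) = C"
    and mass: "(LINT y|lebesgue_on {0..1}. h y * \<rho> y) = M"
  obtains R where "0 < C" "continuous_on {0..1} R" "R 0 = R 1" "\<And>y. y \<in> {0..1} \<Longrightarrow> 0 < R y \<and> R y < rmax"
    "AE y in lborel. y \<in> {0..1} \<longrightarrow> \<rho> y = R y"
    "\<And>y. y \<in> {0..1} \<Longrightarrow> ((\<lambda>y. p (R y)) has_real_derivative reynolds_slope \<mu> s C (h y) (R y)) (at y within {0..1})"
    "AE y in lborel. y \<in> {0..1} \<longrightarrow> G y = reynolds_slope \<mu> s C (h y) (R y)"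
    "(LINT y|lborel. indicator {0..1} y * (h y * R y)) = M"
proof -
  define q where "q y = c + integral {0..y} G" for y
  have cq: "continuous_on {0..1} q"
    unfolding q_def by (intro continuous_intros primitive_continuous[OF G(1)])
  have q01: "q 0 = q 1" using G(2) by (simp add: q_def)
  note mono = strict_mono_onD[OF p(2)]
  have mono_le: "p a \<le> p b" if "a \<in> {0..<rmax}" "b \<in> {0..<rmax}" "a \<le> b" for a b
    using mono[of a b] that by (cases "a = b") auto
  have qge: "p 0 \<le> q y" if "y \<in> {0..1}" for y
  proof -
    have "0 \<le> q y - p 0"
    proof (rule AE_nonneg_imp_nonneg[OF _ _ that])
      show "AE y in lborel. y \<in> {0..1} \<longrightarrow> 0 \<le> q y - p 0"
        using pc \<rho>
      proof eventually_elim
        case (elim y)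
        then show ?case using mono_le[of 0 "\<rho> y"] rmax by (auto simp: q_def)
      qed
    qed (intro continuous_intros cq)
    then show ?thesis by simp
  qed
  define pinv where "pinv = the_inv_into {0..<rmax} p"
  define R where "R y = pinv (q y)" for y
  have inj: "inj_on p {0..<rmax}" using p(2) by (rule strict_mono_on_imp_inj_on)
  have pinv: "pinv (p r) = r" if "r \<in> {0..<rmax}" for r
    unfolding pinv_def by (rule the_inv_into_f_f[OF inj that])
  have R: "R y \<in> {0..<rmax}" "p (R y) = q y" if "y \<in> {0..1}" for y
  proof -
    have "\<exists>r\<in>{0..<rmax}. p r = q y" using p(3) qge[OF that] by blast
    then obtain r where "r \<in> {0..<rmax}" "p r = q y" by blast
    then show "R y \<in> {0..<rmax}" "p (R y) = q y" using pinv[of r] by (auto simp: R_def)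
  qed
  have R01: "R 0 = R 1" using q01 by (simp add: R_def)
  have cR: "continuous_on {0..1} R"
  proof -
    have "\<exists>m\<in>{0..1}. \<forall>y\<in>{0..1}. q y \<le> q m" by (rule continuous_attains_sup) (use cq in auto)
    then obtain m where m: "m \<in> {0..1}" "\<And>y. y \<in> {0..1} \<Longrightarrow> q y \<le> q m" by blast
    have cinv: "continuous_on (p ` {0..R m}) pinv"
      by (rule continuous_on_inv) (use R(1)[OF m(1)] p(1) pinv in \<open>auto intro: continuous_on_subset\<close>)
    have "q ` {0..1} \<subseteq> p ` {0..R m}"
    proof
      fix z assume "z \<in> q ` {0..1}"
      then obtain y where y: "y \<in> {0..1}" "z = q y" by blast
      have "R y \<le> R m"
      proof (rule ccontr)
        assume "\<not> R y \<le> R m"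
        then have "p (R m) < p (R y)" using mono[OF R(1)[OF m(1)] R(1)[OF y(1)]] by simp
        then show False using m(2)[OF y(1)] R(2) y m by simp
      qed
      then show "z \<in> p ` {0..R m}" using R[OF y(1)] y(2) by (intro image_eqI[of _ _ "R y"]) auto
    qed
    from continuous_on_compose2[OF cinv cq this] show ?thesis by (simp add: R_def[abs_def])
  qed
  have \<rho>R: "AE y in lborel. y \<in> {0..1} \<longrightarrow> \<rho> y = R y"
    using pc \<rho>
  proof eventually_elim
    case (elim y)
    show ?case
    proof
      assume y: "y \<in> {0..1}"
      then have "p (\<rho> y) = p (R y)" "\<rho> y \<in> {0..<rmax}" using elim R(2)[OF y] by (auto simp: q_def)
      then show "\<rho> y = R y" using inj R(1)[OF y] by (auto dest: inj_onD)
    qed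
  qed
  have flR: "AE y in lborel. y \<in> {0..1} \<longrightarrow> R y * (s * h y / 2 - G y * h y ^ 3 / (12 * \<mu>)) = C"
    using fl \<rho>R by eventually_elim auto
  have zero_iff: "q y = p 0" if "R y = 0" "y \<in> {0..1}" for y
    using R(2)[OF that(2)] that(1) by simp
  have pos_q: "p 0 < q y" if "0 < R y" "y \<in> {0..1}" for y
    using mono[of 0 "R y"] R[OF that(2)] that(1) rmax by auto
  have incr: "q a < q b" if "0 \<le> a" "a < b" "AE y in lborel. a < y \<and> y < b \<longrightarrow> 0 < G y" for a b
    using primitive_strict_increasing[OF G(1) that] by (simp add: q_def)
  have chR: "continuous_on {0..1} (\<lambda>y. h y * R y)"
    using h(1) by (intro continuous_intros cR) (auto intro: continuous_on_subset)
  have massR: "(LINT y|lborel. indicator {0..1} y * (h y * R y)) = M"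
  proof -
    have "(LINT y|lebesgue_on {0..1}. h y * \<rho> y) = (LINT y|lborel. indicator {0..1} y * (h y * R y))"
    proof (rule lebesgue_on_integral_eq(1))
      show "AE y in lborel. y \<in> {0..1} \<longrightarrow> h y * \<rho> y = indicator {0..1} y * (h y * R y)"
        using \<rho>R by eventually_elim auto
      have "integrable lborel (\<lambda>y. indicator {0..1} y *\<^sub>R (h y * R y))"
        by (rule borel_integrable_compact) (use chR in auto)
      then show "(\<lambda>y. indicator {0..1} y * (h y * R y)) \<in> borel_measurable borel" by auto
    qed auto
    with mass show ?thesis by simp
  qed
  obtain y0 where y0: "y0 \<in> {0..1}" "0 < R y0"
  proof -
    have "\<exists>y\<in>{0..1}. 0 < R y"
    proof (rule ccontr)
      assume "\<not> ?thesis"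
      then have "R y = 0" if "y \<in> {0..1}" for y using R(1)[OF that] that by force
      then have "(\<lambda>y. indicator {0..1} y * (h y * R y)) = (\<lambda>y. 0)" by (auto simp: fun_eq_iff indicator_def)
      then have "(LINT y|lborel. indicator {0..1} y * (h y * R y)) = 0" by simp
      then show False using massR pos(3) by simp
    qed
    then show ?thesis using that by blast
  qed
  have Gpos: "0 < G y" if "R y * (s * h y / 2 - G y * h y ^ 3 / (12 * \<mu>)) \<le> 0" "0 < R y" for y
  proof -
    have "s * h y / 2 \<le> G y * h y ^ 3 / (12 * \<mu>)"
      using that by (simp add: mult_le_0_iff)
    moreover have "0 < s * h y / 2" using pos h by simp
    ultimately have "0 < G y * h y ^ 3 / (12 * \<mu>)" by linarith
    then show ?thesis using pos h(2)[of y] by (simp add: zero_less_mult_iff zero_less_divide_iff)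
  qed
  have Cpos: "0 < C"
  proof (rule ccontr)
    assume "\<not> 0 < C"
    then have C: "C \<le> 0" by simp
    \<comment> \<open>going right from a point of positive density, a first zero would be reached by increasing pressure\<close>
    have stay: "0 < R y" if a: "a \<in> {0..1}" "0 < R a" and y: "y \<in> {a..1}" for a y
    proof (rule ccontr)
      assume "\<not> 0 < R y"
      then have Ry: "R y = 0" using R(1)[of y] a y by auto
      let ?Z = "{x \<in> {a..1}. R x = 0}"
      have "closed ?Z"
      proof -
        have "continuous_on {a..1} R" using cR by (rule continuous_on_subset) (use a in auto)
        from continuous_closed_preimage_constant[OF this, of 0] show ?thesis by (simp add: vimage_def)
      qed
      moreover have "?Z \<noteq> {}" "bdd_below ?Z" using y Ry by (auto intro!: bdd_belowI[of _ a])
      ultimately have z: "Inf ?Z \<in> ?Z" by (intro closed_contains_Inf)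
      define b where "b = Inf ?Z"
      have b: "b \<in> {a..1}" "R b = 0" using z by (auto simp: b_def)
      then have "a < b" using a by (cases "a = b") auto
      have "AE x in lborel. a < x \<and> x < b \<longrightarrow> 0 < G x"
        using flR
      proof eventually_elim
        case (elim x)
        show ?case
        proof
          assume x: "a < x \<and> x < b"
          then have x01: "x \<in> {0..1}" using a b by auto
          have "x \<notin> ?Z" using x cInf_lower[OF _ \<open>bdd_below ?Z\<close>, of x] by (auto simp: b_def)
          then have "0 < R x" using R(1)[OF x01] x a b by auto
          then show "0 < G x" using Gpos[of x] elim x01 C by simp
        qed
      qed
      from incr[OF _ \<open>a < b\<close> this] have "q a < q b" using a by simp
      moreover have "q b = p 0" using zero_iff b a by auto
      ultimately show False using qge[OF a(1)] by simp
    qed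
    have "0 < R 1" using stay[OF y0, of 1] y0 by simp
    then have "0 < R 0" using R01 by simp
    then have all: "0 < R y" if "y \<in> {0..1}" for y using stay[of 0 y] that by simp
    have "AE y in lborel. 0 < y \<and> y < 1 \<longrightarrow> 0 < G y"
      using flR
    proof eventually_elim
      case (elim y)
      then show ?case using Gpos[of y] all[of y] C by auto
    qed
    from incr[OF _ _ this] show False using q01 by simp
  qed
  \<comment> \<open>room to the right is needed; the point \<open>1\<close> is covered by periodicity\<close>
  have noz: "R a \<noteq> 0" if a: "a \<in> {0..<1}" for a
  proof
    assume Ra: "R a = 0"
    have cont: "continuous_on {0..1} (\<lambda>y. R y * (s * h y / 2))"
      using h(1) by (intro continuous_intros cR) (auto intro: continuous_on_subset)
    obtain d where d: "d > 0" "\<And>x. x \<in> {0..1} \<Longrightarrow> dist x a < d \<Longrightarrow> dist (R x * (s * h x / 2)) (R a * (s * h a / 2)) < C"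
      using cont a Cpos unfolding continuous_on_iff by (metis atLeastAtMost_iff atLeastLessThan_iff less_imp_le)
    define b where "b = min 1 (a + d)"
    have b: "a < b" "b \<le> 1" using d a by (auto simp: b_def)
    have "AE y in lborel. a < y \<and> y < b \<longrightarrow> 0 < - G y"
      using flR
    proof eventually_elim
      case (elim y)
      show ?case
      proof
        assume y: "a < y \<and> y < b"
        then have y01: "y \<in> {0..1}" using a b by auto
        have "dist y a < d" using y by (auto simp: b_def dist_real_def)
        then have "R y * (s * h y / 2) < C" using d(2)[OF y01] Ra by (simp add: dist_real_def)
        then have "R y * (G y * h y ^ 3 / (12 * \<mu>)) < 0"
          using elim y01 by (simp add: right_diff_distrib)
        moreover have "0 \<le> R y" using R(1)[OF y01] by simp
        ultimately have "G y * h y ^ 3 / (12 * \<mu>) < 0" by (meson mult_nonneg_nonneg not_le)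
        then show "0 < - G y" using pos h(2)[of y] by (simp add: mult_less_0_iff divide_less_0_iff)
      qed
    qed
    from primitive_strict_increasing[OF _ _ b(1) this] have "integral {0..b} G < integral {0..a} G"
      using G(1) a by simp
    then have "q b < q a" by (simp add: q_def)
    moreover have "q a = p 0" using zero_iff[OF Ra] a by simp
    ultimately show False using qge[of b] a b by simp
  qed
  have Rpos: "0 < R y" if "y \<in> {0..1}" for y
  proof -
    have "R y \<noteq> 0" using noz[of y] noz[of 0] R01 that by (cases "y = 1") auto
    then show ?thesis using R(1)[OF that] by simp
  qed
  define g where "g y = reynolds_slope \<mu> s C (h y) (R y)" for y
  have Gg: "AE y in lborel. y \<in> {0..1} \<longrightarrow> G y = g y"
    using flR
  proof eventually_elim
    case (elim y)
    show ?case
    proof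
      assume y: "y \<in> {0..1}"
      have "R y * (s * h y / 2 - G y * h y ^ 3 / (12 * \<mu>)) = C" using elim y by simp
      then have "s * h y / 2 - C / R y = G y * h y ^ 3 / (12 * \<mu>)"
        using Rpos[OF y] by (simp add: field_simps)
      then show "G y = g y" using pos h(2)[of y] by (simp add: g_def reynolds_slope_def)
    qed
  qed
  have cg: "continuous_on {0..1} g"
    unfolding g_def reynolds_slope_def
  proof (intro continuous_intros cR)
    show "continuous_on {0..1} h" using h(1) by (rule continuous_on_subset) simp
    then show "continuous_on {0..1} h" .
    show "\<forall>x\<in>{0..1}. h x ^ 3 \<noteq> 0" using h(2) by (metis less_irrefl power_not_zero)
    show "\<forall>x\<in>{0..1}. R x \<noteq> 0" using Rpos by (metis less_irrefl)
  qed simp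
  have ig: "integrable lborel (\<lambda>y. indicator {0..1} y * g y)"
    using borel_integrable_compact[OF compact_Icc cg] by simp
  have qg: "q y = c + integral {0..y} g" if y: "y \<in> {0..1}" for y
  proof -
    have "integral {0..y} G = (LINT x|lborel. indicator {0..y} x * G x)"
      by (rule integral_eq_LINT(2)[OF G(1)]) simp
    also have "\<dots> = (LINT x|lborel. indicator {0..y} x * (indicator {0..1} x * g x))"
    proof (rule integral_cong_AE)
      show "AE x in lborel. indicator {0..y} x * G x = indicator {0..y} x * (indicator {0..1} x * g x)"
        using Gg by eventually_elim (use y in \<open>auto simp: indicator_def\<close>)
    qed (use G(1) ig in auto)
    also have "\<dots> = integral {0..y} (\<lambda>x. indicator {0..1} x * g x)"
      by (rule integral_eq_LINT(2)[OF ig, symmetric]) simp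
    also have "\<dots> = integral {0..y} g"
      by (rule Henstock_Kurzweil_Integration.integral_cong) (use y in \<open>auto simp: indicator_def\<close>)
    finally show ?thesis by (simp add: q_def)
  qed
  have "((\<lambda>y. p (R y)) has_real_derivative g y) (at y within {0..1})" if y: "y \<in> {0..1}" for y
  proof -
    have "((\<lambda>y. c + integral {0..y} g) has_real_derivative 0 + g y) (at y within {0..1})"
      by (intro derivative_intros integral_has_real_derivative cg y)
    then have "((\<lambda>y. c + integral {0..y} g) has_real_derivative g y) (at y within {0..1})" by simp
    then show ?thesis
      by (rule has_field_derivative_transform_within[where d = 1]) (use qg R(2) y in auto)
  qed
  with that[OF Cpos cR R01 _ \<rho>R _ _ massR] Rpos R(1) Gg show ?thesis by (simp add: g_def)
qed

text \<open>A minimum at \<open>0\<close> is also one at \<open>1\<close>, and the two one-sided conditions combine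
  because the derivative is periodic.\<close>

lemma periodic_min_critical:
  fixes D d :: "real \<Rightarrow> real"
  assumes D: "\<And>y. y \<in> {0..1} \<Longrightarrow> (D has_real_derivative d y) (at y within {0..1})"
    and per: "D 0 = D 1" "d 0 = d 1"
  obtains m where "m \<in> {0..1}" "\<And>y. y \<in> {0..1} \<Longrightarrow> D m \<le> D y" "d m = 0"
proof -
  have "continuous_on {0..1} D"
    unfolding continuous_on_eq_continuous_within using DERIV_continuous[OF D] by blast
  then have "\<exists>m\<in>{0..1}. \<forall>y\<in>{0..1}. D m \<le> D y" by (intro continuous_attains_inf) auto
  then obtain m where m: "m \<in> {0..1}" "\<And>y. y \<in> {0..1} \<Longrightarrow> D m \<le> D y" by blast
  have right: "0 \<le> d x" if x: "x \<in> {0..<1}" "\<And>y. y \<in> {0..1} \<Longrightarrow> D x \<le> D y" for x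
  proof (rule ccontr)
    assume "\<not> 0 \<le> d x"
    then obtain e where e: "e > 0" "\<And>t. 0 < t \<Longrightarrow> x + t \<in> {0..1} \<Longrightarrow> t < e \<Longrightarrow> D (x + t) < D x"
      using has_real_derivative_neg_dec_right[OF D, of x] x(1) by auto
    define t where "t = min (e / 2) (1 - x)"
    have t: "0 < t" "t < e" "x + t \<in> {0..1}" using e x by (auto simp: t_def)
    show False using e(2)[OF t(1,3,2)] x(2)[OF t(3)] by simp
  qed
  have left: "d x \<le> 0" if x: "x \<in> {0<..1}" "\<And>y. y \<in> {0..1} \<Longrightarrow> D x \<le> D y" for x
  proof (rule ccontr)
    assume "\<not> d x \<le> 0"
    then obtain e where e: "e > 0" "\<And>t. 0 < t \<Longrightarrow> x - t \<in> {0..1} \<Longrightarrow> t < e \<Longrightarrow> D (x - t) < D x"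
      using has_real_derivative_pos_inc_left[OF D, of x] x(1) by auto
    define t where "t = min (e / 2) x"
    have t: "0 < t" "t < e" "x - t \<in> {0..1}" using e x by (auto simp: t_def)
    show False using e(2)[OF t(1,3,2)] x(2)[OF t(3)] by simp
  qed
  have "d m = 0"
  proof (cases "m = 0 \<or> m = 1")
    case True
    then have "D 0 = D m" "D 1 = D m" using per by auto
    then have "0 \<le> d 0" "d 1 \<le> 0" using right[of 0] left[of 1] m(2) by auto
    then show ?thesis using True per by auto
  next
    case False
    then show ?thesis using right[of m] left[of m] m by force
  qed
  then show ?thesis using that m by blast
qed

text \<open>At a minimum of the pressure difference the two pressure gradients agree, that is
  \<open>C1 / R1 = C2 / R2\<close>. So the density with the larger flux is the larger one there, and hence
  everywhere because the minimum of the pressure difference is nonnegative.\<close>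

lemma reynolds_comparison:
  fixes p h R1 R2 :: "real \<Rightarrow> real"
  assumes p: "strict_mono_on {0..<rmax} p" and h: "\<And>y. 0 < h y" "h 0 = h 1"
    and \<mu>: "0 < \<mu>" and C: "0 < C2" "C2 \<le> C1"
    and R1': "\<forall>y\<in>{0..1}. 0 < R1 y \<and> R1 y < rmax" "R1 0 = R1 1"
      "\<forall>y\<in>{0..1}. ((\<lambda>y. p (R1 y)) has_real_derivative reynolds_slope \<mu> s C1 (h y) (R1 y)) (at y within {0..1})"
    and R2': "\<forall>y\<in>{0..1}. 0 < R2 y \<and> R2 y < rmax" "R2 0 = R2 1"
      "\<forall>y\<in>{0..1}. ((\<lambda>y. p (R2 y)) has_real_derivative reynolds_slope \<mu> s C2 (h y) (R2 y)) (at y within {0..1})"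
    and y: "y \<in> {0..1}"
  shows "R2 y \<le> R1 y" "C2 < C1 \<Longrightarrow> R2 y < R1 y"
proof -
  note R1 = R1'[rule_format] and R2 = R2'[rule_format]
  note mono = strict_mono_onD[OF p]
  have less_iff: "p (R1 y) < p (R2 y) \<longleftrightarrow> R1 y < R2 y" "p (R2 y) < p (R1 y) \<longleftrightarrow> R2 y < R1 y"
    if "y \<in> {0..1}" for y
    using mono[of "R1 y" "R2 y"] mono[of "R2 y" "R1 y"] R1(1)[OF that] R2(1)[OF that]
    by (cases "R1 y" "R2 y" rule: linorder_cases; force)+
  let ?D = "\<lambda>y. p (R1 y) - p (R2 y)"
  let ?d = "\<lambda>y. reynolds_slope \<mu> s C1 (h y) (R1 y) - reynolds_slope \<mu> s C2 (h y) (R2 y)"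
  obtain m where m: "m \<in> {0..1}" "\<And>y. y \<in> {0..1} \<Longrightarrow> ?D m \<le> ?D y" "?d m = 0"
  proof (rule periodic_min_critical[of ?D ?d])
    show "(?D has_real_derivative ?d y) (at y within {0..1})" if "y \<in> {0..1}" for y
      by (intro derivative_intros R1(3) R2(3) that)
  qed (use R1(2) R2(2) h(2) in auto)
  have "12 * \<mu> / h m ^ 3 * (C2 / R2 m - C1 / R1 m) = 0"
    using m(3) unfolding reynolds_slope_def right_diff_distrib by linarith
  moreover have "12 * \<mu> / h m ^ 3 \<noteq> 0" using \<mu> h(1)[of m] by simp
  ultimately have "C2 / R2 m = C1 / R1 m" by (metis eq_iff_diff_eq_0 mult_eq_0_iff)
  then have eq: "C2 * R1 m = C1 * R2 m" using R1(1)[OF m(1)] R2(1)[OF m(1)] by (simp add: field_simps)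
  have r2: "0 < R2 m" using R2(1)[OF m(1)] by simp
  have "C2 * R2 m \<le> C2 * R1 m" unfolding eq using C r2 by (intro mult_right_mono) auto
  then have "R2 m \<le> R1 m" using C by simp
  then have "0 \<le> ?D m" using less_iff(1)[OF m(1)] by (simp add: not_less[symmetric])
  then have "0 \<le> ?D y" using m(2)[OF y] by linarith
  then show "R2 y \<le> R1 y" using less_iff(1)[OF y] by (simp add: not_less[symmetric])
  assume "C2 < C1"
  then have "C2 * R2 m < C2 * R1 m" unfolding eq using r2 by (intro mult_strict_right_mono) auto
  then have "R2 m < R1 m" using C by simp
  then have "0 < ?D m" using less_iff(2)[OF m(1)] by simp
  then have "0 < ?D y" using m(2)[OF y] by linarith
  then show "R2 y < R1 y" using less_iff(2)[OF y] by simp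
qed

lemma mass_strict_mono:
  fixes f g h :: "real \<Rightarrow> real"
  assumes c: "continuous_on {0..1} f" "continuous_on {0..1} g" "continuous_on UNIV h" and h: "\<And>y. 0 < h y"
    and lt: "\<And>y. y \<in> {0..1} \<Longrightarrow> f y < g y"
  shows "(LINT y|lborel. indicator {0..1} y * (h y * f y)) < (LINT y|lborel. indicator {0..1} y * (h y * g y))"
proof -
  have ch: "continuous_on {0..1} h" using c(3) by (rule continuous_on_subset) simp
  have i: "integrable lborel (\<lambda>y. indicator {0..1} y * (h y * k y))" if "continuous_on {0..1} k" for k
    using borel_integrable_compact[OF compact_Icc continuous_on_mult[OF ch that]] by simp
  let ?f = "\<lambda>y. indicator {0..1} y * (h y * (g y - f y))"
  have i0: "integrable lborel ?f" by (intro i continuous_intros c)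
  have nn: "0 \<le> ?f y" for y using lt[of y] h[of y] by (auto simp: indicator_def less_imp_le)
  have "(LINT y|lborel. ?f y) \<noteq> 0"
  proof
    assume "(LINT y|lborel. ?f y) = 0"
    then have "AE y in lborel. ?f y = 0" using integral_nonneg_eq_0_iff_AE[OF i0] nn by simp
    then have "AE y in lborel. y \<notin> {0<..<1::real}"
    proof eventually_elim
      case (elim y) then show ?case using lt[of y] h[of y] by (auto simp: indicator_def)
    qed
    then show False by (rule not_null_interval[rotated]) simp
  qed
  moreover have "0 \<le> (LINT y|lborel. ?f y)" by (rule Bochner_Integration.integral_nonneg) (rule nn)
  moreover have "(LINT y|lborel. ?f y) = (LINT y|lborel. indicator {0..1} y * (h y * g y)) - (LINT y|lborel. indicator {0..1} y * (h y * f y))"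
    using Bochner_Integration.integral_diff[OF i[OF c(2)] i[OF c(1)]] by (simp add: algebra_simps)
  ultimately show ?thesis by linarith
qed

theorem mainTheorem3:
  fixes h p :: "real \<Rightarrow> real"
    and \<nu> \<mu> s M rmax :: real
    and \<rho>1 \<rho>2 :: "real \<Rightarrow> real"
    and v1 v2 :: "real \<times> real \<Rightarrow> real"
  assumes "0 < \<nu>" and "\<nu> \<le> 1"
    and "C2_holder_torus \<nu> h" and "\<And>y. h y > 0"
    and "\<mu> > 0" and "s > 0" and "M > 0" and "rmax > 0"
    and "continuous_on {0..<rmax} p"
    and "p C1_differentiable_on {0<..<rmax}"
    and "p 0 \<ge> 0"
    and "\<And>r. r \<in> {0<..<rmax} \<Longrightarrow> deriv p r > 0"
    and "filterlim p at_top (at_left rmax)"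
    and "is_solution h p \<mu> s M rmax \<rho>1 v1"
    and "is_solution h p \<mu> s M rmax \<rho>2 v2"
  shows "(AE y in lebesgue_on {0..1}. \<rho>1 y = \<rho>2 y) \<and> (AE x in lebesgue_on (Q h). v1 x = v2 x)"
proof -
  have h: "continuous_on UNIV h" "periodic1 h" "\<And>y. 0 < h y"
    using assms(3,4) C_diff_continuous by (auto simp: C2_holder_torus_def)
  interpret periodic_fun_simple' h by (rule h(2))
  have h01: "h 0 = h 1" by (simp add: of_1)
  have p: "strict_mono_on {0..<rmax} p" by (rule strict_mono_on_if_deriv_pos[OF assms(9,10,12)])
  have range: "\<forall>z\<ge>p 0. \<exists>r\<in>{0..<rmax}. p r = z"
    using blowup_range[OF assms(9,8,13)] by metis
  have reg: "\<exists>G C R. 0 < C \<and> continuous_on {0..1} R \<and> R 0 = R 1 \<and> (\<forall>y\<in>{0..1}. 0 < R y \<and> R y < rmax) \<and>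
      (AE y in lborel. y \<in> {0..1} \<longrightarrow> \<rho> y = R y) \<and>
      (\<forall>y\<in>{0..1}. ((\<lambda>y. p (R y)) has_real_derivative reynolds_slope \<mu> s C (h y) (R y)) (at y within {0..1})) \<and>
      (AE y in lborel. y \<in> {0..1} \<longrightarrow> G y = reynolds_slope \<mu> s C (h y) (R y)) \<and>
      (LINT y|lborel. indicator {0..1} y * (h y * R y)) = M \<and>
      (AE x in lborel. x \<in> Q h \<longrightarrow> v x = G (fst x) / (2 * \<mu>) * (snd x * (snd x - h (fst x))) + s * (1 - snd x / h (fst x)))"
    if sol: "is_solution h p \<mu> s M rmax \<rho> v" for \<rho> v
  proof -
    obtain G c C where G: "integrable lborel G" "integral {0..1} G = 0"
      and pc: "AE y in lborel. y \<in> {0..1} \<longrightarrow> p (\<rho> y) = c + integral {0..y} G"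
      and fl: "AE y in lborel. y \<in> {0..1} \<longrightarrow> \<rho> y * (s * h y / 2 - G y * h y ^ 3 / (12 * \<mu>)) = C"
      and vG: "AE x in lborel. x \<in> Q h \<longrightarrow> v x = G (fst x) / (2 * \<mu>) * (snd x * (snd x - h (fst x))) + s * (1 - snd x / h (fst x))"
      by (rule solution_reduction[OF h assms(5) sol]) (rule that)
    have "AE y in lebesgue_on {0..1}. 0 \<le> \<rho> y \<and> \<rho> y < rmax" and mass: "(LINT y|lebesgue_on {0..1}. h y * \<rho> y) = M"
      using sol by (auto simp: is_solution_def)
    then have \<rho>: "AE y in lborel. y \<in> {0..1} \<longrightarrow> 0 \<le> \<rho> y \<and> \<rho> y < rmax"
      by (subst (asm) AE_lebesgue_on_iff) auto
    obtain R where "0 < C" "continuous_on {0..1} R" "R 0 = R 1" "\<And>y. y \<in> {0..1} \<Longrightarrow> 0 < R y \<and> R y < rmax"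
      "AE y in lborel. y \<in> {0..1} \<longrightarrow> \<rho> y = R y"
      "\<And>y. y \<in> {0..1} \<Longrightarrow> ((\<lambda>y. p (R y)) has_real_derivative reynolds_slope \<mu> s C (h y) (R y)) (at y within {0..1})"
      "AE y in lborel. y \<in> {0..1} \<longrightarrow> G y = reynolds_slope \<mu> s C (h y) (R y)"
      "(LINT y|lborel. indicator {0..1} y * (h y * R y)) = M"
      by (rule pressure_regularity[OF assms(9) p range assms(8) h(1,3) h01 assms(5,6,7) G \<rho> pc fl mass], rule that)
    then show ?thesis using vG by (intro exI[of _ G] exI[of _ C] exI[of _ R]) simp
  qed
  obtain G1 C1 R1 where 1: "0 < C1" "continuous_on {0..1} R1" "R1 0 = R1 1" "\<forall>y\<in>{0..1}. 0 < R1 y \<and> R1 y < rmax"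
      "AE y in lborel. y \<in> {0..1} \<longrightarrow> \<rho>1 y = R1 y"
      "\<forall>y\<in>{0..1}. ((\<lambda>y. p (R1 y)) has_real_derivative reynolds_slope \<mu> s C1 (h y) (R1 y)) (at y within {0..1})"
      "AE y in lborel. y \<in> {0..1} \<longrightarrow> G1 y = reynolds_slope \<mu> s C1 (h y) (R1 y)"
      "(LINT y|lborel. indicator {0..1} y * (h y * R1 y)) = M"
      "AE x in lborel. x \<in> Q h \<longrightarrow> v1 x = G1 (fst x) / (2 * \<mu>) * (snd x * (snd x - h (fst x))) + s * (1 - snd x / h (fst x))"
    using reg[OF assms(14)] by blast
  obtain G2 C2 R2 where 2: "0 < C2" "continuous_on {0..1} R2" "R2 0 = R2 1" "\<forall>y\<in>{0..1}. 0 < R2 y \<and> R2 y < rmax"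
      "AE y in lborel. y \<in> {0..1} \<longrightarrow> \<rho>2 y = R2 y"
      "\<forall>y\<in>{0..1}. ((\<lambda>y. p (R2 y)) has_real_derivative reynolds_slope \<mu> s C2 (h y) (R2 y)) (at y within {0..1})"
      "AE y in lborel. y \<in> {0..1} \<longrightarrow> G2 y = reynolds_slope \<mu> s C2 (h y) (R2 y)"
      "(LINT y|lborel. indicator {0..1} y * (h y * R2 y)) = M"
      "AE x in lborel. x \<in> Q h \<longrightarrow> v2 x = G2 (fst x) / (2 * \<mu>) * (snd x * (snd x - h (fst x))) + s * (1 - snd x / h (fst x))"
    using reg[OF assms(15)] by blast
  note cmp12 = reynolds_comparison[OF p h(3) h01 assms(5) _ _ 1(4,3,6) 2(4,3,6)]
  note cmp21 = reynolds_comparison[OF p h(3) h01 assms(5) _ _ 2(4,3,6) 1(4,3,6)]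
  have C: "C1 = C2"
  proof (cases C1 C2 rule: linorder_cases)
    case less
    then have "R1 y < R2 y" if "y \<in> {0..1}" for y using cmp21(2)[OF 1(1) _ that] by simp
    from mass_strict_mono[OF 1(2) 2(2) h(1,3) this] show ?thesis using 1(8) 2(8) by simp
  next
    case greater
    then have "R2 y < R1 y" if "y \<in> {0..1}" for y using cmp12(2)[OF 2(1) _ that] by simp
    from mass_strict_mono[OF 2(2) 1(2) h(1,3) this] show ?thesis using 1(8) 2(8) by simp
  qed
  have R: "R1 y = R2 y" if "y \<in> {0..1}" for y
    using cmp12(1)[OF 2(1) _ that] cmp21(1)[OF 1(1) _ that] C by simp
  have "AE y in lborel. y \<in> {0..1} \<longrightarrow> \<rho>1 y = \<rho>2 y"
    using 1(5) 2(5) by eventually_elim (use R in auto)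
  moreover have "AE y in lborel. y \<in> {0..1} \<longrightarrow> G1 y = G2 y"
    using 1(7) 2(7) by eventually_elim (use R C in auto)
  from AE_plane_fst[OF this] 1(9) 2(9) have "AE x in lborel. x \<in> Q h \<longrightarrow> v1 x = v2 x"
    by eventually_elim (auto simp: Q_def)
  ultimately show ?thesis
    using AE_lebesgue_on_iff[OF Q_borel[OF h(1)]] AE_lebesgue_on_iff[of "{0..1::real}"] by simp
qed

end
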